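(* Let $(L_t)_{t\ge0}$ be a $d$-dimensional Lévy process with Lévy triplet $(b,Q,\nu)$. Denote by $(A,\mathcal{D}(A))$ its generator and fix $\alpha\in[0,2]$ such that $\int_{0<|y|\le1}|y|^\alpha\,\nu(dy)<\infty$. (i) $C_0^2(\mathbb{R}^d)\subseteq\mathcal{D}(A)$ and for $f\in C_0^2(\mathbb{R}^d)$, $x\in\mathbb{R}^d$, $$Af(x)=b\cdot\nabla f(x)+\tfrac12\operatorname{tr}(Q\nabla^2f(x))+\int_{\mathbb{R}^d\setminus\{0\}}\left(f(x+y)-f(x)-\nabla f(x)\cdot y\,\mathbf{1}_{(0,1)}(|y|)\right)\nu(dy).$$ (ii) If $Q=0$, $\alpha\in[0,1]$ and $b=\int_{0<|y|<1}y\,\nu(dy)$, then $\mathcal{C}_0^\alpha\subseteq\mathcal{D}(A)$ and for $f\in\mathcal{C}_0^\alpha$, $x\in\mathbb{R}^d$, $$Af(x)=\int_{\mathbb{R}^d\setminus\{0\}}\left(f(x+y)-f(x)\right)\nu(dy).$$ (iii) If $Q=0$ and $\alpha\in[1,2]$, then $\mathcal{C}_0^{1,\alpha-1}\subseteq\mathcal{D}(A)$ and for $f\in\mathcal{C}_0^{1,\alpha-1}$, $x\in\mathbb{R}^d$, $$Af(x)=b\cdot\nabla f(x)+\int_{\mathbb{R}^d\setminus\{0\}}\left(f(x+y)-f(x)-\nabla f(x)\cdot y\,\mathbf{1}_{(0,1)}(|y|)\right)\nu(dy).$$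
   Context: A Lévy process has stationary independent increments, $L_0=0$ a.s., and càdlàg paths. Its triplet $(b,Q,\nu)$ is determined by $\mathbb{E}e^{i\xi\cdot L_1}=e^{-\psi(\xi)}$ with $$\psi(\xi)=-ib\cdot\xi+\tfrac12\xi\cdot Q\xi+\int_{\mathbb{R}^d\setminus\{0\}}\left(1-e^{iy\cdot\xi}+iy\cdot\xi\,\mathbf{1}_{(0,1)}(|y|)\right)\nu(dy),$$ where $b\in\mathbb{R}^d$, $Q\in\mathbb{R}^{d\times d}$ is symmetric positive semidefinite and $\nu$ is a measure on $\mathbb{R}^d\setminus\{0\}$ with $\int\min\{|y|^2,1\}\,\nu(dy)<\infty$. $C_0(\mathbb{R}^d)$ denotes the continuous functions $\mathbb{R}^d\to\mathbb{R}$ vanishing at infinity, and $C_0^k(\mathbb{R}^d)$ the functions which together with all partial derivatives up to and including order $k$ are in $C_0(\mathbb{R}^d)$. The generator has as domain $\mathcal{D}(A)$ the set of $f\in C_0(\mathbb{R}^d)$ for which $\frac1t(\mathbb{E}f(x+L_t)-f(x))$ converges as $t\to0$, uniformly in $x\in\mathbb{R}^d$, to a function in $C_0(\mathbb{R}^d)$, and $Af$ is this limit. Hölder spaces: for $\alpha\in[0,1]$, $\mathcal{C}_0^\alpha:=\{f\in C_0(\mathbb{R}^d):\ \sup_{x\ne y}\frac{|f(x)-f(y)|}{|x-y|^\alpha}<\infty\}$ and $\mathcal{C}_0^{1,\alpha}:=\{f\in C_0^1(\mathbb{R}^d):\ \partial_jf\in\mathcal{C}_0^\alpha\text{ for all }j=1,\dots,d\}$.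 *)

theory Defs
  imports "HOL-Probability.Probability"
begin

text \<open>The time parameter is real; only the values \<open>L t\<close> with \<open>t \<ge> 0\<close> are ever used.\<close>

locale levy_process = prob_space M
  for M :: "'w measure" and L :: "real \<Rightarrow> 'w \<Rightarrow> real ^ 'n" +
  assumes random_variable_L: "\<And>t. 0 \<le> t \<Longrightarrow> random_variable borel (L t)"
    and start_zero: "AE \<omega> in M. L 0 \<omega> = 0"
    and stationary_increments: "\<And>s h. 0 \<le> s \<Longrightarrow> 0 \<le> h \<Longrightarrow>
      distr M borel (\<lambda>\<omega>. L (s + h) \<omega> - L s \<omega>) = distr M borel (\<lambda>\<omega>. L h \<omega> - L 0 \<omega>)"
    and independent_increments: "\<And>(n::nat) (s::nat \<Rightarrow> real).
      0 \<le> s 0 \<Longrightarrow> (\<And>i. i < n \<Longrightarrow> s i < s (Suc i)) \<Longrightarrow>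
      indep_vars (\<lambda>_. borel) (\<lambda>i \<omega>. L (s (Suc i)) \<omega> - L (s i) \<omega>) {..<n}"
    and right_continuous: "\<And>\<omega> t. \<omega> \<in> space M \<Longrightarrow> 0 \<le> t \<Longrightarrow>
      continuous (at_right t) (\<lambda>s. L s \<omega>)"
    and left_limits: "\<And>\<omega> t. \<omega> \<in> space M \<Longrightarrow> 0 < t \<Longrightarrow>
      \<exists>l. ((\<lambda>s. L s \<omega>) \<longlongrightarrow> l) (at_left t)"

text \<open>A measure on \<open>\<real>\<^sup>d - {0}\<close> is a measure whose \<open>\<sigma>\<close>-algebra is the Borel \<open>\<sigma>\<close>-algebra of that
  subspace. In particular \<open>space \<nu> = - {0}\<close>, so every integral with respect to \<open>\<nu>\<close> is over
  \<open>\<real>\<^sup>d - {0}\<close>.\<close>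

definition levy_measure :: "(real ^ 'n) measure \<Rightarrow> bool" where
  "levy_measure \<nu> \<longleftrightarrow>
     sets \<nu> = sets (restrict_space borel (- {0})) \<and>
     (\<integral>\<^sup>+ y. ennreal (min ((norm y)\<^sup>2) 1) \<partial>\<nu>) < \<infinity>"

definition levy_triplet :: "real ^ 'n \<Rightarrow> real ^ 'n ^ 'n \<Rightarrow> (real ^ 'n) measure \<Rightarrow> bool" where
  "levy_triplet b Q \<nu> \<longleftrightarrow>
     transpose Q = Q \<and> (\<forall>\<xi>. 0 \<le> \<xi> \<bullet> (Q *v \<xi>)) \<and> levy_measure \<nu>"

definition char_exponent ::
  "real ^ 'n \<Rightarrow> real ^ 'n ^ 'n \<Rightarrow> (real ^ 'n) measure \<Rightarrow> real ^ 'n \<Rightarrow> complex" where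
  "char_exponent b Q \<nu> \<xi> =
     - \<i> * complex_of_real (b \<bullet> \<xi>) + complex_of_real (1/2 * (\<xi> \<bullet> (Q *v \<xi>)))
     + (LINT y|\<nu>. 1 - exp (\<i> * complex_of_real (y \<bullet> \<xi>))
          + \<i> * complex_of_real (y \<bullet> \<xi> * indicator {0<..<1} (norm y)))"

definition has_levy_triplet ::
  "'w measure \<Rightarrow> (real \<Rightarrow> 'w \<Rightarrow> real ^ 'n) \<Rightarrow>
   real ^ 'n \<Rightarrow> real ^ 'n ^ 'n \<Rightarrow> (real ^ 'n) measure \<Rightarrow> bool" where
  "has_levy_triplet M L b Q \<nu> \<longleftrightarrow>
     levy_triplet b Q \<nu> \<and>
     (\<forall>\<xi>. (LINT \<omega>|M. exp (\<i> * complex_of_real (\<xi> \<bullet> L 1 \<omega>))) = exp (- char_exponent b Q \<nu> \<xi>))"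

definition C0 :: "(real ^ 'n \<Rightarrow> real) set" where
  "C0 = {f. continuous_on UNIV f \<and> (f \<longlongrightarrow> 0) at_infinity}"

text \<open>The partial derivative is classical, i.e. the derivative at \<open>0\<close> of \<open>h \<mapsto> f (x + h e\<^sub>j)\<close>;
  \<open>partial\<close> is meaningful only where \<open>has_partial\<close> holds.\<close>

definition has_partial :: "'n \<Rightarrow> (real ^ 'n \<Rightarrow> real) \<Rightarrow> real ^ 'n \<Rightarrow> bool" where
  "has_partial j f x \<longleftrightarrow> (\<lambda>h::real. f (x + h *\<^sub>R axis j 1)) differentiable (at 0)"

definition partial :: "'n \<Rightarrow> (real ^ 'n \<Rightarrow> real) \<Rightarrow> real ^ 'n \<Rightarrow> real" where
  "partial j f x = deriv (\<lambda>h::real. f (x + h *\<^sub>R axis j 1)) 0"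

definition gradient :: "(real ^ 'n \<Rightarrow> real) \<Rightarrow> real ^ 'n \<Rightarrow> real ^ 'n" where
  "gradient f x = (\<chi> j. partial j f x)"

definition hessian :: "(real ^ 'n \<Rightarrow> real) \<Rightarrow> real ^ 'n \<Rightarrow> real ^ 'n ^ 'n" where
  "hessian f x = (\<chi> i j. partial i (partial j f) x)"

primrec C0_diff :: "nat \<Rightarrow> (real ^ 'n \<Rightarrow> real) set" where
  "C0_diff 0 = C0"
| "C0_diff (Suc k) = {f \<in> C0. \<forall>j. (\<forall>x. has_partial j f x) \<and> partial j f \<in> C0_diff k}"

definition C0_holder :: "real \<Rightarrow> (real ^ 'n \<Rightarrow> real) set" where
  "C0_holder \<alpha> =
     {f \<in> C0. bdd_above {\<bar>f x - f y\<bar> / norm (x - y) powr \<alpha> |x y. x \<noteq> y}}"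

definition C0_1_holder :: "real \<Rightarrow> (real ^ 'n \<Rightarrow> real) set" where
  "C0_1_holder \<alpha> = {f \<in> C0_diff 1. \<forall>j. partial j f \<in> C0_holder \<alpha>}"

definition generator_limit ::
  "'w measure \<Rightarrow> (real \<Rightarrow> 'w \<Rightarrow> real ^ 'n) \<Rightarrow> (real ^ 'n \<Rightarrow> real) \<Rightarrow> (real ^ 'n \<Rightarrow> real) \<Rightarrow> bool" where
  "generator_limit M L f g \<longleftrightarrow>
     uniform_limit UNIV (\<lambda>t x. (1 / t) * ((LINT \<omega>|M. f (x + L t \<omega>)) - f x)) g (at_right 0)"

definition generator_domain ::
  "'w measure \<Rightarrow> (real \<Rightarrow> 'w \<Rightarrow> real ^ 'n) \<Rightarrow> (real ^ 'n \<Rightarrow> real) set" where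
  "generator_domain M L = {f \<in> C0. \<exists>g \<in> C0. generator_limit M L f g}"

definition generator ::
  "'w measure \<Rightarrow> (real \<Rightarrow> 'w \<Rightarrow> real ^ 'n) \<Rightarrow> (real ^ 'n \<Rightarrow> real) \<Rightarrow> real ^ 'n \<Rightarrow> real" where
  "generator M L f = (THE g. g \<in> C0 \<and> generator_limit M L f g)"

end

theory Submission
  imports Defs
begin

text \<open>
  The proof rests on Dynkin's formula \<open>E f(x + L_t) - f x = \<integral> (A f)(x + y) \<eta>_t(dy)\<close>, where \<open>\<eta>_t\<close> is the
  occupation measure of \<open>L\<close> on \<open>[0, t]\<close>. Since \<open>E exp(i \<xi> \<bullet> L_s) = exp(-s \<psi>(\<xi>))\<close>, it holds
  for \<open>f x = cos(\<xi> \<bullet> x)\<close>. By Fubini it passes to Gaussians, which are mixtures of cosines, then to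
  convolutions of bounded functions with Gaussians, and by dominated convergence to every \<open>f\<close> in one
  of the three classes, because the Gaussian averages of \<open>f\<close> satisfy the same Hoelder estimates as \<open>f\<close>.
  Once \<open>A f\<close> is in \<open>C0\<close>, hence uniformly continuous, dividing by \<open>t\<close> and using \<open>L_s \<rightarrow> 0\<close> in probability
  gives the uniform convergence that defines the generator.
\<close>

section \<open>Integral calculus and the Gaussian density\<close>

text \<open>The triplet is given by a Fourier transform alone, so nothing about the jumps of the
  paths is directly accessible. For fixed \<open>t\<close> the argument therefore works with two
  finite measures, the law of \<open>L t\<close> and the occupation measure, tied together by one
  identity between their Fourier transforms; the locale \<open>dynkin_measures\<close> isolates
  this. Each enlargement of the class of functions is then a Fubini or dominated convergence
  argument, and the obstacle is always the integral against \<open>\<nu>\<close>, whose mass near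
  the origin may be infinite: the compensated increment must be bounded uniformly along the
  approximation. For Gaussian mixtures the bound is a multiple of
  \<open>min ((norm y)\<^sup>2) 1\<close>; for the limit functions it is a multiple of
  \<open>levy_weight \<alpha>\<close>, and its constant survives the averaging because an average
  against a probability density increases neither a supremum nor a Hoelder constant. The averages
  are used in two forms: with the translation on the Gaussian they are smooth and satisfy the
  formula, with the translation on \<open>f\<close> they inherit its bounds.\<close>

lemma has_real_derivative_integral:
  fixes f f' :: "real \<Rightarrow> 'a \<Rightarrow> real"
  assumes int: "\<And>s. \<bar>s\<bar> < 1 \<Longrightarrow> integrable M (f s)"
    and der: "\<And>s z. \<bar>s\<bar> < 1 \<Longrightarrow> ((\<lambda>s. f s z) has_real_derivative f' s z) (at s)"
    and bound: "\<And>s z. \<bar>s\<bar> < 1 \<Longrightarrow> \<bar>f' s z\<bar> \<le> B z"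
    and B: "integrable M B"
  shows "((\<lambda>s. LINT z|M. f s z) has_real_derivative (LINT z|M. f' 0 z)) (at 0)"
proof -
  let ?S = "{-1<..<1::real}"
  have at: "at 0 within ?S = at 0"
    by (rule at_within_open) auto
  have lim: "((\<lambda>s. (f s z - f 0 z) / (s - 0)) \<longlongrightarrow> f' 0 z) (at 0 within ?S)" for z
    using der[of 0 z] by (simp add: has_field_derivative_iff at)
  have "((\<lambda>s. ((LINT z|M. f s z) - (LINT z|M. f 0 z)) / (s - 0)) \<longlongrightarrow> (LINT z|M. f' 0 z)) (at 0 within ?S)"
    unfolding tendsto_at_iff_sequentially
  proof safe
    fix X :: "nat \<Rightarrow> real"
    assume X: "\<forall>i. X i \<in> ?S - {0}" "X \<longlonglongrightarrow> 0"
    then have X1: "\<bar>X i\<bar> < 1" and X0: "X i \<noteq> 0" for i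
      by (auto simp: abs_less_iff)
    have conv: "(\<lambda>i. (f (X i) z - f 0 z) / X i) \<longlonglongrightarrow> f' 0 z" for z
      using lim[of z] X unfolding tendsto_at_iff_sequentially by (auto simp: o_def)
    \<comment> \<open>The mean value inequality turns the bound on the derivative into a bound on
      all difference quotients, which is what dominated convergence needs.\<close>
    have bd: "\<bar>(f (X i) z - f 0 z) / X i\<bar> \<le> B z" for i z
    proof -
      have "norm (f (X i) z - f 0 z) \<le> B z * norm (X i - 0)"
        by (rule field_differentiable_bound[of ?S _ "\<lambda>s. f' s z"])
          (use X1[of i] in \<open>auto intro!: DERIV_subset[OF der] bound simp: abs_less_iff\<close>)
      then show ?thesis
        using X0[of i] by (simp add: field_simps)
    qed
    have [measurable]: "f (X i) \<in> borel_measurable M" "f 0 \<in> borel_measurable M" for i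
      using int X1 by auto
    have "(\<lambda>i. LINT z|M. (f (X i) z - f 0 z) / X i) \<longlonglongrightarrow> (LINT z|M. f' 0 z)"
      by (rule integral_dominated_convergence[where w = B])
        (use B conv bd in \<open>auto intro: borel_measurable_LIMSEQ_real[OF conv]\<close>)
    also have "(\<lambda>i. LINT z|M. (f (X i) z - f 0 z) / X i)
        = (\<lambda>i. ((LINT z|M. f (X i) z) - (LINT z|M. f 0 z)) / X i)"
      using int X1 by (simp add: fun_eq_iff)
    finally show "((\<lambda>s. ((LINT z|M. f s z) - (LINT z|M. f 0 z)) / (s - 0)) \<circ> X) \<longlonglongrightarrow> (LINT z|M. f' 0 z)"
      by (simp add: o_def)
  qed
  then show ?thesis
    by (simp add: has_field_derivative_iff at)
qed

text \<open>A single mean value step instead of a Taylor expansion, so that only the oscillation of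
  \<open>p'\<close> has to be controlled. It serves Gaussians, with \<open>K\<close> of order |y|^2,
  as well as functions with Hoelder gradient, with \<open>K\<close> of order |y|^\<alpha>.\<close>

lemma mean_value_linearization:
  fixes p p' :: "real \<Rightarrow> real"
  assumes "\<And>s. 0 \<le> s \<Longrightarrow> s \<le> 1 \<Longrightarrow> (p has_real_derivative p' s) (at s)"
    and "\<And>s. 0 < s \<Longrightarrow> s < 1 \<Longrightarrow> \<bar>p' s - p' 0\<bar> \<le> K"
  shows "\<bar>p 1 - p 0 - p' 0\<bar> \<le> K"
proof -
  obtain s where "0 < s" "s < 1" "p 1 - p 0 = (1 - 0) * p' s"
    using MVT2[of 0 1 p p'] assms(1) by auto
  then show ?thesis using assms(2)[of s] by simp
qed

text \<open>\<open>lborel\<close> is the image of the product of one-dimensional Lebesgue measures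
  under the map that assembles a vector from its coordinates, so both claims reduce to those for
  product measures.\<close>

lemma
  fixes g :: "'a::euclidean_space \<Rightarrow> real \<Rightarrow> 'b::{real_normed_field, banach, second_countable_topology}"
  assumes g: "\<And>b. b \<in> Basis \<Longrightarrow> integrable lborel (g b)"
  shows integrable_lborel_prod: "integrable lborel (\<lambda>x::'a. \<Prod>b\<in>Basis. g b (x \<bullet> b))"
    and integral_lborel_prod: "(LINT x|lborel. (\<Prod>b\<in>Basis. g b ((x::'a) \<bullet> b))) = (\<Prod>b\<in>Basis. (LINT r|lborel. g b r))"
proof -
  interpret product_sigma_finite "\<lambda>_::'a. lborel :: real measure" ..
  let ?T = "\<lambda>f::'a\<Rightarrow>real. \<Sum>b\<in>Basis. f b *\<^sub>R b"
  have T: "?T \<in> (\<Pi>\<^sub>M b\<in>Basis. lborel) \<rightarrow>\<^sub>M borel" by measurable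
  have [measurable]: "\<And>b. b \<in> Basis \<Longrightarrow> g b \<in> borel_measurable borel"
    using g by (auto dest!: borel_measurable_integrable)
  have m: "(\<lambda>x::'a. \<Prod>b\<in>Basis. g b (x \<bullet> b)) \<in> borel_measurable borel" by measurable
  have eq: "(\<Prod>b\<in>Basis. g b (?T f \<bullet> b)) = (\<Prod>b\<in>Basis. g b (f b))" for f
    by (intro prod.cong refl) (simp add: inner_sum_left inner_Basis if_distrib cong: if_cong)
  show "integrable lborel (\<lambda>x::'a. \<Prod>b\<in>Basis. g b (x \<bullet> b))"

    by (subst lborel_eq, subst integrable_distr_eq[OF T m], unfold eq, rule product_integrable_prod) (use g in auto)
  show "(LINT x|lborel. (\<Prod>b\<in>Basis. g b ((x::'a) \<bullet> b))) = (\<Prod>b\<in>Basis. (LINT r|lborel. g b r))"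

    by (subst lborel_eq, subst integral_distr[OF T m], unfold eq, rule product_integral_prod) (use g in auto)
qed

lemma nn_integral_lborel_translate:
  fixes f :: "'a::euclidean_space \<Rightarrow> ennreal"
  assumes [measurable]: "f \<in> borel_measurable borel"
  shows "(\<integral>\<^sup>+z. f (x - z) \<partial>lborel) = (\<integral>\<^sup>+z. f z \<partial>lborel)"
proof -
  have "(\<integral>\<^sup>+z. f z \<partial>lborel) = (\<integral>\<^sup>+z. f z \<partial>density (distr lborel borel (\<lambda>z. x + (-1) *\<^sub>R z)) (\<lambda>_. \<bar>-1\<bar>^DIM('a)))"
    by (subst lborel_affine[of "-1" x]) (auto simp: one_ennreal_def[symmetric])
  also have "\<dots> = (\<integral>\<^sup>+z. f (x - z) \<partial>lborel)"
    by (simp add: nn_integral_density nn_integral_distr one_ennreal_def[symmetric])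
  finally show ?thesis ..
qed

text \<open>The substitution z = x - u/c, which converts an average with a fixed Gaussian weight
  into a convolution with a Gaussian of width 1/c.\<close>

lemma integral_lborel_affine_scaled:
  fixes f :: "'a::euclidean_space \<Rightarrow> real"
  assumes [measurable]: "f \<in> borel_measurable borel" and c: "0 < c"
  shows "(LINT z|lborel. f z) = (LINT u|lborel. f (x - u /\<^sub>R c)) / c ^ DIM('a)"
proof -
  have eq: "lborel = density (distr lborel borel (\<lambda>u. x + (- inverse c) *\<^sub>R u)) (\<lambda>_. ennreal (inverse c ^ DIM('a)))"
    using c by (subst lborel_affine[of "- inverse c" x]) (auto simp: power_abs[symmetric])
  have "(LINT z|lborel. f z) = (LINT z|distr lborel borel (\<lambda>u. x + (- inverse c) *\<^sub>R u). inverse c ^ DIM('a) *\<^sub>R f z)"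
    using c by (subst eq, subst integral_density) auto
  also have "\<dots> = (LINT u|lborel. inverse c ^ DIM('a) *\<^sub>R f (x + (- inverse c) *\<^sub>R u))"
    by (subst integral_distr) auto
  also have "\<dots> = (LINT u|lborel. f (x - u /\<^sub>R c)) / c ^ DIM('a)"
    by (simp add: field_simps power_inverse)
  finally show ?thesis .
qed

section \<open>The Gaussian density: integrability, Fourier transform and moments\<close>

text \<open>Left unnormalised, so that scaling the argument and taking envelopes only change the
  parameter \<open>a\<close>; the mass is divided out in \<open>gauss_avg\<close>.\<close>

definition gauss :: "real \<Rightarrow> 'a::euclidean_space \<Rightarrow> real" where
  "gauss a x = exp (- a * (norm x)\<^sup>2)"

lemma gauss_pos [simp]: "0 < gauss a x" and gauss_nonneg [simp]: "0 \<le> gauss a x"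
  by (simp_all add: gauss_def)

lemma borel_measurable_gauss [measurable]: "gauss a \<in> borel_measurable borel"
  unfolding gauss_def by measurable

lemma gauss_prod: "gauss a x = (\<Prod>b\<in>Basis. exp (- a * (x \<bullet> b)\<^sup>2))"
  unfolding gauss_def
  by (subst power2_norm_eq_inner, subst euclidean_inner)
    (simp add: exp_sum[symmetric] sum_distrib_left power2_eq_square sum_negf)

lemma integrable_gauss_real:
  assumes "0 < a" shows "integrable lborel (\<lambda>r::real. exp (- a * r\<^sup>2))"
proof -
  have "integrable lborel (\<lambda>r. sqrt (2*pi*(1/sqrt(2*a))\<^sup>2) * normal_density 0 (1/sqrt(2*a)) r)"
    using assms by (intro integrable_mult_right integrable_normal_density) simp
  also have "(\<lambda>r. sqrt (2*pi*(1/sqrt(2*a))\<^sup>2) * normal_density 0 (1/sqrt(2*a)) r) = (\<lambda>r::real. exp (- a * r\<^sup>2))"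
    using assms by (auto simp: normal_density_def fun_eq_iff power_divide)
  finally show ?thesis .
qed

lemma integrable_gauss:
  assumes "0 < a" shows "integrable lborel (gauss a :: 'a::euclidean_space \<Rightarrow> real)"
  unfolding gauss_prod[abs_def] by (intro integrable_lborel_prod integrable_gauss_real assms)

lemma gaussian_fourier_real:
  fixes t :: real
  shows "integrable lborel (\<lambda>r. complex_of_real (exp (- (1/2) * r\<^sup>2)) * iexp (t * r))" (is ?I)
    and "(LINT r|lborel. complex_of_real (exp (- (1/2) * r\<^sup>2)) * iexp (t * r)) = complex_of_real (sqrt (2 * pi) * exp (- (1/2) * t\<^sup>2))" (is ?E)
proof -
  have eq: "complex_of_real (exp (- (1/2) * r\<^sup>2)) * iexp (t * r)
      = complex_of_real (sqrt (2 * pi)) * (std_normal_density r *\<^sub>R iexp (t * r))" for r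
    by (simp add: normal_density_def scaleR_conv_of_real)
  have i: "integrable lborel (\<lambda>r. std_normal_density r *\<^sub>R iexp (t * r))"
    by (rule Bochner_Integration.integrable_bound[OF integrable_normal_density[of 1 0]]) auto
  show ?I
    unfolding eq using i by (rule integrable_mult_right)
  have "(LINT r|lborel. std_normal_density r *\<^sub>R iexp (t * r)) = char std_normal_distribution t"
    unfolding char_def by (subst integral_density) auto
  then show ?E
    unfolding eq integral_mult_right_zero by (simp only: char_std_normal_distribution) simp
qed

text \<open>The integrand factorises over the coordinates into characteristic functions of the
  standard normal law. Writing the constant as the total mass lets later proofs divide by it knowing
  only that it is positive.\<close>

lemma gauss_fourier:
  fixes x :: "'a::euclidean_space"
  shows "(LINT z|lborel. gauss (1/2) z * cos (z \<bullet> x)) = (LINT z|lborel. gauss (1/2) (z::'a)) * gauss (1/2) x"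
proof -
  let ?g = "\<lambda>b r. complex_of_real (exp (- (1/2) * r\<^sup>2)) * iexp ((x \<bullet> b) * r)"
  have prod: "(\<Prod>b\<in>Basis. ?g b (z \<bullet> b)) = complex_of_real (gauss (1/2) z) * iexp (z \<bullet> x)" for z
    unfolding prod.distrib gauss_prod of_real_prod
    by (simp add: euclidean_inner[of z x] exp_sum sum_distrib_left mult_ac)
  have int: "integrable lborel (\<lambda>z::'a. complex_of_real (gauss (1/2) z) * iexp (z \<bullet> x))"
    unfolding prod[symmetric] by (intro integrable_lborel_prod gaussian_fourier_real)
  have "(LINT z|lborel. complex_of_real (gauss (1/2) (z::'a)) * iexp (z \<bullet> x))
      = (\<Prod>b\<in>Basis. complex_of_real (sqrt (2 * pi) * exp (- (1/2) * (x \<bullet> b)\<^sup>2)))"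
    unfolding prod[symmetric]
    by (subst integral_lborel_prod) (use gaussian_fourier_real in \<open>auto intro!: prod.cong\<close>)
  also have "\<dots> = complex_of_real (sqrt (2 * pi) ^ DIM('a) * gauss (1/2) x)"
    unfolding gauss_prod of_real_mult prod.distrib by simp
  finally have *: "(LINT z|lborel. complex_of_real (gauss (1/2) (z::'a)) * iexp (z \<bullet> x))
      = complex_of_real (sqrt (2 * pi) ^ DIM('a) * gauss (1/2) x)" .
  have "(LINT z|lborel. gauss (1/2) (z::'a) * cos (z \<bullet> x)) = (LINT z|lborel. Re (complex_of_real (gauss (1/2) (z::'a)) * iexp (z \<bullet> x)))"
    by (simp add: Re_exp)
  also have "\<dots> = sqrt (2 * pi) ^ DIM('a) * gauss (1/2) x"
    using int by (subst integral_Re) (simp_all only: * Re_complex_of_real)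
  finally have c: "(LINT z|lborel. gauss (1/2) (z::'a) * cos (z \<bullet> x)) = sqrt (2 * pi) ^ DIM('a) * gauss (1/2) x" .
  have "(LINT z|lborel. gauss (1/2) (z::'a)) = sqrt (2 * pi) ^ DIM('a)"
  proof -
    have "(LINT z|lborel. gauss (1/2) (z::'a)) = (\<Prod>b\<in>(Basis::'a set). (LINT r|lborel. exp (- (1/2) * r\<^sup>2)))"
      unfolding gauss_prod by (subst integral_lborel_prod) (use integrable_gauss_real[of "1/2"] in auto)
    also have "(LINT r|lborel. exp (- (1/2) * r\<^sup>2)) = sqrt (2 * pi)"
      using gaussian_fourier_real(2)[of 0] by (simp del: of_real_mult of_real_exp)
    finally show ?thesis by simp
  qed
  with c show ?thesis by simp
qed

lemma integral_gauss_pos: "0 < (LINT z|lborel. gauss (1/2) (z::'a::euclidean_space))"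
proof -
  have "(LINT z|lborel. gauss (1/2) (z::'a)) \<noteq> 0"
  proof
    assume "(LINT z|lborel. gauss (1/2) (z::'a)) = 0"
    then have "AE z in lborel. gauss (1/2) (z::'a) = 0"
      using integrable_gauss[of "1/2", where 'a='a] by (subst (asm) integral_nonneg_eq_0_iff_AE) auto
    then have "AE z in (lborel::'a measure). False"
      by eventually_elim (use gauss_pos[of "1/2"] in \<open>metis less_irrefl\<close>)
    then show False
      by (simp add: AE_iff_null null_sets_def)
  qed
  moreover have "0 \<le> (LINT z|lborel. gauss (1/2) (z::'a))"
    by (intro Bochner_Integration.integral_nonneg) simp
  ultimately show ?thesis by linarith
qed

text \<open>Half of the exponent pays for the polynomial: r^j \<le> exp(j r), and expanding (a r -
  j)^2 \<ge> 0 gives j r \<le> j^2/(2a) + (a/2) r^2.\<close>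

lemma gauss_moment_bound:
  assumes a: "0 < a"
  shows "(norm x) ^ j * gauss a x \<le> exp (real j ^ 2 / (2 * a)) * gauss (a/2) x"
proof -
  have "0 \<le> (a * norm x - j)\<^sup>2" by simp
  then have le: "j * norm x \<le> real j ^ 2 / (2 * a) + a/2 * (norm x)\<^sup>2"
    using a by (simp add: field_simps power2_eq_square)
  have "(norm x) ^ j \<le> exp (norm x) ^ j"
    using exp_ge_add_one_self[of "norm x"] by (intro power_mono) (linarith, simp)
  also have "\<dots> = exp (j * norm x)" by (simp add: exp_of_nat_mult)
  also have "\<dots> \<le> exp (real j ^ 2 / (2 * a) + a/2 * (norm x)\<^sup>2)" using le by simp
  finally have "(norm x) ^ j * gauss a x \<le> exp (real j ^ 2 / (2 * a) + a/2 * (norm x)\<^sup>2) * gauss a x"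
    by (rule mult_right_mono) simp
  also have "\<dots> = exp (real j ^ 2 / (2 * a)) * gauss (a/2) x"
    unfolding gauss_def exp_add[symmetric] by (simp add: mult_exp_exp field_simps)
  finally show ?thesis .
qed

text \<open>The absolute integral over \<open>m\<close> is controlled for each \<open>y\<close> by a
  function of \<open>y\<close> alone, which is the form in which mixtures are estimated:
  \<open>m\<close> is the mixing measure and \<open>k\<close> is one of \<open>\<nu>\<close>,
  \<open>\<mu>\<close>, \<open>\<eta>\<close>.\<close>

lemma Fubini_bounded:
  fixes f :: "'a \<Rightarrow> 'b \<Rightarrow> real"
  assumes m: "sigma_finite_measure m" and k: "sigma_finite_measure k"
    and f: "case_prod f \<in> borel_measurable (m \<Otimes>\<^sub>M k)"
    and W: "\<And>y. y \<in> space k \<Longrightarrow> (\<integral>\<^sup>+z. ennreal \<bar>f z y\<bar> \<partial>m) \<le> W y"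
    and W': "(\<integral>\<^sup>+y. W y \<partial>k) < \<infinity>"
  shows "(LINT y|k. (LINT z|m. f z y)) = (LINT z|m. (LINT y|k. f z y))"
    and "integrable m (\<lambda>z. LINT y|k. f z y)"
    and "(\<integral>\<^sup>+z. ennreal \<bar>LINT y|k. f z y\<bar> \<partial>m) \<le> (\<integral>\<^sup>+y. W y \<partial>k)"
proof -
  interpret m: sigma_finite_measure m by (rule m)
  interpret k: sigma_finite_measure k by (rule k)
  interpret pair_sigma_finite m k ..
  note f[measurable]
  have le: "(\<integral>\<^sup>+z. \<integral>\<^sup>+y. ennreal \<bar>f z y\<bar> \<partial>k \<partial>m) \<le> (\<integral>\<^sup>+y. W y \<partial>k)"
    by (subst Fubini'[symmetric]) (auto intro!: nn_integral_mono W)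
  have "integrable (m \<Otimes>\<^sub>M k) (case_prod f)"
  proof (rule integrableI_bounded)
    have "(\<integral>\<^sup>+p. ennreal (norm (case_prod f p)) \<partial>(m \<Otimes>\<^sub>M k)) = (\<integral>\<^sup>+z. \<integral>\<^sup>+y. ennreal \<bar>f z y\<bar> \<partial>k \<partial>m)"
      by (subst k.nn_integral_fst[symmetric]) auto
    then show "(\<integral>\<^sup>+p. ennreal (norm (case_prod f p)) \<partial>(m \<Otimes>\<^sub>M k)) < \<infinity>"
      using le W' by simp
  qed (rule f)
  note int = this
  show "(LINT y|k. (LINT z|m. f z y)) = (LINT z|m. (LINT y|k. f z y))"
    by (rule Fubini_integral[OF int])
  show "integrable m (\<lambda>z. LINT y|k. f z y)" by (rule integrable_fst[OF int])
  have "(\<integral>\<^sup>+z. ennreal \<bar>LINT y|k. f z y\<bar> \<partial>m) \<le> (\<integral>\<^sup>+z. \<integral>\<^sup>+y. ennreal \<bar>f z y\<bar> \<partial>k \<partial>m)"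
  proof (rule nn_integral_mono)
    fix z
    \<comment> \<open>The Bochner integral of a non-integrable function is 0, so the inequality
      holds for every \<open>z\<close> and not merely almost every one.\<close>
    show "ennreal \<bar>LINT y|k. f z y\<bar> \<le> (\<integral>\<^sup>+y. ennreal \<bar>f z y\<bar> \<partial>k)"
      using integral_norm_bound_ennreal[of k "f z"]
      by (cases "integrable k (f z)") (simp_all add: not_integrable_integral_eq)
  qed
  with le show "(\<integral>\<^sup>+z. ennreal \<bar>LINT y|k. f z y\<bar> \<partial>m) \<le> (\<integral>\<^sup>+y. W y \<partial>k)" by (rule order_trans[rotated])
qed

section \<open>The abstract Dynkin formula\<close>

definition jump :: "(real ^ 'n \<Rightarrow> real) \<Rightarrow> (real ^ 'n \<Rightarrow> real ^ 'n) \<Rightarrow> real ^ 'n \<Rightarrow> real ^ 'n \<Rightarrow> real" where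
  "jump f v x y = f (x + y) - f x - (v x \<bullet> y) * indicator {0<..<1} (norm y)"

text \<open>The claimed generator with the gradient and the second-order term replaced by free
  arguments \<open>v\<close> and \<open>q\<close>. The operator is then linear in the triple (f, v,
  q), and mixtures can be formed in the three components separately.\<close>

definition levy_op ::
  "real ^ 'n \<Rightarrow> (real ^ 'n) measure \<Rightarrow> (real ^ 'n \<Rightarrow> real) \<Rightarrow> (real ^ 'n \<Rightarrow> real ^ 'n) \<Rightarrow> (real ^ 'n \<Rightarrow> real) \<Rightarrow> real ^ 'n \<Rightarrow> real" where
  "levy_op b \<nu> f v q x = b \<bullet> v x + q x + (LINT y|\<nu>. jump f v x y)"

lemma iexp_linearization_bound:
  "\<lbrakk>norm y < 1; y \<noteq> 0\<rbrakk> \<Longrightarrow> cmod (1 - iexp h + \<i> * complex_of_real (h * indicator {0<..<1} (norm y))) \<le> h\<^sup>2"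
  "norm y \<ge> 1 \<Longrightarrow> cmod (1 - iexp h + \<i> * complex_of_real (h * indicator {0<..<1} (norm y))) \<le> 2"
proof -
  have 1: "cmod (1 - iexp h + \<i> * complex_of_real h) \<le> h\<^sup>2"
  proof -
    have "cmod (1 - iexp h + \<i> * complex_of_real h) = cmod (iexp h - (\<Sum>k\<le>1. (\<i> * h)^k / fact k))"
      by (subst norm_minus_cancel[symmetric]) (simp add: algebra_simps)
    also have "\<dots> \<le> h\<^sup>2 / 2" using iexp_approx1[of h 1] by (simp add: numeral_2_eq_2)
    finally show ?thesis by (smt (verit) zero_le_power2 field_sum_of_halves)
  qed
  have 2: "cmod (1 - iexp h) \<le> 2"
    by (rule order_trans[OF norm_triangle_ineq4]) simp
  show "\<lbrakk>norm y < 1; y \<noteq> 0\<rbrakk> \<Longrightarrow> cmod (1 - iexp h + \<i> * complex_of_real (h * indicator {0<..<1} (norm y))) \<le> h\<^sup>2"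
    using 1 by simp
  show "norm y \<ge> 1 \<Longrightarrow> cmod (1 - iexp h + \<i> * complex_of_real (h * indicator {0<..<1} (norm y))) \<le> 2"
    using 2 by simp
qed

text \<open>Inside the unit ball the compensated exponential is quadratic in y \<bullet> \<xi>,
  hence at most |\<xi>|^2 |y|^2 by Cauchy-Schwarz; outside there is no compensator and it is at most
  2. The sum of the two constants covers both ranges.\<close>

lemma levy_integrand_bound:
  fixes y \<xi> :: "real ^ 'n"
  shows "cmod (1 - exp (\<i> * complex_of_real (y \<bullet> \<xi>)) + \<i> * complex_of_real (y \<bullet> \<xi> * indicator {0<..<1} (norm y)))
     \<le> (2 + (norm \<xi>)\<^sup>2) * min ((norm y)\<^sup>2) 1"
proof (cases "y = 0")
  case False
  have h: "(y \<bullet> \<xi>)\<^sup>2 \<le> (norm \<xi>)\<^sup>2 * (norm y)\<^sup>2"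
    using power_mono[OF Cauchy_Schwarz_ineq2[of y \<xi>], of 2] by (simp add: power_mult_distrib mult.commute)
  show ?thesis
  proof (cases "norm y < 1")
    case True
    then have "min ((norm y)\<^sup>2) 1 = (norm y)\<^sup>2" by (simp add: power_le_one)
    then show ?thesis
      using order_trans[OF order_trans[OF iexp_linearization_bound(1)[OF True False, of "y \<bullet> \<xi>"] h], of "(2 + (norm \<xi>)\<^sup>2) * (norm y)\<^sup>2"]
      by (simp add: mult_right_mono)
  next
    case F: False
    then have "min ((norm y)\<^sup>2) 1 = 1" by (simp add: one_le_power)
    then show ?thesis
      using order_trans[OF iexp_linearization_bound(2)[of y "y \<bullet> \<xi>"], of "2 + (norm \<xi>)\<^sup>2"] F by simp
  qed
qed simp

text \<open>\<open>\<mu>\<close> is to be the law of \<open>L t\<close> and \<open>\<eta>\<close>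
  the occupation measure up to \<open>t\<close>. The assumption \<open>trig\<close> is then the
  integrated form of d/ds exp(-s \<psi>) = -\<psi> exp(-s \<psi>). Here \<open>\<nu>\<close> lives
  on all Borel sets, with a null origin, so that product measurability can be handled in the Borel
  space.\<close>

locale dynkin_measures =
  fixes b :: "real ^ 'n" and Q :: "real ^ 'n ^ 'n" and \<nu> \<mu> \<eta> :: "(real ^ 'n) measure"
  assumes finite_\<mu>: "finite_measure \<mu>" and finite_\<eta>: "finite_measure \<eta>"
    and sets_\<mu> [measurable_cong]: "sets \<mu> = sets borel"
    and sets_\<eta> [measurable_cong]: "sets \<eta> = sets borel"
    and sets_\<nu> [measurable_cong]: "sets \<nu> = sets borel"
    and \<nu>_zero: "emeasure \<nu> {0} = 0"
    and \<nu>_finite: "(\<integral>\<^sup>+y. ennreal (min ((norm y)\<^sup>2) 1) \<partial>\<nu>) < \<infinity>"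
    and trig: "\<And>\<xi>. (LINT y|\<mu>. iexp (\<xi> \<bullet> y)) - 1 = - char_exponent b Q \<nu> \<xi> * (LINT y|\<eta>. iexp (\<xi> \<bullet> y))"
begin

sublocale \<mu>: finite_measure \<mu> by (rule finite_\<mu>)
sublocale \<eta>: finite_measure \<eta> by (rule finite_\<eta>)

lemma space_eq [simp]: "space \<mu> = UNIV" "space \<eta> = UNIV" "space \<nu> = UNIV"
  using sets_eq_imp_space_eq[OF sets_\<mu>] sets_eq_imp_space_eq[OF sets_\<eta>] sets_eq_imp_space_eq[OF sets_\<nu>]
  by simp_all

lemma integrable_\<nu>_min: "integrable \<nu> (\<lambda>y. min ((norm y)\<^sup>2) 1)"
  using \<nu>_finite by (intro integrableI_nonneg) auto

text \<open>By Markov's inequality the sets where min(|y|^2, 1) \<ge> 1/(n+1) have finite measure;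
  they exhaust everything but the origin, which is null. This is what permits Fubini against
  \<open>\<nu>\<close>.\<close>

sublocale \<nu>: sigma_finite_measure \<nu>
proof
  let ?A = "\<lambda>n::nat. {y::real^'n. 1 / Suc n \<le> min ((norm y)\<^sup>2) 1}"
  have "emeasure \<nu> (?A n) < \<infinity>" for n
  proof -
    have "emeasure \<nu> (?A n) = (\<integral>\<^sup>+y. indicator (?A n) y \<partial>\<nu>)"
      by (subst nn_integral_indicator) auto
    also have "\<dots> \<le> (\<integral>\<^sup>+y. ennreal (Suc n) * ennreal (min ((norm y)\<^sup>2) 1) \<partial>\<nu>)"
    proof (intro nn_integral_mono)
      fix y :: "real ^ 'n"
      have "1 / real (Suc n) \<le> m \<Longrightarrow> 1 \<le> real (Suc n) * m" for m
        by (simp add: field_simps del: of_nat_Suc)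
      then show "indicator (?A n) y \<le> ennreal (Suc n) * ennreal (min ((norm y)\<^sup>2) 1)"
        by (simp add: ennreal_mult[symmetric] indicator_def del: of_nat_Suc)
    qed
    also have "\<dots> < \<infinity>"
      using \<nu>_finite by (subst nn_integral_cmult) (auto simp: ennreal_mult_less_top)
    finally show ?thesis .
  qed
  moreover have "(\<Union>n. ?A n) \<union> {0} = UNIV"
  proof -
    have "\<exists>n. y \<in> ?A n" if "y \<noteq> 0" for y :: "real^'n"
    proof -
      have "0 < min ((norm y)\<^sup>2) 1" using that by simp
      then obtain n where "1 / Suc n < min ((norm y)\<^sup>2) 1" by (rule nat_approx_posE)
      then show ?thesis by (metis (mono_tags) less_imp_le mem_Collect_eq)
    qed
    then show ?thesis by auto
  qed
  ultimately show "\<exists>A. countable A \<and> A \<subseteq> sets \<nu> \<and> \<Union> A = space \<nu> \<and> (\<forall>a\<in>A. emeasure \<nu> a \<noteq> \<infinity>)"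
    using \<nu>_zero by (intro exI[of _ "insert {0} (range ?A)"]) (auto simp: less_top)
qed

definition dynkin :: "(real ^ 'n \<Rightarrow> real) \<Rightarrow> (real ^ 'n \<Rightarrow> real) \<Rightarrow> bool" where
  "dynkin f g \<longleftrightarrow> (\<forall>x. (LINT y|\<mu>. f (x + y)) - f x = (LINT y|\<eta>. g (x + y)))"

text \<open>The operator is linear and commutes with translations. This produces the atoms
  \<open>h z * gauss a (x - z)\<close> of a convolution from a single Gaussian.\<close>

lemma dynkin_scaled_translate:
  assumes "dynkin f (levy_op b \<nu> f v q)"
  shows "dynkin (\<lambda>x. a * f (x - z)) (levy_op b \<nu> (\<lambda>x. a * f (x - z)) (\<lambda>x. a *\<^sub>R v (x - z)) (\<lambda>x. a * q (x - z)))"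
proof -
  have j: "jump (\<lambda>x. a * f (x - z)) (\<lambda>x. a *\<^sub>R v (x - z)) x y = a * jump f v (x - z) y" for x y
    by (simp add: jump_def algebra_simps)
  have "levy_op b \<nu> (\<lambda>x. a * f (x - z)) (\<lambda>x. a *\<^sub>R v (x - z)) (\<lambda>x. a * q (x - z)) x = a * levy_op b \<nu> f v q (x - z)" for x
    by (simp add: levy_op_def j algebra_simps)
  moreover have "x + y - z = (x - z) + y" for x y by simp
  ultimately show ?thesis
    using assms unfolding dynkin_def by (simp only: integral_mult_right_zero right_diff_distrib[symmetric] simp_thms)
qed

text \<open>Bounded pointwise convergence suffices on both sides because \<open>\<mu>\<close> and
  \<open>\<eta>\<close> are finite, so constants are integrable.\<close>

lemma dynkin_limit:
  assumes D: "\<And>n::nat. dynkin (F n) (G n)"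
    and [measurable]: "\<And>n. F n \<in> borel_measurable borel" "\<And>n. G n \<in> borel_measurable borel"
    and F: "\<And>x. (\<lambda>n. F n x) \<longlonglongrightarrow> f x" "\<And>n x. \<bar>F n x\<bar> \<le> C"
    and G: "\<And>x. (\<lambda>n. G n x) \<longlonglongrightarrow> g x" "\<And>n x. \<bar>G n x\<bar> \<le> C"
  shows "dynkin f g"
  unfolding dynkin_def
proof
  fix x
  have [measurable]: "f \<in> borel_measurable borel" "g \<in> borel_measurable borel"
    by (rule borel_measurable_LIMSEQ_real[OF F(1)] borel_measurable_LIMSEQ_real[OF G(1)], measurable)+
  have "(\<lambda>n. (LINT y|\<mu>. F n (x + y)) - F n x) \<longlonglongrightarrow> (LINT y|\<mu>. f (x + y)) - f x"
    by (intro tendsto_diff F integral_dominated_convergence[where w = "\<lambda>_. C"]) (use F in auto)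
  moreover have "(\<lambda>n. (LINT y|\<eta>. G n (x + y))) \<longlonglongrightarrow> (LINT y|\<eta>. g (x + y))"
    by (intro integral_dominated_convergence[where w = "\<lambda>_. C"]) (use G in auto)
  ultimately show "(LINT y|\<mu>. f (x + y)) - f x = (LINT y|\<eta>. g (x + y))"
    using D unfolding dynkin_def by (metis (no_types, lifting) ext LIMSEQ_unique)
qed

text \<open>The character exp(i \<xi> \<bullet> x) is an eigenfunction of the operator with
  eigenvalue -\<psi>(\<xi>). Multiplying \<open>trig\<close> by this character and taking real parts
  gives the formula for the cosine.\<close>

lemma dynkin_cos:
  "dynkin (\<lambda>x. cos (\<xi> \<bullet> x))
    (levy_op b \<nu> (\<lambda>x. cos (\<xi> \<bullet> x)) (\<lambda>x. - sin (\<xi> \<bullet> x) *\<^sub>R \<xi>) (\<lambda>x. - 1/2 * cos (\<xi> \<bullet> x) * (\<xi> \<bullet> (Q *v \<xi>))))"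
  (is "dynkin ?f ?g")
proof -
  let ?w = "\<lambda>y. 1 - exp (\<i> * complex_of_real (y \<bullet> \<xi>)) + \<i> * complex_of_real (y \<bullet> \<xi> * indicator {0<..<1} (norm y))"
  let ?\<psi> = "char_exponent b Q \<nu> \<xi>"
  have w: "integrable \<nu> ?w"
    by (rule Bochner_Integration.integrable_bound[OF integrable_mult_right[OF integrable_\<nu>_min, of "2 + (norm \<xi>)\<^sup>2"]])
      (use levy_integrand_bound[of _ \<xi>] in \<open>auto simp: abs_mult min_def\<close>)
  have op: "?g x = Re (- ?\<psi> * iexp (\<xi> \<bullet> x))" for x
  proof -
    have "(LINT y|\<nu>. jump ?f (\<lambda>x. - sin (\<xi> \<bullet> x) *\<^sub>R \<xi>) x y) = (LINT y|\<nu>. Re (- ?w y * iexp (\<xi> \<bullet> x)))"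
      by (intro Bochner_Integration.integral_cong refl)
        (simp add: jump_def Re_exp Im_exp inner_add_right cos_add inner_commute[of \<xi>] algebra_simps)
    also have "\<dots> = Re (LINT y|\<nu>. - ?w y * iexp (\<xi> \<bullet> x))"
      by (intro integral_Re integrable_mult_left integrable_minus w)
    also have "(LINT y|\<nu>. - ?w y * iexp (\<xi> \<bullet> x)) = - (LINT y|\<nu>. ?w y) * iexp (\<xi> \<bullet> x)"
      by (simp only: integral_mult_left_zero integral_minus)
    finally show ?thesis
      by (simp add: levy_op_def char_exponent_def Re_exp Im_exp algebra_simps)
  qed
  have i\<mu>: "integrable \<mu> (\<lambda>y. iexp (\<xi> \<bullet> y))" and i\<eta>: "integrable \<eta> (\<lambda>y. iexp (\<xi> \<bullet> y))"
    by (auto intro!: \<mu>.integrable_const_bound[where B = 1] \<eta>.integrable_const_bound[where B = 1])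
  have exp_add': "iexp (\<xi> \<bullet> (x + y)) = iexp (\<xi> \<bullet> x) * iexp (\<xi> \<bullet> y)" for x y
    by (simp add: inner_add_right distrib_left exp_add)
  show ?thesis
    unfolding dynkin_def
  proof
    fix x
    have "(LINT y|\<mu>. ?f (x + y)) - ?f x = (LINT y|\<mu>. Re (iexp (\<xi> \<bullet> x) * iexp (\<xi> \<bullet> y))) - Re (iexp (\<xi> \<bullet> x))"
      unfolding exp_add'[symmetric] by (simp add: Re_exp)
    also have "\<dots> = Re (iexp (\<xi> \<bullet> x) * ((LINT y|\<mu>. iexp (\<xi> \<bullet> y)) - 1))"
      by (subst integral_Re[OF integrable_mult_right[OF i\<mu>]]) (simp only: integral_mult_right_zero right_diff_distrib minus_complex.simps mult_1_right)
    also have "\<dots> = Re (LINT y|\<eta>. (- ?\<psi> * iexp (\<xi> \<bullet> x)) * iexp (\<xi> \<bullet> y))"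
      unfolding trig integral_mult_right_zero by (simp only: mult_ac)
    also have "\<dots> = (LINT y|\<eta>. Re ((- ?\<psi> * iexp (\<xi> \<bullet> x)) * iexp (\<xi> \<bullet> y)))"
      by (rule integral_Re[symmetric, OF integrable_mult_right[OF i\<eta>]])
    also have "\<dots> = (LINT y|\<eta>. ?g (x + y))"
      unfolding op exp_add' by (simp only: mult_ac)
    finally show "(LINT y|\<mu>. ?f (x + y)) - ?f x = (LINT y|\<eta>. ?g (x + y))" .
  qed
qed

lemma jump_cos_bound:
  "\<bar>jump (\<lambda>x. cos (\<xi> \<bullet> x)) (\<lambda>x. - sin (\<xi> \<bullet> x) *\<^sub>R \<xi>) x y\<bar> \<le> (2 + (norm \<xi>)\<^sup>2) * min ((norm y)\<^sup>2) 1"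
proof -
  let ?w = "1 - exp (\<i> * complex_of_real (y \<bullet> \<xi>)) + \<i> * complex_of_real (y \<bullet> \<xi> * indicator {0<..<1} (norm y))"
  have "jump (\<lambda>x. cos (\<xi> \<bullet> x)) (\<lambda>x. - sin (\<xi> \<bullet> x) *\<^sub>R \<xi>) x y = Re (- ?w * iexp (\<xi> \<bullet> x))"
    by (simp add: jump_def Re_exp Im_exp inner_add_right cos_add inner_commute[of \<xi>] algebra_simps)
  also have "\<bar>\<dots>\<bar> \<le> cmod (- ?w * iexp (\<xi> \<bullet> x))" by (rule abs_Re_le_cmod)
  also have "\<dots> = cmod ?w"
    by (simp only: norm_mult norm_minus_cancel norm_exp_i_times mult_1_right)
  finally show ?thesis using levy_integrand_bound[of y \<xi>] by linarith
qed

end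

lemma integral_jump:
  fixes f :: "'c \<Rightarrow> real ^ 'n \<Rightarrow> real" and v :: "'c \<Rightarrow> real ^ 'n \<Rightarrow> real ^ 'n"
  assumes "\<And>x. integrable m (\<lambda>z. f z x)" "\<And>x. integrable m (\<lambda>z. v z x)"
  shows "jump (\<lambda>x. LINT z|m. f z x) (\<lambda>x. LINT z|m. v z x) x y = (LINT z|m. jump (f z) (v z) x y)"
  unfolding jump_def using assms by simp

context dynkin_measures
begin

text \<open>Superposition: the mixing integral is exchanged with those over \<open>\<mu>\<close>,
  \<open>\<eta>\<close> and \<open>\<nu>\<close>. The first two measures are finite, so uniform
  bounds are enough; inside the operator the assumption \<open>jump\<close> supplies a majorant that
  \<open>\<nu>\<close> integrates.\<close>

lemma dynkin_mixture:
  fixes m :: "'c measure" and f q :: "'c \<Rightarrow> real ^ 'n \<Rightarrow> real" and v :: "'c \<Rightarrow> real ^ 'n \<Rightarrow> real ^ 'n"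
  assumes m: "sigma_finite_measure m"
    and f_meas: "case_prod f \<in> borel_measurable (m \<Otimes>\<^sub>M borel)"
    and v_meas: "case_prod v \<in> borel_measurable (m \<Otimes>\<^sub>M borel)"
    and q_meas: "case_prod q \<in> borel_measurable (m \<Otimes>\<^sub>M borel)"
    and C: "0 \<le> C"
    and f: "\<And>x. (\<integral>\<^sup>+z. ennreal \<bar>f z x\<bar> \<partial>m) \<le> ennreal C"
    and v: "\<And>x. (\<integral>\<^sup>+z. ennreal (norm (v z x)) \<partial>m) \<le> ennreal C"
    and q: "\<And>x. (\<integral>\<^sup>+z. ennreal \<bar>q z x\<bar> \<partial>m) \<le> ennreal C"
    and jump: "\<And>x y. (\<integral>\<^sup>+z. ennreal \<bar>jump (f z) (v z) x y\<bar> \<partial>m) \<le> ennreal (C * min ((norm y)\<^sup>2) 1)"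
    and D: "\<And>z. z \<in> space m \<Longrightarrow> dynkin (f z) (levy_op b \<nu> (f z) (v z) (q z))"
  shows "dynkin (\<lambda>x. LINT z|m. f z x)
    (levy_op b \<nu> (\<lambda>x. LINT z|m. f z x) (\<lambda>x. LINT z|m. v z x) (\<lambda>x. LINT z|m. q z x))"
proof -
  interpret m: sigma_finite_measure m by (rule m)
  \<comment> \<open>Joint measurability restated for compositions, so that shifted arguments such as
    \<open>x + y\<close> over any product space are covered.\<close>
  have f_meas' [measurable (raw)]: "(\<lambda>p. f (c p) (d p)) \<in> borel_measurable N"
    and v_meas' [measurable (raw)]: "(\<lambda>p. v (c p) (d p)) \<in> borel_measurable N"
    and q_meas' [measurable (raw)]: "(\<lambda>p. q (c p) (d p)) \<in> borel_measurable N"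
    if [measurable]: "c \<in> N \<rightarrow>\<^sub>M m" "d \<in> N \<rightarrow>\<^sub>M borel" for N :: "'d measure" and c d
  proof -
    have *: "(\<lambda>p. (c p, d p)) \<in> N \<rightarrow>\<^sub>M m \<Otimes>\<^sub>M borel" by measurable
    show "(\<lambda>p. f (c p) (d p)) \<in> borel_measurable N"
      using measurable_compose[OF * f_meas] by simp
    show "(\<lambda>p. v (c p) (d p)) \<in> borel_measurable N"
      using measurable_compose[OF * v_meas] by simp
    show "(\<lambda>p. q (c p) (d p)) \<in> borel_measurable N"
      using measurable_compose[OF * q_meas] by simp
  qed
  have int_f: "integrable m (\<lambda>z. f z x)" and int_v: "integrable m (\<lambda>z. v z x)" and int_q: "integrable m (\<lambda>z. q z x)" for x
    using f[of x] v[of x] q[of x] by (auto intro!: integrableI_bounded simp: le_less_trans)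
  define K where "K = (\<integral>\<^sup>+y. ennreal (C * min ((norm y)\<^sup>2) 1) \<partial>\<nu>)"
  have K: "K < \<infinity>"
    using \<nu>_finite C unfolding K_def by (simp add: ennreal_mult nn_integral_cmult ennreal_mult_less_top)
  note J = Fubini_bounded[OF m \<nu>.sigma_finite_measure_axioms, where f = "\<lambda>z y. jump (f z) (v z) x y"
      and W = "\<lambda>y. ennreal (C * min ((norm y)\<^sup>2) 1)" for x, OF _ jump K[unfolded K_def]]
  have J_meas: "(\<lambda>(z, y). jump (f z) (v z) x y) \<in> borel_measurable (m \<Otimes>\<^sub>M \<nu>)" for x
    unfolding jump_def by measurable
  define g where "g = (\<lambda>z. levy_op b \<nu> (f z) (v z) (q z))"
  have g_meas: "case_prod g \<in> borel_measurable (m \<Otimes>\<^sub>M borel)"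
    unfolding g_def levy_op_def jump_def by measurable
  have g_meas' [measurable (raw)]: "(\<lambda>p. g (c p) (d p)) \<in> borel_measurable N"
    if [measurable]: "c \<in> N \<rightarrow>\<^sub>M m" "d \<in> N \<rightarrow>\<^sub>M borel" for N :: "'d measure" and c d
  proof -
    have *: "(\<lambda>p. (c p, d p)) \<in> N \<rightarrow>\<^sub>M m \<Otimes>\<^sub>M borel" by measurable
    show ?thesis using measurable_compose[OF * g_meas] by simp
  qed
  have op: "levy_op b \<nu> (\<lambda>x. LINT z|m. f z x) (\<lambda>x. LINT z|m. v z x) (\<lambda>x. LINT z|m. q z x) x = (LINT z|m. g z x)" for x
    unfolding levy_op_def integral_jump[OF int_f int_v] g_def
    using int_v int_q J(2)[OF J_meas, of x] by (simp add: J(1)[OF J_meas])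
  \<comment> \<open>The three summands bound the drift, the second-order term and the jump integral;
    the result is uniform in \<open>x\<close> and hence integrable over the finite measure
    \<open>\<eta>\<close>.\<close>
  define C' where "C' = ennreal (norm b) * ennreal C + ennreal C + K"
  have g_bound: "(\<integral>\<^sup>+z. ennreal \<bar>g z x\<bar> \<partial>m) \<le> C'" for x
  proof -
    have "(\<integral>\<^sup>+z. ennreal \<bar>g z x\<bar> \<partial>m)
        \<le> (\<integral>\<^sup>+z. ennreal (norm b) * ennreal (norm (v z x)) + ennreal \<bar>q z x\<bar> + ennreal \<bar>LINT y|\<nu>. jump (f z) (v z) x y\<bar> \<partial>m)"
    proof (rule nn_integral_mono)
      fix z
      have "\<bar>g z x\<bar> \<le> norm b * norm (v z x) + \<bar>q z x\<bar> + \<bar>LINT y|\<nu>. jump (f z) (v z) x y\<bar>"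
        unfolding g_def levy_op_def using Cauchy_Schwarz_ineq2[of b "v z x"] by linarith
      then show "ennreal \<bar>g z x\<bar> \<le> ennreal (norm b) * ennreal (norm (v z x)) + ennreal \<bar>q z x\<bar> + ennreal \<bar>LINT y|\<nu>. jump (f z) (v z) x y\<bar>"
        by (simp add: ennreal_mult[symmetric] ennreal_plus[symmetric] ennreal_leI del: ennreal_plus)
    qed
    also have "\<dots> = ennreal (norm b) * (\<integral>\<^sup>+z. ennreal (norm (v z x)) \<partial>m) + (\<integral>\<^sup>+z. ennreal \<bar>q z x\<bar> \<partial>m)
        + (\<integral>\<^sup>+z. ennreal \<bar>LINT y|\<nu>. jump (f z) (v z) x y\<bar> \<partial>m)"
      unfolding jump_def by (simp add: nn_integral_add nn_integral_cmult)
    also have "\<dots> \<le> C'"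
      unfolding C'_def K_def by (intro add_mono mult_left_mono v q J(3)[OF J_meas]) auto
    finally show ?thesis .
  qed
  have C': "C' < \<infinity>" using K unfolding C'_def by (simp add: ennreal_mult_less_top)
  have fin: "(\<integral>\<^sup>+y. ennreal C \<partial>\<mu>) < \<infinity>" "(\<integral>\<^sup>+y. C' \<partial>\<eta>) < \<infinity>"
    using C' \<mu>.emeasure_finite[of UNIV] \<eta>.emeasure_finite[of UNIV]
    by (simp_all add: ennreal_mult_eq_top_iff less_top[symmetric])
  have 1: "(LINT y|\<mu>. (LINT z|m. f z (x + y))) = (LINT z|m. (LINT y|\<mu>. f z (x + y)))" for x
    by (rule Fubini_bounded(1)[OF m \<mu>.sigma_finite_measure_axioms _ f fin(1)]) measurable
  have 3: "integrable m (\<lambda>z. LINT y|\<mu>. f z (x + y))" for x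
    by (rule Fubini_bounded(2)[OF m \<mu>.sigma_finite_measure_axioms _ f fin(1)]) measurable
  have 2: "(LINT y|\<eta>. (LINT z|m. g z (x + y))) = (LINT z|m. (LINT y|\<eta>. g z (x + y)))" for x
    by (rule Fubini_bounded(1)[OF m \<eta>.sigma_finite_measure_axioms _ g_bound fin(2)]) measurable
  show ?thesis
    unfolding dynkin_def op
  proof
    fix x
    have "(LINT y|\<mu>. (LINT z|m. f z (x + y))) - (LINT z|m. f z x) = (LINT z|m. (LINT y|\<mu>. f z (x + y)) - f z x)"
      using 1 3 int_f by simp
    also have "\<dots> = (LINT z|m. (LINT y|\<eta>. g z (x + y)))"
      using D unfolding dynkin_def g_def by (intro Bochner_Integration.integral_cong) auto
    finally show "(LINT y|\<mu>. (LINT z|m. f z (x + y))) - (LINT z|m. f z x) = (LINT y|\<eta>. (LINT z|m. g z (x + y)))"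
      by (simp only: 2)
  qed
qed

end

section \<open>Dynkin's formula for Gaussian convolutions\<close>

definition gauss_grad :: "real \<Rightarrow> 'a::euclidean_space \<Rightarrow> 'a" where
  "gauss_grad a x = (- 2 * a * gauss a x) *\<^sub>R x"

text \<open>The second derivative as a bilinear form: the remainder estimate evaluates it at the
  jump direction, the operator at coordinate vectors.\<close>

definition gauss_hess :: "real \<Rightarrow> 'a::euclidean_space \<Rightarrow> 'a \<Rightarrow> 'a \<Rightarrow> real" where
  "gauss_hess a x u w = (4 * a\<^sup>2 * (x \<bullet> u) * (x \<bullet> w) - 2 * a * (u \<bullet> w)) * gauss a x"

lemma borel_measurable_gauss_grad [measurable]: "gauss_grad a \<in> borel_measurable borel"
  unfolding gauss_grad_def by measurable

lemma borel_measurable_gauss_hess [measurable]: "(\<lambda>x. gauss_hess a x u w) \<in> borel_measurable borel"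
  unfolding gauss_hess_def by measurable

lemma gauss_line: "gauss a (x + s *\<^sub>R u) = exp (- a * ((norm x)\<^sup>2 + 2 * s * (x \<bullet> u) + s\<^sup>2 * (norm u)\<^sup>2))"
  unfolding gauss_def power2_norm_eq_inner power2_eq_square[of s]
  by (simp add: inner_add_left inner_add_right inner_commute algebra_simps)

lemma gauss_deriv:
  "((\<lambda>s. gauss a (x + s *\<^sub>R u)) has_real_derivative gauss_grad a (x + s *\<^sub>R u) \<bullet> u) (at s)"
  unfolding gauss_grad_def gauss_line
  by (auto intro!: derivative_eq_intros simp: inner_add_left power2_norm_eq_inner algebra_simps)

lemma gauss_grad_deriv:
  "((\<lambda>s. gauss_grad a (x + s *\<^sub>R u) \<bullet> w) has_real_derivative gauss_hess a (x + s *\<^sub>R u) u w) (at s)"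
proof -
  have "((\<lambda>s. - 2 * a * gauss a (x + s *\<^sub>R u) * ((x + s *\<^sub>R u) \<bullet> w)) has_real_derivative
      - 2 * a * (gauss_grad a (x + s *\<^sub>R u) \<bullet> u) * ((x + s *\<^sub>R u) \<bullet> w) + - 2 * a * gauss a (x + s *\<^sub>R u) * (u \<bullet> w)) (at s)"
    by (auto intro!: derivative_eq_intros gauss_deriv simp: inner_add_left)
  then show ?thesis
    by (simp add: gauss_grad_def gauss_hess_def algebra_simps power2_eq_square)
qed

text \<open>From |x| \<le> |x + u| + 1 and (r + 1)^2 \<le> 2 r^2 + 2: a shift by at most 1 costs
  half of the exponent and a factor \<open>exp a\<close>.\<close>

lemma gauss_shift:
  assumes "0 \<le> a" "norm u \<le> 1" shows "gauss a (x + u) \<le> exp a * gauss (a/2) x"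
proof -
  have "norm x \<le> norm (x + u) + 1"
    using norm_triangle_ineq4[of "x + u" u] assms by simp
  then have "(norm x)\<^sup>2 \<le> (norm (x + u) + 1)\<^sup>2" by (intro power_mono) auto
  also have "\<dots> \<le> 2 * (norm (x + u))\<^sup>2 + 2"
    using zero_le_power2[of "norm (x + u) - 1"] by (simp add: power2_eq_square algebra_simps)
  finally have "a/2 * (norm x)\<^sup>2 \<le> a/2 * (2 * (norm (x + u))\<^sup>2 + 2)"
    using assms by (intro mult_left_mono) auto
  then show ?thesis
    unfolding gauss_def exp_add[symmetric] by (simp add: mult_exp_exp algebra_simps)
qed

text \<open>The parameter drops from a to a/2 to absorb the polynomial factors of the derivatives,
  and from a/2 to a/4 to absorb the shift. Uniformity over unit shifts provides majorants for
  differentiating convolutions and for remainders along segments.\<close>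

lemma gauss_envelope:
  assumes a: "0 < a"
  obtains A where "0 \<le> A"
    and "\<And>x::'a::euclidean_space. gauss a x \<le> A * gauss (a/4) x"
    and "\<And>x u::'a. norm u \<le> 1 \<Longrightarrow> norm (gauss_grad a (x + u)) \<le> A * gauss (a/4) x"
    and "\<And>x u v w::'a. norm u \<le> 1 \<Longrightarrow> \<bar>gauss_hess a (x + u) v w\<bar> \<le> A * gauss (a/4) x * (norm v * norm w)"
proof -
  define E where "E j = exp (real j ^ 2 / (2 * a))" for j :: nat
  \<comment> \<open>The sum of the constants for the value, the gradient and the second derivative;
    all are nonnegative, so \<open>A0\<close> dominates each.\<close>
  define A0 where "A0 = E 0 + 2 * a * E 1 + (4 * a\<^sup>2 * E 2 + 2 * a * E 0)"
  have E: "0 \<le> E j" for j by (simp add: E_def)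
  have m: "norm x ^ j * gauss a x \<le> E j * gauss (a/2) x" for x :: 'a and j
    unfolding E_def by (rule gauss_moment_bound[OF a])
  have le: "B * gauss (a/2) (x + u) \<le> A0 * exp (a/2) * gauss (a/4) x" if "norm u \<le> 1" "B \<le> A0" for x u :: 'a and B
  proof -
    have "B * gauss (a/2) (x + u) \<le> A0 * gauss (a/2) (x + u)" using that by (intro mult_right_mono) auto
    also have "\<dots> \<le> A0 * (exp (a/2) * gauss (a/2/2) x)"
      using a E that by (intro mult_left_mono gauss_shift) (auto simp: A0_def)
    finally show ?thesis by (simp add: mult.assoc)
  qed
  show ?thesis
  proof (rule that[of "A0 * exp (a/2)"])
    show "0 \<le> A0 * exp (a/2)" using a E by (auto simp: A0_def)
    show "gauss a x \<le> A0 * exp (a/2) * gauss (a/4) x" for x :: 'a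
      using m[of x 0] le[of 0 "E 0" x] a E by (auto simp: A0_def intro: order_trans)
    show "norm (gauss_grad a (x + u)) \<le> A0 * exp (a/2) * gauss (a/4) x" if "norm u \<le> 1" for x u :: 'a
    proof -
      have "norm (gauss_grad a (x + u)) = 2 * a * (norm (x + u) ^ 1 * gauss a (x + u))"
        using a by (simp add: gauss_grad_def abs_mult)
      also have "\<dots> \<le> 2 * a * (E 1 * gauss (a/2) (x + u))" using a by (intro mult_left_mono m) auto
      also have "\<dots> = (2 * a * E 1) * gauss (a/2) (x + u)" by simp
      also have "\<dots> \<le> A0 * exp (a/2) * gauss (a/4) x" using a E that by (intro le) (auto simp: A0_def)
      finally show ?thesis .
    qed
    show "\<bar>gauss_hess a (x + u) v w\<bar> \<le> A0 * exp (a/2) * gauss (a/4) x * (norm v * norm w)" if "norm u \<le> 1" for x u v w :: 'a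
    proof -
      let ?z = "x + u"
      have "\<bar>4 * a\<^sup>2 * (?z \<bullet> v) * (?z \<bullet> w) - 2 * a * (v \<bullet> w)\<bar>
          \<le> 4 * a\<^sup>2 * (\<bar>?z \<bullet> v\<bar> * \<bar>?z \<bullet> w\<bar>) + 2 * a * \<bar>v \<bullet> w\<bar>"
        using abs_triangle_ineq4[of "4 * a\<^sup>2 * (?z \<bullet> v) * (?z \<bullet> w)" "2 * a * (v \<bullet> w)"] a by (simp add: abs_mult mult.assoc)
      also have "\<dots> \<le> 4 * a\<^sup>2 * ((norm ?z * norm v) * (norm ?z * norm w)) + 2 * a * (norm v * norm w)"
        using a by (intro add_mono mult_left_mono mult_mono Cauchy_Schwarz_ineq2) auto
      also have "\<dots> = (4 * a\<^sup>2 * norm ?z ^ 2 + 2 * a * norm ?z ^ 0) * (norm v * norm w)"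
        by (simp add: power2_eq_square algebra_simps)
      finally have "\<bar>gauss_hess a ?z v w\<bar> \<le> (4 * a\<^sup>2 * norm ?z ^ 2 + 2 * a * norm ?z ^ 0) * (norm v * norm w) * gauss a ?z"
        unfolding gauss_hess_def abs_mult[of _ "gauss a ?z"] by (simp add: mult_right_mono)
      also have "\<dots> = (4 * a\<^sup>2 * (norm ?z ^ 2 * gauss a ?z) + 2 * a * (norm ?z ^ 0 * gauss a ?z)) * (norm v * norm w)"
        by (simp add: algebra_simps)
      also have "\<dots> \<le> (4 * a\<^sup>2 * (E 2 * gauss (a/2) ?z) + 2 * a * (E 0 * gauss (a/2) ?z)) * (norm v * norm w)"
        using a by (intro mult_right_mono add_mono mult_left_mono m) auto
      also have "\<dots> = ((4 * a\<^sup>2 * E 2 + 2 * a * E 0) * gauss (a/2) ?z) * (norm v * norm w)"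
        by (simp add: algebra_simps)
      also have "\<dots> \<le> (A0 * exp (a/2) * gauss (a/4) x) * (norm v * norm w)"
        using a E that by (intro mult_right_mono le) (auto simp: A0_def)
      finally show ?thesis .
    qed
  qed
qed

text \<open>Moving the base point along the line carries the derivative from 0 to any
  \<open>s\<close>, so only derivatives at 0 ever have to be assumed.\<close>

lemma has_real_derivative_line:
  fixes F :: "'a::real_normed_vector \<Rightarrow> real"
  assumes "\<And>x. ((\<lambda>s. F (x + s *\<^sub>R u)) has_real_derivative F' x) (at 0)"
  shows "((\<lambda>s. F (x + s *\<^sub>R u)) has_real_derivative F' (x + s *\<^sub>R u)) (at s)"
proof -
  have "((\<lambda>r. F (x + s *\<^sub>R u + r *\<^sub>R u)) has_real_derivative F' (x + s *\<^sub>R u)) (at 0)"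
    by (rule assms)
  then have "((\<lambda>r. F (x + (r + s) *\<^sub>R u)) has_real_derivative F' (x + s *\<^sub>R u)) (at 0)"
    by (simp add: algebra_simps)
  then show ?thesis
    using DERIV_shift[of "\<lambda>s. F (x + s *\<^sub>R u)" "F' (x + s *\<^sub>R u)" 0 s] by simp
qed

text \<open>Two mean value steps along the segment from \<open>x\<close> to \<open>x + y\<close>.
  The Gaussian factor stays at the base point \<open>x\<close>, so the estimate can be integrated
  over all translates of the Gaussian.\<close>

lemma gauss_jump_bound:
  fixes x y :: "'a::euclidean_space"
  assumes A: "\<And>x u v w::'a. norm u \<le> 1 \<Longrightarrow> \<bar>gauss_hess a (x + u) v w\<bar> \<le> A * gauss (a/4) x * (norm v * norm w)"
    and y: "norm y \<le> 1"
  shows "\<bar>gauss a (x + y) - gauss a x - gauss_grad a x \<bullet> y\<bar> \<le> A * gauss (a/4) x * (norm y)\<^sup>2"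
proof -
  have "\<bar>gauss a (x + 1 *\<^sub>R y) - gauss a (x + 0 *\<^sub>R y) - gauss_grad a (x + 0 *\<^sub>R y) \<bullet> y\<bar> \<le> A * gauss (a/4) x * (norm y)\<^sup>2"
  proof (rule mean_value_linearization[of "\<lambda>s. gauss a (x + s *\<^sub>R y)" "\<lambda>s. gauss_grad a (x + s *\<^sub>R y) \<bullet> y"])
    fix s :: real assume s: "0 < s" "s < 1"
    have "\<exists>r. 0 < r \<and> r < s \<and> gauss_grad a (x + s *\<^sub>R y) \<bullet> y - gauss_grad a (x + 0 *\<^sub>R y) \<bullet> y
        = (s - 0) * gauss_hess a (x + r *\<^sub>R y) y y"
      by (rule MVT2[OF s(1), of "\<lambda>s. gauss_grad a (x + s *\<^sub>R y) \<bullet> y"]) (rule gauss_grad_deriv)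
    then obtain r where r: "0 < r" "r < s"
      and eq: "gauss_grad a (x + s *\<^sub>R y) \<bullet> y - gauss_grad a (x + 0 *\<^sub>R y) \<bullet> y = (s - 0) * gauss_hess a (x + r *\<^sub>R y) y y"
      by blast
    have ry: "norm (r *\<^sub>R y) \<le> 1" using r s y mult_le_one[of r "norm y"] by simp
    have "\<bar>(s - 0) * gauss_hess a (x + r *\<^sub>R y) y y\<bar> \<le> \<bar>gauss_hess a (x + r *\<^sub>R y) y y\<bar>"
      using s by (simp add: abs_mult mult_left_le_one_le)
    also have "\<dots> \<le> A * gauss (a/4) x * (norm y * norm y)" by (rule A[OF ry])
    finally show "\<bar>gauss_grad a (x + s *\<^sub>R y) \<bullet> y - gauss_grad a (x + 0 *\<^sub>R y) \<bullet> y\<bar> \<le> A * gauss (a/4) x * (norm y)\<^sup>2"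
      unfolding eq by (simp add: power2_eq_square)
  qed (rule gauss_deriv)
  then show ?thesis by simp
qed

text \<open>Half the trace of \<open>Q\<close> times the matrix of the form \<open>B\<close>; the
  order of the indices agrees term by term with \<open>trace_hessian\<close>.\<close>

definition second_order :: "real ^ 'n ^ 'n \<Rightarrow> (real ^ 'n \<Rightarrow> real ^ 'n \<Rightarrow> real) \<Rightarrow> real" where
  "second_order Q B = 1/2 * (\<Sum>i\<in>UNIV. \<Sum>j\<in>UNIV. Q $ i $ j * B (axis j 1) (axis i 1))"

text \<open>The case of a cosine, whose second derivative is a multiple of this rank-one
  form.\<close>

lemma second_order_rank_one:
  "second_order Q (\<lambda>u w. r * ((\<xi> \<bullet> u) * (\<xi> \<bullet> w))) = 1/2 * r * (\<xi> \<bullet> (Q *v \<xi>))"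
proof -
  have "\<xi> \<bullet> (Q *v \<xi>) = (\<Sum>i\<in>UNIV. \<Sum>j\<in>UNIV. \<xi> $ i * (Q $ i $ j * \<xi> $ j))"
    by (simp add: inner_vec_def matrix_vector_mult_def sum_distrib_left)
  then show ?thesis
    by (simp add: second_order_def inner_axis sum_distrib_left mult_ac)
qed

lemma second_order_scale: "second_order Q (\<lambda>u w. r * B u w) = r * second_order Q B"
  by (simp add: second_order_def sum_distrib_left mult_ac)

lemma second_order_integral:
  assumes "\<And>u w. integrable m (\<lambda>z. B z u w)"
  shows "(LINT z|m. second_order Q (B z)) = second_order Q (\<lambda>u w. LINT z|m. B z u w)"
    and "integrable m (\<lambda>z. second_order Q (B z))"
  unfolding second_order_def using assms by simp_all

lemma second_order_bound:
  assumes "\<And>u w. \<bar>B u w\<bar> \<le> K * (norm u * norm w)"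
  shows "\<bar>second_order Q B\<bar> \<le> (1/2 * (\<Sum>i\<in>UNIV. \<Sum>j\<in>UNIV. \<bar>Q $ i $ j\<bar>)) * K"
proof -
  have "\<bar>\<Sum>i\<in>UNIV. \<Sum>j\<in>UNIV. Q $ i $ j * B (axis j 1) (axis i 1)\<bar> \<le> (\<Sum>i\<in>UNIV. \<Sum>j\<in>UNIV. \<bar>Q $ i $ j\<bar> * K)"
    using assms[of "axis _ 1" "axis _ 1"]
    by (intro order_trans[OF sum_abs] sum_mono) (simp add: abs_mult mult_left_mono)
  then show ?thesis
    by (simp add: second_order_def sum_distrib_right)
qed

section \<open>Gaussians as mixtures of cosines\<close>

lemma integrable_gauss_moment:
  assumes "0 < a" shows "integrable lborel (\<lambda>z::'a::euclidean_space. norm z ^ j * gauss a z)"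
  by (rule Bochner_Integration.integrable_bound[OF integrable_mult_right[OF integrable_gauss[of "a/2"], of "exp (real j ^ 2 / (2 * a))"]])
    (use assms gauss_moment_bound[OF assms, of _ j] in \<open>auto simp: abs_mult\<close>)

abbreviation gauss_mass :: "'a::euclidean_space itself \<Rightarrow> real" where
  "gauss_mass _ \<equiv> LINT z|lborel. gauss (1/2) (z::'a)"

lemma gauss_fourier_scaled:
  fixes x :: "'a::euclidean_space"
  shows "(LINT z|lborel. gauss (1/2) z * cos ((c *\<^sub>R z) \<bullet> x)) = gauss_mass TYPE('a) * gauss (c\<^sup>2/2) x"
  using gauss_fourier[of "c *\<^sub>R x"] by (simp add: gauss_def power_mult_distrib)

text \<open>The Fourier representation of the Gaussian is differentiated under the integral in a
  direction \<open>u\<close>; uniqueness of the derivative identifies the result with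
  \<open>gauss_grad\<close>. The vector identity follows by testing against every
  \<open>u\<close>.\<close>

lemma gauss_fourier_grad:
  fixes x :: "'a::euclidean_space"
  shows "integrable lborel (\<lambda>z. gauss (1/2) z *\<^sub>R (- sin ((c *\<^sub>R z) \<bullet> x) *\<^sub>R c *\<^sub>R z))"
    and "(LINT z|lborel. gauss (1/2) z *\<^sub>R (- sin ((c *\<^sub>R z) \<bullet> x) *\<^sub>R c *\<^sub>R z)) = gauss_mass TYPE('a) *\<^sub>R gauss_grad (c\<^sup>2/2) x"
proof -
  show int: "integrable lborel (\<lambda>z. gauss (1/2) z *\<^sub>R (- sin ((c *\<^sub>R z) \<bullet> x) *\<^sub>R c *\<^sub>R z))" for x :: 'a
    by (rule Bochner_Integration.integrable_bound[OF integrable_mult_right[OF integrable_gauss_moment[of "1/2" 1], of "\<bar>c\<bar>"]])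
      (auto simp: abs_mult intro!: mult_left_le_one_le)
  show "(LINT z|lborel. gauss (1/2) z *\<^sub>R (- sin ((c *\<^sub>R z) \<bullet> x) *\<^sub>R c *\<^sub>R z)) = gauss_mass TYPE('a) *\<^sub>R gauss_grad (c\<^sup>2/2) x"
    (is "?l = ?r")
  proof (rule vector_eq_rdot[THEN iffD1], rule allI)
    fix u :: 'a
    have i: "integrable lborel (\<lambda>z::'a. gauss (1/2) z * cos ((c *\<^sub>R z) \<bullet> x))" for x
      by (rule Bochner_Integration.integrable_bound[OF integrable_gauss[of "1/2"]]) (auto simp: abs_mult mult_left_le)
    have "((\<lambda>s. LINT z|lborel. gauss (1/2) z * cos ((c *\<^sub>R z) \<bullet> (x + s *\<^sub>R u))) has_real_derivative
        (LINT z|lborel. gauss (1/2) z * (- sin ((c *\<^sub>R z) \<bullet> (x + 0 *\<^sub>R u)) * ((c *\<^sub>R z) \<bullet> u)))) (at 0)"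
    proof (rule has_real_derivative_integral[where B = "\<lambda>z. (\<bar>c\<bar> * norm u) * (norm z ^ 1 * gauss (1/2) z)"])
      show "((\<lambda>s. gauss (1/2) z * cos ((c *\<^sub>R z) \<bullet> (x + s *\<^sub>R u))) has_real_derivative
          gauss (1/2) z * (- sin ((c *\<^sub>R z) \<bullet> (x + s *\<^sub>R u)) * ((c *\<^sub>R z) \<bullet> u))) (at s)" for s z
        by (auto intro!: derivative_eq_intros simp: inner_add_right)
      show "\<bar>gauss (1/2) z * (- sin ((c *\<^sub>R z) \<bullet> (x + s *\<^sub>R u)) * ((c *\<^sub>R z) \<bullet> u))\<bar> \<le> (\<bar>c\<bar> * norm u) * (norm z ^ 1 * gauss (1/2) z)" for s z
      proof -
        have "\<bar>- sin ((c *\<^sub>R z) \<bullet> (x + s *\<^sub>R u)) * ((c *\<^sub>R z) \<bullet> u)\<bar> \<le> 1 * (norm (c *\<^sub>R z) * norm u)"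
          unfolding abs_mult by (intro mult_mono Cauchy_Schwarz_ineq2) auto
        then show ?thesis
          unfolding abs_mult[of "gauss (1/2) z"] using mult_left_mono[of _ _ "gauss (1/2) z"] by (fastforce simp: mult_ac)
      qed
    qed (use i integrable_mult_right[OF integrable_gauss_moment[of "1/2" 1]] in auto)
    then have "((\<lambda>s. gauss_mass TYPE('a) * gauss (c\<^sup>2/2) (x + s *\<^sub>R u)) has_real_derivative
        (LINT z|lborel. gauss (1/2) z * (- sin ((c *\<^sub>R z) \<bullet> x) * ((c *\<^sub>R z) \<bullet> u)))) (at 0)"
      unfolding gauss_fourier_scaled by simp
    moreover have "((\<lambda>s. gauss_mass TYPE('a) * gauss (c\<^sup>2/2) (x + s *\<^sub>R u)) has_real_derivative
        gauss_mass TYPE('a) * (gauss_grad (c\<^sup>2/2) (x + 0 *\<^sub>R u) \<bullet> u)) (at 0)"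
      by (intro DERIV_cmult gauss_deriv)
    ultimately have "(LINT z|lborel. gauss (1/2) z * (- sin ((c *\<^sub>R z) \<bullet> x) * ((c *\<^sub>R z) \<bullet> u))) = ?r \<bullet> u"
      by (auto dest: DERIV_unique)
    moreover have "?l \<bullet> u = (LINT z|lborel. (gauss (1/2) z *\<^sub>R (- sin ((c *\<^sub>R z) \<bullet> x) *\<^sub>R c *\<^sub>R z)) \<bullet> u)"
      by (rule integral_inner_left[OF int, symmetric])
    ultimately show "?l \<bullet> u = ?r \<bullet> u"
      by (simp add: mult_ac)
  qed
qed

text \<open>The representation of the gradient, paired with \<open>w\<close>, is differentiated once
  more, with the second moment of the Gaussian as majorant.\<close>

lemma gauss_fourier_hess:
  fixes x u w :: "'a::euclidean_space"
  shows "integrable lborel (\<lambda>z. gauss (1/2) z * (- cos ((c *\<^sub>R z) \<bullet> x) * (((c *\<^sub>R z) \<bullet> u) * ((c *\<^sub>R z) \<bullet> w))))"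
    and "(LINT z|lborel. gauss (1/2) z * (- cos ((c *\<^sub>R z) \<bullet> x) * (((c *\<^sub>R z) \<bullet> u) * ((c *\<^sub>R z) \<bullet> w))))
      = gauss_mass TYPE('a) * gauss_hess (c\<^sup>2/2) x u w"
proof -
  have bd: "\<bar>gauss (1/2) z * (- cos r * (((c *\<^sub>R z) \<bullet> u) * ((c *\<^sub>R z) \<bullet> w)))\<bar> \<le> (c\<^sup>2 * norm u * norm w) * (norm z ^ 2 * gauss (1/2) z)" for r and z :: 'a
  proof -
    have "\<bar>- cos r * (((c *\<^sub>R z) \<bullet> u) * ((c *\<^sub>R z) \<bullet> w))\<bar> \<le> 1 * ((norm (c *\<^sub>R z) * norm u) * (norm (c *\<^sub>R z) * norm w))"
      unfolding abs_mult by (intro mult_mono Cauchy_Schwarz_ineq2) auto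
    also have "\<dots> = (c\<^sup>2 * norm u * norm w) * norm z ^ 2"
      by (simp add: power2_eq_square mult_ac abs_mult[symmetric])
    finally show ?thesis
      unfolding abs_mult[of "gauss (1/2) z"] using mult_left_mono[of _ _ "gauss (1/2) z"] by (fastforce simp: mult_ac)
  qed
  show int: "integrable lborel (\<lambda>z. gauss (1/2) z * (- cos ((c *\<^sub>R z) \<bullet> x) * (((c *\<^sub>R z) \<bullet> u) * ((c *\<^sub>R z) \<bullet> w))))" for x :: 'a
    by (rule Bochner_Integration.integrable_bound[OF integrable_mult_right[OF integrable_gauss_moment[of "1/2" 2], of "c\<^sup>2 * norm u * norm w"]])
      (use bd in \<open>auto simp: abs_mult\<close>)
  have eq: "(LINT z|lborel. gauss (1/2) z * (- sin ((c *\<^sub>R z) \<bullet> x) * ((c *\<^sub>R z) \<bullet> w))) = gauss_mass TYPE('a) * (gauss_grad (c\<^sup>2/2) x \<bullet> w)"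
    and i: "integrable lborel (\<lambda>z. gauss (1/2) z * (- sin ((c *\<^sub>R z) \<bullet> x) * ((c *\<^sub>R z) \<bullet> w)))" for x :: 'a
  proof -
    let ?v = "\<lambda>z. gauss (1/2) z *\<^sub>R (- sin ((c *\<^sub>R z) \<bullet> x) *\<^sub>R c *\<^sub>R z)"
    have v: "?v z \<bullet> w = gauss (1/2) z * (- sin ((c *\<^sub>R z) \<bullet> x) * ((c *\<^sub>R z) \<bullet> w))" for z
      by (simp only: inner_scaleR_left)
    show "integrable lborel (\<lambda>z. gauss (1/2) z * (- sin ((c *\<^sub>R z) \<bullet> x) * ((c *\<^sub>R z) \<bullet> w)))"
      unfolding v[symmetric] by (intro integrable_inner_left gauss_fourier_grad(1))
    show "(LINT z|lborel. gauss (1/2) z * (- sin ((c *\<^sub>R z) \<bullet> x) * ((c *\<^sub>R z) \<bullet> w))) = gauss_mass TYPE('a) * (gauss_grad (c\<^sup>2/2) x \<bullet> w)"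
      unfolding v[symmetric] integral_inner_left[OF gauss_fourier_grad(1)] gauss_fourier_grad(2) by simp
  qed
  have "((\<lambda>s. LINT z|lborel. gauss (1/2) z * (- sin ((c *\<^sub>R z) \<bullet> (x + s *\<^sub>R u)) * ((c *\<^sub>R z) \<bullet> w))) has_real_derivative
      (LINT z|lborel. gauss (1/2) z * (- cos ((c *\<^sub>R z) \<bullet> (x + 0 *\<^sub>R u)) * (((c *\<^sub>R z) \<bullet> u) * ((c *\<^sub>R z) \<bullet> w))))) (at 0)"
  proof (rule has_real_derivative_integral[where B = "\<lambda>z. (c\<^sup>2 * norm u * norm w) * (norm z ^ 2 * gauss (1/2) z)"])
    show "((\<lambda>s. gauss (1/2) z * (- sin ((c *\<^sub>R z) \<bullet> (x + s *\<^sub>R u)) * ((c *\<^sub>R z) \<bullet> w))) has_real_derivative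
        gauss (1/2) z * (- cos ((c *\<^sub>R z) \<bullet> (x + s *\<^sub>R u)) * (((c *\<^sub>R z) \<bullet> u) * ((c *\<^sub>R z) \<bullet> w)))) (at s)" for s z
      by (auto intro!: derivative_eq_intros simp: inner_add_right)
  qed (use i bd integrable_mult_right[OF integrable_gauss_moment[of "1/2" 2]] in auto)
  then have "((\<lambda>s. gauss_mass TYPE('a) * (gauss_grad (c\<^sup>2/2) (x + s *\<^sub>R u) \<bullet> w)) has_real_derivative
      (LINT z|lborel. gauss (1/2) z * (- cos ((c *\<^sub>R z) \<bullet> x) * (((c *\<^sub>R z) \<bullet> u) * ((c *\<^sub>R z) \<bullet> w))))) (at 0)"
    unfolding eq by simp
  moreover have "((\<lambda>s. gauss_mass TYPE('a) * (gauss_grad (c\<^sup>2/2) (x + s *\<^sub>R u) \<bullet> w)) has_real_derivative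
      gauss_mass TYPE('a) * gauss_hess (c\<^sup>2/2) (x + 0 *\<^sub>R u) u w) (at 0)"
    by (intro DERIV_cmult gauss_grad_deriv)
  ultimately show "(LINT z|lborel. gauss (1/2) z * (- cos ((c *\<^sub>R z) \<bullet> x) * (((c *\<^sub>R z) \<bullet> u) * ((c *\<^sub>R z) \<bullet> w))))
      = gauss_mass TYPE('a) * gauss_hess (c\<^sup>2/2) x u w"
    by (auto dest: DERIV_unique)
qed

context dynkin_measures
begin

text \<open>Cosines of frequency \<open>c *\<^sub>R z\<close> are mixed with weight
  \<open>gauss (1/2) z\<close>; the three components then integrate to the Gaussian, its gradient
  and its second-order term, each times the mass \<open>Z\<close>. The choice c^2 = 2a produces the
  parameter \<open>a\<close>.\<close>

lemma dynkin_gauss: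
  assumes a: "0 < a"
  shows "dynkin (gauss a) (levy_op b \<nu> (gauss a) (gauss_grad a) (\<lambda>x. second_order Q (gauss_hess a x)))"
proof -
  define c where "c = sqrt (2 * a)"
  have c: "c\<^sup>2/2 = a" using a by (simp add: c_def)
  define Z where "Z = gauss_mass TYPE(real^'n)"
  have Z: "0 < Z" unfolding Z_def by (rule integral_gauss_pos)
  define f where "f z x = gauss (1/2) z * cos ((c *\<^sub>R z) \<bullet> x)" for z x :: "real^'n"
  define v where "v z x = gauss (1/2) z *\<^sub>R (- sin ((c *\<^sub>R z) \<bullet> x) *\<^sub>R c *\<^sub>R z)" for z x :: "real^'n"
  define q where "q z x = gauss (1/2) z * (- 1/2 * cos ((c *\<^sub>R z) \<bullet> x) * ((c *\<^sub>R z) \<bullet> (Q *v (c *\<^sub>R z))))" for z x :: "real^'n"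
  define K where "K = onorm ((*v) Q)"
  have K: "0 \<le> K" unfolding K_def by (rule onorm_pos_le) (rule matrix_vector_mul_bounded_linear)
  \<comment> \<open>One majorant for everything: the constant 2 covers the cosine and the large
    jumps, r \<le> 2 + r^2 covers the gradient, the operator norm \<open>K\<close> of
    \<open>Q\<close> covers the second-order term, and the extra 1 covers the small jumps. Second
    moments make it integrable.\<close>
  define B where "B z = (K + 1) * c\<^sup>2 * (norm z ^ 2 * gauss (1/2) z) + 2 * gauss (1/2) z" for z :: "real^'n"
  have B_eq: "B z = gauss (1/2) z * (2 + (K + 1) * norm (c *\<^sub>R z) ^ 2)" for z
    by (simp add: B_def power_mult_distrib algebra_simps)
  have intB: "integrable lborel B"
    unfolding B_def
    by (intro Bochner_Integration.integrable_add integrable_mult_right integrable_gauss_moment integrable_gauss) simp_all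
  have B_nonneg: "0 \<le> B z" for z unfolding B_eq using K by (intro mult_nonneg_nonneg add_nonneg_nonneg) auto
  have nnB: "(\<integral>\<^sup>+z. ennreal (B z) \<partial>lborel) = ennreal (LINT z|lborel. B z)"
    by (rule nn_integral_eq_integral[OF intB]) (simp add: B_nonneg)
  have fb: "\<bar>f z x\<bar> \<le> B z" for z x
  proof -
    have "\<bar>cos ((c *\<^sub>R z) \<bullet> x)\<bar> \<le> 2 + (K + 1) * norm (c *\<^sub>R z) ^ 2"
      using K by (intro order_trans[OF abs_cos_le_one]) (simp add: add_increasing2)
    then show ?thesis by (simp add: f_def B_eq abs_mult mult_left_mono)
  qed
  have vb: "norm (v z x) \<le> B z" for z x
  proof -
    have "\<bar>sin ((c *\<^sub>R z) \<bullet> x)\<bar> * norm (c *\<^sub>R z) \<le> 1 * norm (c *\<^sub>R z)" by (intro mult_right_mono) auto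
    also have "\<dots> \<le> 2 + norm (c *\<^sub>R z) ^ 2"
    proof -
      have "r \<le> 2 + r\<^sup>2" for r :: real
        using zero_le_power2[of "r - 1/2"] by (simp add: power2_eq_square algebra_simps)
      then show ?thesis by simp
    qed
    also have "\<dots> \<le> 2 + (K + 1) * norm (c *\<^sub>R z) ^ 2"
      using K by (simp add: mult_right_mono[of 1 "K+1"] distrib_right)
    finally show ?thesis by (simp add: v_def B_eq abs_mult mult_left_mono)
  qed
  have qb: "\<bar>q z x\<bar> \<le> B z" for z x
  proof -
    let ?w = "c *\<^sub>R z"
    have "\<bar>- 1/2 * cos (?w \<bullet> x) * (?w \<bullet> (Q *v ?w))\<bar> \<le> 1 * (norm ?w * norm (Q *v ?w))"
      unfolding abs_mult[of _ "?w \<bullet> (Q *v ?w)"] by (intro mult_mono Cauchy_Schwarz_ineq2) (auto simp: abs_mult intro: order_trans[OF abs_cos_le_one])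
    also have "\<dots> \<le> norm ?w * (K * norm ?w)"
      unfolding K_def using onorm[OF matrix_vector_mul_bounded_linear, of Q ?w] by (simp add: mult_left_mono)
    also have "\<dots> \<le> 2 + (K + 1) * norm ?w ^ 2"
      by (simp add: power2_eq_square algebra_simps)
    finally show ?thesis unfolding q_def B_eq abs_mult[of "gauss (1/2) z"] by (simp add: mult_left_mono)
  qed
  have jb: "\<bar>jump (f z) (v z) x y\<bar> \<le> B z * min ((norm y)\<^sup>2) 1" for z x y
  proof -
    have "jump (f z) (v z) x y = gauss (1/2) z * jump (\<lambda>x. cos ((c *\<^sub>R z) \<bullet> x)) (\<lambda>x. - sin ((c *\<^sub>R z) \<bullet> x) *\<^sub>R c *\<^sub>R z) x y"
      by (simp add: jump_def f_def v_def algebra_simps)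
    also have "\<bar>\<dots>\<bar> \<le> gauss (1/2) z * ((2 + (norm (c *\<^sub>R z))\<^sup>2) * min ((norm y)\<^sup>2) 1)"
      unfolding abs_mult[of "gauss (1/2) z"] using jump_cos_bound[of "c *\<^sub>R z" x y] by (simp add: mult_left_mono)
    also have "\<dots> \<le> gauss (1/2) z * ((2 + (K + 1) * (norm (c *\<^sub>R z))\<^sup>2) * min ((norm y)\<^sup>2) 1)"
      using K by (intro mult_left_mono mult_right_mono add_mono) (auto simp: distrib_right)
    finally show ?thesis by (simp add: B_eq mult.assoc)
  qed
  have [measurable]: "(*v) Q \<in> borel_measurable borel"
    by (intro borel_measurable_continuous_onI linear_continuous_on matrix_vector_mul_bounded_linear)
  have meas: "case_prod f \<in> borel_measurable (lborel \<Otimes>\<^sub>M borel)" "case_prod v \<in> borel_measurable (lborel \<Otimes>\<^sub>M borel)"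
      "case_prod q \<in> borel_measurable (lborel \<Otimes>\<^sub>M borel)"
    unfolding f_def v_def q_def by measurable
  have le: "(\<integral>\<^sup>+z. ennreal (h z) \<partial>lborel) \<le> ennreal (LINT z|lborel. B z)" if "\<And>z. h z \<le> B z" for h
    unfolding nnB[symmetric] by (intro nn_integral_mono ennreal_leI that)
  have "dynkin (\<lambda>x. LINT z|lborel. f z x)
      (levy_op b \<nu> (\<lambda>x. LINT z|lborel. f z x) (\<lambda>x. LINT z|lborel. v z x) (\<lambda>x. LINT z|lborel. q z x))"
  proof (rule dynkin_mixture[OF lborel.sigma_finite_measure_axioms meas, where C = "LINT z|lborel. B z"])
    show "0 \<le> (LINT z|lborel. B z)" by (intro Bochner_Integration.integral_nonneg B_nonneg)
    show "(\<integral>\<^sup>+z. ennreal \<bar>jump (f z) (v z) x y\<bar> \<partial>lborel) \<le> ennreal ((LINT z|lborel. B z) * min ((norm y)\<^sup>2) 1)" for x y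
    proof -
      have "(\<integral>\<^sup>+z. ennreal \<bar>jump (f z) (v z) x y\<bar> \<partial>lborel) \<le> (\<integral>\<^sup>+z. ennreal (B z) * ennreal (min ((norm y)\<^sup>2) 1) \<partial>lborel)"
        using jb by (intro nn_integral_mono) (simp add: ennreal_mult[symmetric] B_nonneg ennreal_leI)
      also have "\<dots> = ennreal ((LINT z|lborel. B z) * min ((norm y)\<^sup>2) 1)"
        using intB by (subst nn_integral_multc) (auto simp: nnB ennreal_mult' intro!: ennreal_mult[symmetric] Bochner_Integration.integral_nonneg B_nonneg)
      finally show ?thesis .
    qed
    show "dynkin (f z) (levy_op b \<nu> (f z) (v z) (q z))" for z
      using dynkin_scaled_translate[OF dynkin_cos[of "c *\<^sub>R z"], of "gauss (1/2) z" 0] by (simp add: f_def[abs_def] v_def[abs_def] q_def[abs_def])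
  qed (intro le fb vb qb)+
  moreover have "(LINT z|lborel. f z x) = Z * gauss a (x - 0)" for x
    using gauss_fourier_scaled[of c x] by (simp add: f_def Z_def c)
  moreover have "(LINT z|lborel. v z x) = Z *\<^sub>R gauss_grad a (x - 0)" for x
    using gauss_fourier_grad(2)[of c x] by (simp add: v_def Z_def c)
  moreover have "(LINT z|lborel. q z x) = Z * second_order Q (gauss_hess a (x - 0))" for x
  proof -
    have "q z x = second_order Q (\<lambda>u w. gauss (1/2) z * (- cos ((c *\<^sub>R z) \<bullet> x) * (((c *\<^sub>R z) \<bullet> u) * ((c *\<^sub>R z) \<bullet> w))))" for z
      unfolding second_order_scale q_def using second_order_rank_one[of Q 1 "c *\<^sub>R z"] by simp
    then have "(LINT z|lborel. q z x) = second_order Q (\<lambda>u w. Z * gauss_hess a x u w)"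
      by (simp only: second_order_integral(1)[OF gauss_fourier_hess(1)] gauss_fourier_hess(2) Z_def c)
    then show ?thesis by (simp add: second_order_scale)
  qed
  ultimately have "dynkin (\<lambda>x. Z * gauss a (x - 0))
      (levy_op b \<nu> (\<lambda>x. Z * gauss a (x - 0)) (\<lambda>x. Z *\<^sub>R gauss_grad a (x - 0)) (\<lambda>x. Z * second_order Q (gauss_hess a (x - 0))))"
    by simp
  from dynkin_scaled_translate[OF this, of "1/Z" 0] Z show ?thesis
    by simp
qed

end

section \<open>Convolutions of bounded functions with Gaussians\<close>

lemma nn_integral_gauss_translate:
  fixes x :: "'a::euclidean_space"
  assumes "0 < a" "0 \<le> K"
  shows "(\<integral>\<^sup>+z. ennreal (K * gauss a (x - z)) \<partial>lborel) = ennreal (K * (LINT z|lborel. gauss a (z::'a)))"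
proof -
  have "(\<integral>\<^sup>+z. ennreal (K * gauss a (x - z)) \<partial>lborel) = (\<integral>\<^sup>+z. ennreal (K * gauss a (z::'a)) \<partial>lborel)"
    using nn_integral_lborel_translate[of "\<lambda>z. ennreal (K * gauss a z)" x] by simp
  also have "\<dots> = ennreal (LINT z|lborel. K * gauss a (z::'a))"
    using assms by (intro nn_integral_eq_integral integrable_mult_right integrable_gauss) auto
  finally show ?thesis by simp
qed

lemma integrable_gauss_translate:
  fixes x :: "'a::euclidean_space"
  assumes "0 < a" shows "integrable lborel (\<lambda>z. gauss a (x - z))"
  using nn_integral_gauss_translate[OF assms, of 1 x] by (intro integrableI_nonneg) auto

text \<open>The mean of \<open>h\<close> at \<open>x\<close> minus 1/c times a standard Gaussian
  vector. The scale sits in the argument of \<open>h\<close>, so the probability weight is the same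
  for all \<open>c\<close>, and bounds, increments and the limit of large \<open>c\<close> can be
  read off directly.\<close>

definition gauss_avg :: "real \<Rightarrow> ('a::euclidean_space \<Rightarrow> real) \<Rightarrow> 'a \<Rightarrow> real" where
  "gauss_avg c h x = (LINT u|lborel. gauss (1/2) u * h (x - u /\<^sub>R c)) / gauss_mass TYPE('a)"

text \<open>The same average with the dependence on \<open>x\<close> moved to the kernel, where it
  can be differentiated even when \<open>h\<close> is merely bounded and measurable.\<close>

lemma gauss_avg_eq_convolution:
  fixes h :: "'a::euclidean_space \<Rightarrow> real"
  assumes [measurable]: "h \<in> borel_measurable borel" and c: "0 < c"
  shows "gauss_avg c h x = (LINT z|lborel. (c ^ DIM('a) / gauss_mass TYPE('a)) * h z * gauss (c\<^sup>2/2) (x - z))"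
proof -
  have g: "gauss (c\<^sup>2/2) (u /\<^sub>R c) = gauss (1/2) u" for u :: 'a
    using c by (simp add: gauss_def power_mult_distrib field_simps)
  have "(LINT z|lborel. h z * gauss (c\<^sup>2/2) (x - z)) = (LINT u|lborel. gauss (1/2) u * h (x - u /\<^sub>R c)) / c ^ DIM('a)"
    by (subst integral_lborel_affine_scaled[OF _ c, of _ x]) (simp_all add: g mult.commute)
  then show ?thesis
    using c by (simp add: gauss_avg_def mult.assoc)
qed

context
  fixes h :: "real ^ 'n \<Rightarrow> real" and H a :: real
  assumes h [measurable]: "h \<in> borel_measurable borel" and H: "\<And>z. \<bar>h z\<bar> \<le> H" and a: "0 < a"
begin

lemma bound_nonneg: "0 \<le> H"
  using H[of 0] by linarith

lemma integrable_convolution: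
  fixes g :: "real ^ 'n \<Rightarrow> 'b::{banach, second_countable_topology, real_normed_vector}"
  assumes [measurable]: "g \<in> borel_measurable borel" and g: "\<And>z. norm (g z) \<le> A * gauss (a/4) z"
  shows "integrable lborel (\<lambda>z. h z *\<^sub>R g (x - z))"
proof (rule Bochner_Integration.integrable_bound[OF integrable_mult_right[OF integrable_gauss_translate[of "a/4" x], of "H * A"]])
  show "AE z in lborel. norm (h z *\<^sub>R g (x - z)) \<le> norm (H * A * gauss (a/4) (x - z))"
  proof (rule AE_I2)
    fix z
    have "norm (h z *\<^sub>R g (x - z)) \<le> H * (A * gauss (a/4) (x - z))"
      unfolding norm_scaleR using bound_nonneg by (intro mult_mono H g) auto
    then show "norm (h z *\<^sub>R g (x - z)) \<le> norm (H * A * gauss (a/4) (x - z))"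
      by (simp add: mult.assoc)
  qed
qed (use a in auto)

text \<open>The derivative falls on the kernel. For |s| < 1 and |u| \<le> 1 the shift stays in the
  unit ball, where the envelope gives a majorant depending on \<open>x - z\<close> alone.\<close>

lemma convolution_deriv:
  fixes g g' :: "real ^ 'n \<Rightarrow> real"
  assumes [measurable]: "g \<in> borel_measurable borel"
    and g: "\<And>z. \<bar>g z\<bar> \<le> A * gauss (a/4) z"
    and der: "\<And>x s. ((\<lambda>s. g (x + s *\<^sub>R u)) has_real_derivative g' (x + s *\<^sub>R u)) (at s)"
    and g': "\<And>z v. norm v \<le> 1 \<Longrightarrow> \<bar>g' (z + v)\<bar> \<le> A' * gauss (a/4) z"
    and u: "norm u \<le> 1"
  shows "((\<lambda>s. LINT z|lborel. h z * g (x + s *\<^sub>R u - z)) has_real_derivative (LINT z|lborel. h z * g' (x - z))) (at 0)"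
proof -
  have eq: "x + s *\<^sub>R u - z = (x - z) + s *\<^sub>R u" for s z by simp
  have "((\<lambda>s. LINT z|lborel. h z * g (x + s *\<^sub>R u - z)) has_real_derivative (LINT z|lborel. h z * g' (x + 0 *\<^sub>R u - z))) (at 0)"
  proof (rule has_real_derivative_integral[where B = "\<lambda>z. H * A' * gauss (a/4) (x - z)"])
    show "integrable lborel (\<lambda>z. h z * g (x + s *\<^sub>R u - z))" for s
      using integrable_convolution[of g A "x + s *\<^sub>R u"] g by simp
    show "((\<lambda>s. h z * g (x + s *\<^sub>R u - z)) has_real_derivative h z * g' (x + s *\<^sub>R u - z)) (at s)" for s z
      unfolding eq by (intro DERIV_cmult der)
    show "\<bar>h z * g' (x + s *\<^sub>R u - z)\<bar> \<le> H * A' * gauss (a/4) (x - z)" if "\<bar>s\<bar> < 1" for s z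
    proof -
      have "norm (s *\<^sub>R u) \<le> 1" using that u mult_le_one[of "\<bar>s\<bar>" "norm u"] by simp
      then have "\<bar>h z\<bar> * \<bar>g' ((x - z) + s *\<^sub>R u)\<bar> \<le> H * (A' * gauss (a/4) (x - z))"
        using bound_nonneg by (intro mult_mono H g') auto
      then show ?thesis unfolding eq by (simp add: abs_mult mult.assoc)
    qed
    show "integrable lborel (\<lambda>z. H * A' * gauss (a/4) (x - z))"
      using a by (intro integrable_mult_right integrable_gauss_translate) simp
  qed
  then show ?thesis by simp
qed

lemma gauss_convolution_deriv:
  assumes u: "norm u \<le> 1"
  shows "((\<lambda>s. LINT z|lborel. h z * gauss a (x + s *\<^sub>R u - z)) has_real_derivative
      (LINT z|lborel. h z *\<^sub>R gauss_grad a (x - z)) \<bullet> u) (at 0)" (is ?A)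
    and "((\<lambda>s. (LINT z|lborel. h z *\<^sub>R gauss_grad a (x + s *\<^sub>R u - z)) \<bullet> w) has_real_derivative
      (LINT z|lborel. h z * gauss_hess a (x - z) u w)) (at 0)" (is ?B)
proof -
  from gauss_envelope[OF a] obtain A where A: "0 \<le> A"
    and A0: "\<And>x::real^'n. gauss a x \<le> A * gauss (a/4) x"
    and A1: "\<And>x u::real^'n. norm u \<le> 1 \<Longrightarrow> norm (gauss_grad a (x + u)) \<le> A * gauss (a/4) x"
    and A2: "\<And>x u v w::real^'n. norm u \<le> 1 \<Longrightarrow> \<bar>gauss_hess a (x + u) v w\<bar> \<le> A * gauss (a/4) x * (norm v * norm w)"
    by metis
  have A1w: "\<bar>gauss_grad a (x + v) \<bullet> w\<bar> \<le> (A * norm w) * gauss (a/4) x" if "norm v \<le> 1" for x v w :: "real^'n"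
    using order_trans[OF Cauchy_Schwarz_ineq2[of "gauss_grad a (x + v)" w] mult_right_mono[OF A1[OF that, of x] norm_ge_zero[of w]]]
    by (simp add: mult_ac)
  have inner: "(LINT z|lborel. h z *\<^sub>R gauss_grad a (x - z)) \<bullet> w = (LINT z|lborel. h z * (gauss_grad a (x - z) \<bullet> w))" for x w
    by (subst integral_inner_left[symmetric]) (use A1[of 0] in \<open>auto intro!: integrable_convolution[of _ A]\<close>)
  have "((\<lambda>s. LINT z|lborel. h z * gauss a (x + s *\<^sub>R u - z)) has_real_derivative
      (LINT z|lborel. h z * (gauss_grad a (x - z) \<bullet> u))) (at 0)"
    by (rule convolution_deriv[OF _ _ gauss_deriv A1w u, where A = A]) (use A0 in auto)
  then show ?A unfolding inner .
  have "((\<lambda>s. LINT z|lborel. h z * (gauss_grad a (x + s *\<^sub>R u - z) \<bullet> w)) has_real_derivative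
      (LINT z|lborel. h z * gauss_hess a (x - z) u w)) (at 0)"
    by (rule convolution_deriv[OF _ _ gauss_grad_deriv _ u, where A = "A * norm w" and A' = "A * (norm u * norm w)"])
      (use A1w[of 0 _ w] A2[of _ _ u w] in \<open>auto simp: mult_ac\<close>)
  then show ?B unfolding inner .
qed

end

text \<open>A convolution is a mixture over \<open>z\<close> of scaled translates of one Gaussian,
  each of which satisfies the formula.\<close>

lemma (in dynkin_measures) dynkin_gauss_convolution:
  fixes h :: "real ^ 'n \<Rightarrow> real"
  assumes h [measurable]: "h \<in> borel_measurable borel" and H: "\<And>z. \<bar>h z\<bar> \<le> H" and a: "0 < a"
  shows "dynkin (\<lambda>x. LINT z|lborel. h z * gauss a (x - z))
    (levy_op b \<nu> (\<lambda>x. LINT z|lborel. h z * gauss a (x - z)) (\<lambda>x. LINT z|lborel. h z *\<^sub>R gauss_grad a (x - z))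
      (\<lambda>x. second_order Q (\<lambda>u w. LINT z|lborel. h z * gauss_hess a (x - z) u w)))"
proof -
  have H0: "0 \<le> H" using H[of 0] by linarith
  from gauss_envelope[OF a] obtain A where A: "0 \<le> A"
    and A0: "\<And>x::real^'n. gauss a x \<le> A * gauss (a/4) x"
    and A1: "\<And>x u::real^'n. norm u \<le> 1 \<Longrightarrow> norm (gauss_grad a (x + u)) \<le> A * gauss (a/4) x"
    and A2: "\<And>x u v w::real^'n. norm u \<le> 1 \<Longrightarrow> \<bar>gauss_hess a (x + u) v w\<bar> \<le> A * gauss (a/4) x * (norm v * norm w)"
    by metis
  define K where "K = 1/2 * (\<Sum>i\<in>UNIV. \<Sum>j\<in>UNIV. \<bar>Q $ i $ j\<bar>)"
  have K: "0 \<le> K" unfolding K_def by (intro mult_nonneg_nonneg sum_nonneg) auto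
  define q where "q x = second_order Q (gauss_hess a x)" for x
  have qb: "\<bar>q x\<bar> \<le> K * (A * gauss (a/4) x)" for x
    unfolding q_def K_def using A2[of 0 x] by (intro second_order_bound) simp
  have [measurable]: "q \<in> borel_measurable borel" unfolding q_def[abs_def] second_order_def by measurable
  define G where "G = (LINT z|lborel. gauss (a/4) (z::real^'n))"
  have G: "0 \<le> G" unfolding G_def by (intro Bochner_Integration.integral_nonneg) simp
  \<comment> \<open>The factor 2 pays for the two values in an increment with |y| \<ge> 1;
    \<open>K * A\<close> pays for the second-order term.\<close>
  define C where "C = H * ((2 * A) * G) + H * (K * A * G)"
  have C: "0 \<le> C" "H * (A * G) \<le> C" "H * (2 * A * G) \<le> C" "H * (K * A * G) \<le> C"
    unfolding C_def using H0 A G K by (auto intro!: add_nonneg_nonneg mult_nonneg_nonneg simp: algebra_simps)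
  have est: "(\<integral>\<^sup>+z. ennreal (p z) \<partial>lborel) \<le> ennreal (H * (B * G))"
    if p: "\<And>z. p z \<le> H * (B * gauss (a/4) (x - z))" and B: "0 \<le> B" for p :: "real^'n \<Rightarrow> real" and B x
  proof -
    have "(\<integral>\<^sup>+z. ennreal (p z) \<partial>lborel) \<le> (\<integral>\<^sup>+z. ennreal ((H * B) * gauss (a/4) (x - z)) \<partial>lborel)"
      using p by (intro nn_integral_mono ennreal_leI) (simp add: mult.assoc)
    also have "\<dots> = ennreal ((H * B) * G)"
      unfolding G_def using a B H0 by (intro nn_integral_gauss_translate) auto
    finally show ?thesis by (simp add: mult.assoc)
  qed
  have hb: "norm (h z *\<^sub>R (g::'b::real_normed_vector)) \<le> H * r" if "norm g \<le> r" for z g r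
    unfolding norm_scaleR using H0 that by (intro mult_mono H) auto
  have D: "dynkin (\<lambda>x. LINT z|lborel. h z * gauss a (x - z))
    (levy_op b \<nu> (\<lambda>x. LINT z|lborel. h z * gauss a (x - z)) (\<lambda>x. LINT z|lborel. h z *\<^sub>R gauss_grad a (x - z))
      (\<lambda>x. LINT z|lborel. h z * q (x - z)))"
  proof (rule dynkin_mixture[OF lborel.sigma_finite_measure_axioms, where C = C])
    show "(\<lambda>(z, x). h z * gauss a (x - z)) \<in> borel_measurable (lborel \<Otimes>\<^sub>M borel)"
      "(\<lambda>(z, x). h z *\<^sub>R gauss_grad a (x - z)) \<in> borel_measurable (lborel \<Otimes>\<^sub>M borel)"
      "(\<lambda>(z, x). h z * q (x - z)) \<in> borel_measurable (lborel \<Otimes>\<^sub>M borel)"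
      by measurable
    show "0 \<le> C" by (rule C)
    show "(\<integral>\<^sup>+z. ennreal \<bar>h z * gauss a (x - z)\<bar> \<partial>lborel) \<le> ennreal C" for x
      by (rule order_trans[OF est[where B = A and x = x] ennreal_leI[OF C(2)]])
        (use A0 A hb[of "gauss a _" "A * gauss (a/4) _"] in auto)
    show "(\<integral>\<^sup>+z. ennreal (norm (h z *\<^sub>R gauss_grad a (x - z))) \<partial>lborel) \<le> ennreal C" for x
      by (rule order_trans[OF est[where B = A and x = x] ennreal_leI[OF C(2)]])
        (use A1[of 0] A in \<open>auto intro!: hb simp del: norm_scaleR\<close>)
    show "(\<integral>\<^sup>+z. ennreal \<bar>h z * q (x - z)\<bar> \<partial>lborel) \<le> ennreal C" for x
      by (rule order_trans[OF est[where B = "K * A" and x = x] ennreal_leI[OF C(4)]])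
        (use K A qb hb[of "q _" "K * (A * gauss (a/4) _)"] in \<open>auto simp: mult.assoc\<close>)
    show "(\<integral>\<^sup>+z. ennreal \<bar>jump (\<lambda>x. h z * gauss a (x - z)) (\<lambda>x. h z *\<^sub>R gauss_grad a (x - z)) x y\<bar> \<partial>lborel)
        \<le> ennreal (C * min ((norm y)\<^sup>2) 1)" for x y
    proof -
      have j: "\<bar>jump (\<lambda>x. h z * gauss a (x - z)) (\<lambda>x. h z *\<^sub>R gauss_grad a (x - z)) x y\<bar>
          = norm (h z *\<^sub>R (gauss a (x - z + y) - gauss a (x - z) - gauss_grad a (x - z) \<bullet> y * indicator {0<..<1} (norm y)))" for z
        by (simp add: jump_def algebra_simps abs_mult[symmetric])
      show ?thesis
      \<comment> \<open>The split follows the cutoff: small jumps have the quadratic remainder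
        bound, large jumps carry no compensator and are bounded by two values of the convolved
        Gaussian.\<close>
      proof (cases "norm y < 1")
        case True
        have *: "norm (gauss a (w + y) - gauss a w - gauss_grad a w \<bullet> y * indicator {0<..<1} (norm y)) \<le> (A * (norm y)\<^sup>2) * gauss (a/4) w" for w
          using gauss_jump_bound[OF A2, of y w] True by (cases "y = 0") (auto simp: mult_ac)
        have "(\<integral>\<^sup>+z. ennreal \<bar>jump (\<lambda>x. h z * gauss a (x - z)) (\<lambda>x. h z *\<^sub>R gauss_grad a (x - z)) x y\<bar> \<partial>lborel)
            \<le> ennreal (H * ((A * (norm y)\<^sup>2) * G))"
          unfolding j by (intro est[where x = x] hb *) (use A in simp)
        also have "\<dots> = ennreal (H * (A * G) * (norm y)\<^sup>2)" by (simp add: mult_ac)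
        also have "\<dots> \<le> ennreal (C * (norm y)\<^sup>2)"
          by (intro ennreal_leI mult_right_mono C) simp
        also have "(norm y)\<^sup>2 = min ((norm y)\<^sup>2) 1" using True by (simp add: power_le_one)
        finally show ?thesis by simp
      next
        case False
        have *: "(\<integral>\<^sup>+z. ennreal \<bar>h z * gauss a (x' - z)\<bar> \<partial>lborel) \<le> ennreal (H * (A * G))" for x'
          by (rule est[where x = x']) (use A0 A hb[of "gauss a _" "A * gauss (a/4) _"] in auto)
        have "(\<integral>\<^sup>+z. ennreal \<bar>jump (\<lambda>x. h z * gauss a (x - z)) (\<lambda>x. h z *\<^sub>R gauss_grad a (x - z)) x y\<bar> \<partial>lborel)
            \<le> (\<integral>\<^sup>+z. ennreal \<bar>h z * gauss a ((x + y) - z)\<bar> + ennreal \<bar>h z * gauss a (x - z)\<bar> \<partial>lborel)"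
          using False by (intro nn_integral_mono) (simp add: jump_def ennreal_plus[symmetric] abs_triangle_ineq4 ennreal_leI del: ennreal_plus)
        also have "\<dots> \<le> ennreal (H * (A * G)) + ennreal (H * (A * G))"
          by (subst nn_integral_add) (auto intro!: add_mono *)
        also have "\<dots> \<le> ennreal C"
          using H0 A G C(3) by (subst ennreal_plus[symmetric]) (auto intro!: ennreal_leI simp: mult_ac)
        also have "C = C * min ((norm y)\<^sup>2) 1" using False by (simp add: one_le_power)
        finally show ?thesis .
      qed
    qed
    show "dynkin (\<lambda>x. h z * gauss a (x - z))
        (levy_op b \<nu> (\<lambda>x. h z * gauss a (x - z)) (\<lambda>x. h z *\<^sub>R gauss_grad a (x - z)) (\<lambda>x. h z * q (x - z)))" for z
      unfolding q_def by (rule dynkin_scaled_translate[OF dynkin_gauss[OF a]])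
  qed
  have "(LINT z|lborel. h z * q (x - z)) = second_order Q (\<lambda>u w. LINT z|lborel. h z * gauss_hess a (x - z) u w)" for x
    unfolding q_def second_order_scale[symmetric]
  proof (rule second_order_integral(1))
    fix u w
    show "integrable lborel (\<lambda>z. h z * gauss_hess a (x - z) u w)"
      using integrable_convolution[OF h H a, of "\<lambda>z. gauss_hess a z u w" "A * (norm u * norm w)" x] A2[of 0 _ u w]
      by (simp add: mult_ac)
  qed
  with D show ?thesis by simp
qed

section \<open>Gaussian averages\<close>

lemma gauss_avg_const: "gauss_avg c (\<lambda>_. K) (x::'a::euclidean_space) = K"
  using integral_gauss_pos[where 'a='a] by (simp add: gauss_avg_def)

lemma integrable_gauss_avg:
  fixes h :: "'a::euclidean_space \<Rightarrow> real"
  assumes [measurable]: "h \<in> borel_measurable borel" and H: "\<And>z. \<bar>h z\<bar> \<le> H"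
  shows "integrable lborel (\<lambda>u. gauss (1/2) u * h (x - u /\<^sub>R c))"
proof (rule Bochner_Integration.integrable_bound[OF integrable_mult_left[OF integrable_gauss[of "1/2"], of H]])
  have "\<bar>h z\<bar> \<le> \<bar>H\<bar>" for z using H[of z] by linarith
  then show "AE u in lborel. norm (gauss (1/2) u * h (x - u /\<^sub>R c)) \<le> norm (gauss (1/2) u * H)"
    by (auto simp: abs_mult mult_left_mono)
qed simp_all

lemma gauss_avg_mono:
  fixes h k :: "'a::euclidean_space \<Rightarrow> real"
  assumes "h \<in> borel_measurable borel" "\<And>z. \<bar>h z\<bar> \<le> H" "k \<in> borel_measurable borel" "\<And>z. \<bar>k z\<bar> \<le> K"
    and "\<And>z. h z \<le> k z"
  shows "gauss_avg c h x \<le> gauss_avg c k x"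
  unfolding gauss_avg_def using integral_gauss_pos[where 'a='a] assms
  by (intro divide_right_mono integral_mono integrable_gauss_avg mult_left_mono) auto

lemma gauss_avg_bound:
  fixes h :: "'a::euclidean_space \<Rightarrow> real"
  assumes h: "h \<in> borel_measurable borel" "\<And>z. \<bar>h z\<bar> \<le> H"
  shows "\<bar>gauss_avg c h x\<bar> \<le> H"
proof -
  have "h z \<le> H" "- H \<le> h z" for z using h(2)[of z] by auto
  then show ?thesis
    using gauss_avg_mono[OF h, of "\<lambda>_. H" "\<bar>H\<bar>" c x] gauss_avg_mono[of "\<lambda>_. - H" "\<bar>H\<bar>", OF _ _ h, of c x]
    by (simp add: gauss_avg_const abs_le_iff)
qed

text \<open>Averaging commutes with translations, so the increment of the average is the average of
  the increment. Hoelder bounds therefore pass to the averages with the same constant, whatever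
  \<open>c\<close> is.\<close>

lemma gauss_avg_increment:
  fixes h :: "'a::euclidean_space \<Rightarrow> real"
  assumes [measurable]: "h \<in> borel_measurable borel" and H: "\<And>z. \<bar>h z\<bar> \<le> H" and K: "\<And>z. \<bar>h (z + y) - h z\<bar> \<le> K"
  shows "\<bar>gauss_avg c h (x + y) - gauss_avg c h x\<bar> \<le> K"
proof -
  have eq: "x + y - u /\<^sub>R c = (x - u /\<^sub>R c) + y" for u by simp
  have "integrable lborel (\<lambda>u. gauss (1/2) u * h (x - u /\<^sub>R c + y))"
    using integrable_gauss_avg[OF assms(1) H, of "x + y" c] unfolding eq .
  then have "gauss_avg c h (x + y) - gauss_avg c h x = gauss_avg c (\<lambda>z. h (z + y) - h z) x"
    unfolding gauss_avg_def right_diff_distrib eq using integrable_gauss_avg[OF assms(1) H]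
    by (simp add: diff_divide_distrib)
  then show ?thesis
    using gauss_avg_bound[of "\<lambda>z. h (z + y) - h z" K c x] K by simp
qed

lemma borel_measurable_gauss_avg [measurable]:
  assumes [measurable]: "h \<in> borel_measurable borel"
  shows "gauss_avg c h \<in> borel_measurable borel"
  unfolding gauss_avg_def[abs_def] by measurable

text \<open>The shift u/(n+1) tends to 0 for each \<open>u\<close>, and the bounded \<open>h\<close>
  is dominated under the fixed Gaussian weight.\<close>

lemma gauss_avg_tendsto:
  fixes h :: "'a::euclidean_space \<Rightarrow> real"
  assumes cont: "continuous_on UNIV h" and H: "\<And>z. \<bar>h z\<bar> \<le> H"
  shows "(\<lambda>n. gauss_avg (real (Suc n)) h x) \<longlonglongrightarrow> h x"
proof -
  have [measurable]: "h \<in> borel_measurable borel" by (rule borel_measurable_continuous_onI[OF cont])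
  have "\<bar>h z\<bar> \<le> \<bar>H\<bar>" for z using H[of z] by linarith
  moreover have "(\<lambda>n. gauss (1/2) u * h (x - u /\<^sub>R real (Suc n))) \<longlonglongrightarrow> gauss (1/2) u * h x" for u :: 'a
  proof -
    have "(\<lambda>n. x - u /\<^sub>R real (Suc n)) \<longlonglongrightarrow> x - 0 *\<^sub>R u"
      by (intro tendsto_intros LIMSEQ_inverse_real_of_nat)
    then have "(\<lambda>n. x - u /\<^sub>R real (Suc n)) \<longlonglongrightarrow> x" by simp
    moreover have "isCont h x" using cont by (simp add: continuous_on_eq_continuous_at)
    ultimately have "(\<lambda>n. h (x - u /\<^sub>R real (Suc n))) \<longlonglongrightarrow> h x" by (rule isCont_tendsto_compose[rotated])
    then show ?thesis by (rule tendsto_mult[OF tendsto_const])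
  qed
  ultimately have "(\<lambda>n. LINT u|lborel. gauss (1/2) u * h (x - u /\<^sub>R real (Suc n))) \<longlonglongrightarrow> (LINT u|lborel. gauss (1/2) (u::'a) * h x)"
    by (intro integral_dominated_convergence[where w = "\<lambda>u. gauss (1/2) u * \<bar>H\<bar>"] integrable_mult_left integrable_gauss AE_I2)
      (simp_all add: abs_mult mult_left_mono del: of_nat_Suc)
  from tendsto_divide[OF this tendsto_const, of "gauss_mass TYPE('a)"] show ?thesis
    using integral_gauss_pos[where 'a='a] unfolding gauss_avg_def by simp
qed

text \<open>Here the derivative falls on \<open>h\<close>, in contrast to
  \<open>convolution_deriv\<close>; a bounded measurable derivative in the one direction
  \<open>u\<close> is enough.\<close>

lemma gauss_avg_deriv:
  fixes h h' :: "'a::euclidean_space \<Rightarrow> real"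
  assumes h: "h \<in> borel_measurable borel" and H: "\<And>z. \<bar>h z\<bar> \<le> H"
    and h': "h' \<in> borel_measurable borel" and H': "\<And>z. \<bar>h' z\<bar> \<le> H'"
    and der: "\<And>x. ((\<lambda>s. h (x + s *\<^sub>R u)) has_real_derivative h' x) (at 0)"
  shows "((\<lambda>s. gauss_avg c h (x + s *\<^sub>R u)) has_real_derivative gauss_avg c h' x) (at 0)"
proof -
  have eq: "x + s *\<^sub>R u - w /\<^sub>R c = (x - w /\<^sub>R c) + s *\<^sub>R u" for s w by simp
  have "((\<lambda>s. LINT w|lborel. gauss (1/2) w * h (x + s *\<^sub>R u - w /\<^sub>R c)) has_real_derivative
      (LINT w|lborel. gauss (1/2) w * h' (x + 0 *\<^sub>R u - w /\<^sub>R c))) (at 0)"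
  proof (rule has_real_derivative_integral[where B = "\<lambda>w. gauss (1/2) w * H'"])
    show "((\<lambda>s. gauss (1/2) w * h (x + s *\<^sub>R u - w /\<^sub>R c)) has_real_derivative gauss (1/2) w * h' (x + s *\<^sub>R u - w /\<^sub>R c)) (at s)" for s w
      unfolding eq by (rule DERIV_cmult[OF has_real_derivative_line[OF der]])
    show "\<bar>gauss (1/2) w * h' (x + s *\<^sub>R u - w /\<^sub>R c)\<bar> \<le> gauss (1/2) w * H'" for s w
      using H' by (simp add: abs_mult mult_left_mono)
    show "integrable lborel (\<lambda>w. gauss (1/2) w * h (x + s *\<^sub>R u - w /\<^sub>R c))" for s
      by (rule integrable_gauss_avg[OF h H])
    show "integrable lborel (\<lambda>w::'a. gauss (1/2) w * H')"
      by (intro integrable_mult_left integrable_gauss) simp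
  qed
  then show ?thesis
    unfolding gauss_avg_def by (simp add: DERIV_cdivide)
qed

text \<open>\<open>V\<close> and \<open>W\<close> are the convolutions of a multiple of
  \<open>h\<close> with the derivatives of the kernel. Where \<open>h\<close> itself has partial
  derivatives, uniqueness of the derivative later identifies them with averages of those. The
  measures are quantified inside the conclusion so that one choice of \<open>V\<close> and
  \<open>W\<close> serves all of them.\<close>

lemma gauss_avg_smooth:
  fixes h :: "real ^ 'n \<Rightarrow> real"
  assumes h [measurable]: "h \<in> borel_measurable borel" and H: "\<And>z. \<bar>h z\<bar> \<le> H" and c: "0 < c"
  obtains V W where
    "\<And>x u. norm u \<le> 1 \<Longrightarrow> ((\<lambda>s. gauss_avg c h (x + s *\<^sub>R u)) has_real_derivative V x \<bullet> u) (at 0)"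
    and "\<And>x u w. norm u \<le> 1 \<Longrightarrow> ((\<lambda>s. V (x + s *\<^sub>R u) \<bullet> w) has_real_derivative W x u w) (at 0)"
    and "\<And>b Q \<nu> \<mu> \<eta>. dynkin_measures b Q \<nu> \<mu> \<eta> \<Longrightarrow>
      dynkin_measures.dynkin \<mu> \<eta> (gauss_avg c h) (levy_op b \<nu> (gauss_avg c h) V (\<lambda>x. second_order Q (W x)))"
proof -
  define k where "k z = (c ^ DIM(real^'n) / gauss_mass TYPE(real^'n)) * h z" for z
  have k: "k \<in> borel_measurable borel" unfolding k_def[abs_def] by measurable
  define K where "K = \<bar>c ^ DIM(real^'n) / gauss_mass TYPE(real^'n)\<bar> * H"
  have K: "\<bar>k z\<bar> \<le> K" for z unfolding k_def K_def abs_mult by (intro mult_left_mono H) simp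
  have a: "0 < c\<^sup>2/2" using c by simp
  have eq: "gauss_avg c h = (\<lambda>x. LINT z|lborel. k z * gauss (c\<^sup>2/2) (x - z))"
    unfolding k_def by (rule ext) (rule gauss_avg_eq_convolution[OF h c])
  show ?thesis
    using gauss_convolution_deriv[OF k K a] dynkin_measures.dynkin_gauss_convolution[OF _ k K a]
    by (intro that[of "\<lambda>x. LINT z|lborel. k z *\<^sub>R gauss_grad (c\<^sup>2/2) (x - z)"
          "\<lambda>x u w. LINT z|lborel. k z * gauss_hess (c\<^sup>2/2) (x - z) u w"]) (simp_all only: eq)
qed

text \<open>Existence of partial derivatives does not by itself give a linearization; it is obtained here
  by passing to the limit in the smooth Gaussian averages.\<close>

lemma lipschitz_of_partials:
  fixes f :: "real ^ 'n \<Rightarrow> real" and g :: "real ^ 'n \<Rightarrow> real ^ 'n"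
  assumes f: "continuous_on UNIV f" "\<And>x. \<bar>f x\<bar> \<le> C"
    and g: "\<And>j. (\<lambda>x. g x $ j) \<in> borel_measurable borel" "\<And>x j. \<bar>g x $ j\<bar> \<le> D"
    and der: "\<And>x j. ((\<lambda>s. f (x + s *\<^sub>R axis j 1)) has_real_derivative g x $ j) (at 0)"
    and y: "norm y \<le> 1"
  shows "\<bar>f (x + y) - f x\<bar> \<le> real CARD('n) * D * norm y"
proof -
  have [measurable]: "f \<in> borel_measurable borel" by (rule borel_measurable_continuous_onI[OF f(1)])
  have "\<bar>gauss_avg (real (Suc n)) f (x + y) - gauss_avg (real (Suc n)) f x\<bar> \<le> real CARD('n) * D * norm y" for n
  proof -
    let ?F = "gauss_avg (real (Suc n)) f"
    obtain V where V: "\<And>x u. norm u \<le> 1 \<Longrightarrow> ((\<lambda>s. ?F (x + s *\<^sub>R u)) has_real_derivative V x \<bullet> u) (at 0)"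
      by (rule gauss_avg_smooth[of f C "real (Suc n)"]) (use f(2) in auto)
    have Vj: "V x $ j = gauss_avg (real (Suc n)) (\<lambda>x. g x $ j) x" for x j
      using DERIV_unique[OF V[of "axis j 1" x] gauss_avg_deriv[OF _ f(2) g(1) g(2) der]] by (simp add: inner_axis)
    obtain s where s: "?F (x + 1 *\<^sub>R y) - ?F (x + 0 *\<^sub>R y) = (1 - 0) * (V (x + s *\<^sub>R y) \<bullet> y)"
      using MVT2[of 0 1 "\<lambda>s. ?F (x + s *\<^sub>R y)" "\<lambda>s. V (x + s *\<^sub>R y) \<bullet> y"] has_real_derivative_line[OF V[OF y]] by auto
    have "\<bar>V z \<bullet> y\<bar> \<le> (\<Sum>j\<in>(UNIV::'n set). D * norm y)" for z
      unfolding inner_vec_def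
    proof (rule order_trans[OF sum_abs sum_mono])
      fix j
      have "\<bar>V z $ j\<bar> \<le> D" unfolding Vj by (rule gauss_avg_bound[OF g])
      then have "\<bar>V z $ j\<bar> * \<bar>y $ j\<bar> \<le> D * norm y" by (intro mult_mono component_le_norm_cart) auto
      then show "\<bar>V z $ j \<bullet> y $ j\<bar> \<le> D * norm y" by (simp add: abs_mult)
    qed
    with s show ?thesis by (simp add: mult.assoc)
  qed
  moreover have "(\<lambda>n. \<bar>gauss_avg (real (Suc n)) f (x + y) - gauss_avg (real (Suc n)) f x\<bar>) \<longlonglongrightarrow> \<bar>f (x + y) - f x\<bar>"
    by (intro tendsto_intros gauss_avg_tendsto[OF f])
  ultimately show ?thesis
    by (intro LIMSEQ_le_const2) auto
qed

section \<open>Domination of the jump integrand and passage to the limit\<close>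

text \<open>The majorant matched to regularity \<alpha>: the moment hypothesis makes it integrable
  near the origin. For \<alpha> = 2 it coincides with min(|y|^2, 1).\<close>

definition levy_weight :: "real \<Rightarrow> real ^ 'n \<Rightarrow> real" where
  "levy_weight \<alpha> y = norm y powr \<alpha> * indicator {0<..<1} (norm y) + indicator {1..} (norm y)"

lemma levy_weight_nonneg [simp]: "0 \<le> levy_weight \<alpha> y"
  by (simp add: levy_weight_def)

text \<open>For |y| \<ge> 1 the compensator is cut off and the increment is at most 2C; for smaller
  \<open>y\<close> the assumption \<open>small\<close> applies, and \<open>2 * C + D\<close> covers
  both. With \<open>v = 0\<close> this also bounds uncompensated increments.\<close>

lemma jump_weight_bound:
  assumes "\<And>x. \<bar>f x\<bar> \<le> C" "0 \<le> D" and small: "0 < norm y \<Longrightarrow> norm y < 1 \<Longrightarrow> \<bar>f (x + y) - f x - v x \<bullet> y\<bar> \<le> D * norm y powr \<alpha>"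
  shows "\<bar>jump f v x y\<bar> \<le> (2 * C + D) * levy_weight \<alpha> y"
proof -
  have C: "0 \<le> C" using assms(1)[of 0] by linarith
  consider "y = 0" | "0 < norm y" "norm y < 1" | "1 \<le> norm y" by force
  then show ?thesis
  proof cases
    case 2
    then have "D * norm y powr \<alpha> \<le> (2 * C + D) * norm y powr \<alpha>" using C by (intro mult_right_mono) auto
    from order_trans[OF small[OF 2] this] show ?thesis using 2 by (simp add: jump_def levy_weight_def)
  next
    case 3
    have "\<bar>f (x + y) - f x\<bar> \<le> 2 * C" using assms(1)[of "x + y"] assms(1)[of x] by linarith
    then show ?thesis using 3 assms(2) by (simp add: jump_def levy_weight_def)
  qed (simp add: jump_def levy_weight_def)
qed

context dynkin_measures
begin

text \<open>Covers functions with two continuous derivatives (\<alpha> = 2) and functions with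
  Hoelder gradient (Q = 0) at once; the alternative in \<open>q\<close> records which.
  \<open>F\<close> and \<open>G\<close> average \<open>f\<close> and the components of
  \<open>g\<close>. The bound on the jump integrand is also exported, since it later yields
  integrability and the membership of the operator value in \<open>C0\<close>.\<close>

lemma dynkin_of_partials:
  fixes f :: "real ^ 'n \<Rightarrow> real" and g :: "real ^ 'n \<Rightarrow> real ^ 'n"
  assumes f: "continuous_on UNIV f" "\<And>x. \<bar>f x\<bar> \<le> C"
    and g: "\<And>j. continuous_on UNIV (\<lambda>x. g x $ j)" "\<And>x j. \<bar>g x $ j\<bar> \<le> C"
    and der: "\<And>x j. ((\<lambda>s. f (x + s *\<^sub>R axis j 1)) has_real_derivative g x $ j) (at 0)"
    and \<alpha>: "1 \<le> \<alpha>" and w: "integrable \<nu> (levy_weight \<alpha>)"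
    and holder: "\<And>x y j. 0 < norm y \<Longrightarrow> norm y < 1 \<Longrightarrow> \<bar>g (x + y) $ j - g x $ j\<bar> \<le> D * norm y powr (\<alpha> - 1)"
    and q: "Q = 0 \<and> q = (\<lambda>x. 0) \<or>
      (\<exists>h. (\<forall>i j. continuous_on UNIV (h i j)) \<and> (\<forall>i j x. \<bar>h i j x\<bar> \<le> C) \<and>
        (\<forall>i j x. ((\<lambda>s. g (x + s *\<^sub>R axis i 1) $ j) has_real_derivative h i j x) (at 0)) \<and>
        (\<forall>x. q x = 1/2 * (\<Sum>i\<in>UNIV. \<Sum>j\<in>UNIV. Q $ i $ j * h j i x)))"
  shows "\<bar>jump f g x y\<bar> \<le> (2 * C + real CARD('n) * \<bar>D\<bar>) * levy_weight \<alpha> y"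
    and "dynkin f (levy_op b \<nu> f g q)"
proof -
  have [measurable]: "f \<in> borel_measurable borel" by (rule borel_measurable_continuous_onI[OF f(1)])
  have gm [measurable]: "(\<lambda>x. g x $ j) \<in> borel_measurable borel" for j by (rule borel_measurable_continuous_onI[OF g(1)])
  define K where "K = 2 * C + real CARD('n) * \<bar>D\<bar>"
  define F where "F n = gauss_avg (real (Suc n)) f" for n
  define G where "G n x = (\<chi> j. gauss_avg (real (Suc n)) (\<lambda>x. g x $ j) x)" for n x
  have [measurable]: "F n \<in> borel_measurable borel" for n unfolding F_def by measurable
  have [measurable]: "G n \<in> borel_measurable borel" for n
    by (subst borel_measurable_euclidean_space) (auto simp: G_def[abs_def] Basis_vec_def inner_axis)
  have F: "(\<lambda>n. F n x) \<longlonglongrightarrow> f x" "\<bar>F n x\<bar> \<le> C" for n x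
    unfolding F_def by (rule gauss_avg_tendsto[OF f], rule gauss_avg_bound[OF _ f(2)]) simp
  have G1: "(\<lambda>n. G n x) \<longlonglongrightarrow> g x" for x
    unfolding G_def by (rule vec_tendstoI) (use gauss_avg_tendsto[OF g] in \<open>simp del: of_nat_Suc\<close>)
  have G2: "\<bar>G n x $ j\<bar> \<le> C" for n x j
    unfolding G_def by (simp add: gauss_avg_bound[OF _ g(2)])
  have "\<exists>W. (\<forall>x u. norm u \<le> 1 \<longrightarrow> ((\<lambda>s. F n (x + s *\<^sub>R u)) has_real_derivative G n x \<bullet> u) (at 0))
      \<and> (\<forall>x u w. norm u \<le> 1 \<longrightarrow> ((\<lambda>s. G n (x + s *\<^sub>R u) \<bullet> w) has_real_derivative W x u w) (at 0))
      \<and> dynkin (F n) (levy_op b \<nu> (F n) (G n) (\<lambda>x. second_order Q (W x)))" for n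
  proof -
    obtain V W where V: "\<And>x u. norm u \<le> 1 \<Longrightarrow> ((\<lambda>s. F n (x + s *\<^sub>R u)) has_real_derivative V x \<bullet> u) (at 0)"
      and W: "\<And>x u w. norm u \<le> 1 \<Longrightarrow> ((\<lambda>s. V (x + s *\<^sub>R u) \<bullet> w) has_real_derivative W x u w) (at 0)"
      and D: "\<And>b Q \<nu> \<mu> \<eta>. dynkin_measures b Q \<nu> \<mu> \<eta> \<Longrightarrow>
        dynkin_measures.dynkin \<mu> \<eta> (F n) (levy_op b \<nu> (F n) V (\<lambda>x. second_order Q (W x)))"
      unfolding F_def by (rule gauss_avg_smooth[of f C "real (Suc n)"]) (use f(2) in auto)
    \<comment> \<open>Both sides are partial derivatives of \<open>F n\<close>, computed once with
      the derivative on the kernel and once on \<open>f\<close>. Hence \<open>V\<close> inherits the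
      Hoelder bounds of \<open>g\<close>.\<close>
    have "V x $ j = G n x $ j" for x j
      using DERIV_unique[OF V[of "axis j 1" x, unfolded F_def] gauss_avg_deriv[OF _ f(2) gm g(2) der]]
      by (simp add: inner_axis G_def)
    then have "V = G n" by (simp add: fun_eq_iff vec_eq_iff)
    then show ?thesis using V W D[OF dynkin_measures_axioms] by blast
  qed
  then obtain W where FG: "\<And>n x u. norm u \<le> 1 \<Longrightarrow> ((\<lambda>s. F n (x + s *\<^sub>R u)) has_real_derivative G n x \<bullet> u) (at 0)"
    and W: "\<And>n x u w. norm u \<le> 1 \<Longrightarrow> ((\<lambda>s. G n (x + s *\<^sub>R u) \<bullet> w) has_real_derivative W n x u w) (at 0)"
    and D: "\<And>n. dynkin (F n) (levy_op b \<nu> (F n) (G n) (\<lambda>x. second_order Q (W n x)))"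
    by metis
  have jumpF: "\<bar>jump (F n) (G n) x y\<bar> \<le> K * levy_weight \<alpha> y" for n x y
    unfolding K_def
  proof (rule jump_weight_bound)
    assume y: "0 < norm y" "norm y < 1"
    have "\<bar>F n (x + 1 *\<^sub>R y) - F n (x + 0 *\<^sub>R y) - G n (x + 0 *\<^sub>R y) \<bullet> y\<bar> \<le> real CARD('n) * \<bar>D\<bar> * norm y powr \<alpha>"
    proof (rule mean_value_linearization[of "\<lambda>s. F n (x + s *\<^sub>R y)" "\<lambda>s. G n (x + s *\<^sub>R y) \<bullet> y"])
      show "((\<lambda>s. F n (x + s *\<^sub>R y)) has_real_derivative G n (x + s *\<^sub>R y) \<bullet> y) (at s)" for s
        by (rule has_real_derivative_line[OF FG]) (use y in simp)
      fix s :: real assume s: "0 < s" "s < 1"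
      have sy: "0 < norm (s *\<^sub>R y)" "norm (s *\<^sub>R y) < 1" "norm (s *\<^sub>R y) \<le> norm y"
        using s y mult_strict_mono[of s 1 "norm y" 1] by (auto simp: mult_left_le_one_le)
      have "\<bar>(G n (x + s *\<^sub>R y) - G n x) \<bullet> y\<bar> \<le> (\<Sum>j\<in>(UNIV::'n set). \<bar>D\<bar> * norm y powr \<alpha>)"
        unfolding inner_vec_def
      proof (rule order_trans[OF sum_abs sum_mono])
        fix j
        have "\<bar>G n (x + s *\<^sub>R y) $ j - G n x $ j\<bar> \<le> D * norm (s *\<^sub>R y) powr (\<alpha> - 1)"
          unfolding G_def by simp (rule gauss_avg_increment[OF _ g(2)], measurable, use holder[OF sy(1,2)] in simp)
        also have "\<dots> \<le> \<bar>D\<bar> * norm y powr (\<alpha> - 1)"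
          using \<alpha> sy by (intro mult_mono powr_mono2) auto
        finally have "\<bar>G n (x + s *\<^sub>R y) $ j - G n x $ j\<bar> * \<bar>y $ j\<bar> \<le> (\<bar>D\<bar> * norm y powr (\<alpha> - 1)) * norm y"
          by (intro mult_mono component_le_norm_cart) auto
        also have "\<dots> = \<bar>D\<bar> * norm y powr \<alpha>"
          using y powr_add[of "norm y" "\<alpha> - 1" 1] by simp
        finally show "\<bar>(G n (x + s *\<^sub>R y) - G n x) $ j \<bullet> y $ j\<bar> \<le> \<bar>D\<bar> * norm y powr \<alpha>" by (simp add: abs_mult)
      qed
      then show "\<bar>G n (x + s *\<^sub>R y) \<bullet> y - G n (x + 0 *\<^sub>R y) \<bullet> y\<bar> \<le> real CARD('n) * \<bar>D\<bar> * norm y powr \<alpha>"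
        by (simp add: inner_diff_left mult.assoc)
    qed
    then show "\<bar>F n (x + y) - F n x - G n x \<bullet> y\<bar> \<le> real CARD('n) * \<bar>D\<bar> * norm y powr \<alpha>" by simp
  qed (use F in auto)
  have jump_lim: "(\<lambda>n. jump (F n) (G n) x y) \<longlonglongrightarrow> jump f g x y" for x y
    unfolding jump_def by (intro tendsto_intros F G1)
  show jump_f: "\<bar>jump f g x y\<bar> \<le> (2 * C + real CARD('n) * \<bar>D\<bar>) * levy_weight \<alpha> y" for x y
    by (rule LIMSEQ_le_const2[OF tendsto_rabs[OF jump_lim]]) (use jumpF K_def in auto)
  have [measurable]: "(\<lambda>(x, y). jump (F n) (G n) x y) \<in> borel_measurable (borel \<Otimes>\<^sub>M borel)" for n
    unfolding jump_def by measurable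
  have [measurable]: "jump (F n) (G n) x \<in> borel_measurable borel" for n x
    unfolding jump_def by measurable
  have [measurable]: "levy_weight \<alpha> \<in> borel_measurable borel" for \<alpha>
    unfolding levy_weight_def[abs_def] by measurable
  have int_lim: "(\<lambda>n. LINT y|\<nu>. jump (F n) (G n) x y) \<longlonglongrightarrow> (LINT y|\<nu>. jump f g x y)" for x
  proof (rule integral_dominated_convergence[where w = "\<lambda>y. K * levy_weight \<alpha> y"])
    show "jump f g x \<in> borel_measurable \<nu>"
      by (rule borel_measurable_LIMSEQ_real[OF jump_lim]) measurable
  qed (use jumpF jump_lim w in auto)
  have int_bound: "\<bar>LINT y|\<nu>. jump (F n) (G n) x y\<bar> \<le> (LINT y|\<nu>. K * levy_weight \<alpha> y)" for n x
  proof -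
    have i: "integrable \<nu> (jump (F n) (G n) x)"
      by (rule Bochner_Integration.integrable_bound[OF integrable_mult_right[OF w, of K]])
        (use order_trans[OF jumpF abs_ge_self] in \<open>auto intro!: AE_I2\<close>)
    have "\<bar>LINT y|\<nu>. jump (F n) (G n) x y\<bar> \<le> (LINT y|\<nu>. \<bar>jump (F n) (G n) x y\<bar>)" by (rule integral_abs_bound)
    also have "\<dots> \<le> (LINT y|\<nu>. K * levy_weight \<alpha> y)"
      by (intro integral_mono integrable_abs i integrable_mult_right w jumpF)
    finally show ?thesis .
  qed
  have Wx: "W n x (axis i 1) (axis j 1) = gauss_avg (real (Suc n)) (h i j) x"
    if h: "\<forall>i j. continuous_on UNIV (h i j)" "\<forall>i j x. \<bar>h i j x\<bar> \<le> C"
      "\<forall>i j x. ((\<lambda>s. g (x + s *\<^sub>R axis i 1) $ j) has_real_derivative h i j x) (at 0)" for h n x i j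
  proof -
    have "((\<lambda>s. gauss_avg (real (Suc n)) (\<lambda>x. g x $ j) (x + s *\<^sub>R axis i 1)) has_real_derivative gauss_avg (real (Suc n)) (h i j) x) (at 0)"
      by (rule gauss_avg_deriv[OF gm g(2), where H' = C]) (use h in \<open>auto intro: borel_measurable_continuous_onI\<close>)
    moreover have "((\<lambda>s. gauss_avg (real (Suc n)) (\<lambda>x. g x $ j) (x + s *\<^sub>R axis i 1)) has_real_derivative W n x (axis i 1) (axis j 1)) (at 0)"
      using W[of "axis i 1" n x "axis j 1"] by (simp add: inner_axis G_def)
    ultimately show ?thesis by (rule DERIV_unique[rotated])
  qed
  \<comment> \<open>For Q = 0 the term vanishes whatever \<open>W\<close> is; otherwise
    \<open>Wx\<close> expresses it through averages of the second partial derivatives, which are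
    bounded and converge.\<close>
  have so: "(\<lambda>x. second_order Q (W n x)) \<in> borel_measurable borel \<and>
      \<bar>second_order Q (W n x)\<bar> \<le> (\<Sum>i\<in>UNIV. \<Sum>j\<in>UNIV. \<bar>Q $ i $ j\<bar> * C) \<and> (\<lambda>n. second_order Q (W n x)) \<longlonglongrightarrow> q x" for n x
    using q
  proof
    assume "Q = 0 \<and> q = (\<lambda>x. 0)"
    then show ?thesis by (simp add: second_order_def)
  next
    assume "\<exists>h. (\<forall>i j. continuous_on UNIV (h i j)) \<and> (\<forall>i j x. \<bar>h i j x\<bar> \<le> C) \<and>
        (\<forall>i j x. ((\<lambda>s. g (x + s *\<^sub>R axis i 1) $ j) has_real_derivative h i j x) (at 0)) \<and>
        (\<forall>x. q x = 1/2 * (\<Sum>i\<in>UNIV. \<Sum>j\<in>UNIV. Q $ i $ j * h j i x))"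
    then obtain h where h: "\<forall>i j. continuous_on UNIV (h i j)" "\<forall>i j x. \<bar>h i j x\<bar> \<le> C"
      "\<forall>i j x. ((\<lambda>s. g (x + s *\<^sub>R axis i 1) $ j) has_real_derivative h i j x) (at 0)"
      and qx: "\<And>x. q x = 1/2 * (\<Sum>i\<in>UNIV. \<Sum>j\<in>UNIV. Q $ i $ j * h j i x)" by blast
    have [measurable]: "h i j \<in> borel_measurable borel" for i j using h(1) by (auto intro: borel_measurable_continuous_onI)
    have eq: "second_order Q (W n x) = 1/2 * (\<Sum>i\<in>UNIV. \<Sum>j\<in>UNIV. Q $ i $ j * gauss_avg (real (Suc n)) (h j i) x)" for n x
      unfolding second_order_def Wx[OF h] ..
    have "\<bar>\<Sum>i\<in>UNIV. \<Sum>j\<in>UNIV. Q $ i $ j * gauss_avg (real (Suc n)) (h j i) x\<bar> \<le> (\<Sum>i\<in>UNIV. \<Sum>j\<in>UNIV. \<bar>Q $ i $ j\<bar> * C)"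
      by (intro order_trans[OF sum_abs] sum_mono) (use h(2) in \<open>auto simp: abs_mult intro!: mult_left_mono gauss_avg_bound\<close>)
    moreover have "(\<lambda>n. second_order Q (W n x)) \<longlonglongrightarrow> q x"
      unfolding eq qx using h by (intro tendsto_intros gauss_avg_tendsto[where H = C]) auto
    ultimately show ?thesis unfolding eq by auto
  qed
  have C: "0 \<le> C" using f(2)[of 0] by linarith
  have bG: "\<bar>b \<bullet> G n x\<bar> \<le> (\<Sum>j\<in>UNIV. \<bar>b $ j\<bar> * C)" for n x
    unfolding inner_vec_def
    by (rule order_trans[OF sum_abs sum_mono]) (use G2 in \<open>auto simp: abs_mult intro!: mult_left_mono\<close>)
  define B where "B = C + (\<Sum>j\<in>UNIV. \<bar>b $ j\<bar> * C) + (\<Sum>i\<in>UNIV. \<Sum>j\<in>UNIV. \<bar>Q $ i $ j\<bar> * C) + (LINT y|\<nu>. K * levy_weight \<alpha> y)"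
  have B0: "0 \<le> (\<Sum>j\<in>UNIV. \<bar>b $ j\<bar> * C)" "0 \<le> (\<Sum>i\<in>UNIV. \<Sum>j\<in>UNIV. \<bar>Q $ i $ j\<bar> * C)" "0 \<le> (LINT y|\<nu>. K * levy_weight \<alpha> y)"
    using C by (auto intro!: sum_nonneg Bochner_Integration.integral_nonneg simp: K_def)
  show "dynkin f (levy_op b \<nu> f g q)"
  proof (rule dynkin_limit[OF D, where C = B])
    show "(\<lambda>n. levy_op b \<nu> (F n) (G n) (\<lambda>x. second_order Q (W n x)) x) \<longlonglongrightarrow> levy_op b \<nu> f g q x" for x
      unfolding levy_op_def by (intro tendsto_intros G1 int_lim so[THEN conjunct2, THEN conjunct2])
    show "\<bar>levy_op b \<nu> (F n) (G n) (\<lambda>x. second_order Q (W n x)) x\<bar> \<le> B" for n x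
      unfolding levy_op_def B_def using bG[of n x] int_bound[of n x] so[of n x] C by linarith
    show "\<bar>F n x\<bar> \<le> B" for n x unfolding B_def using F(2)[of n x] B0 by linarith
    show "levy_op b \<nu> (F n) (G n) (\<lambda>x. second_order Q (W n x)) \<in> borel_measurable borel" for n
    proof -
      have [measurable]: "(\<lambda>x. second_order Q (W n x)) \<in> borel_measurable borel" using so by blast
      show ?thesis unfolding levy_op_def[abs_def] by measurable
    qed
  qed (use F in auto)
qed

text \<open>\<open>f\<close> may have no derivatives, and the gradients \<open>V\<close> of its
  averages may be unbounded as \<open>n\<close> grows. They cancel for each fixed \<open>n\<close>,
  before the limit is taken: the drift is exactly the integral of the compensator, leaving plain
  increments that inherit the Hoelder bound.\<close>

lemma dynkin_of_holder:
  fixes f :: "real ^ 'n \<Rightarrow> real"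
  assumes f: "continuous_on UNIV f" "\<And>x. \<bar>f x\<bar> \<le> C"
    and \<alpha>: "\<alpha> \<le> 1" and w: "integrable \<nu> (levy_weight \<alpha>)"
    and holder: "\<And>x y. 0 < norm y \<Longrightarrow> norm y < 1 \<Longrightarrow> \<bar>f (x + y) - f x\<bar> \<le> D * norm y powr \<alpha>"
    and Q: "Q = 0" and b: "b = (LINT y|\<nu>. indicator {0<..<1} (norm y) *\<^sub>R y)"
  shows "\<bar>f (x + y) - f x\<bar> \<le> (2 * C + \<bar>D\<bar>) * levy_weight \<alpha> y"
    and "dynkin f (\<lambda>x. LINT y|\<nu>. f (x + y) - f x)"
proof -
  have [measurable]: "f \<in> borel_measurable borel" by (rule borel_measurable_continuous_onI[OF f(1)])
  define K where "K = 2 * C + \<bar>D\<bar>"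
  have C: "0 \<le> C" using f(2)[of 0] by linarith
  have inc: "\<bar>k (x + y) - k x\<bar> \<le> K * levy_weight \<alpha> y"
    if k: "\<And>x. \<bar>k x\<bar> \<le> C" "0 < norm y \<Longrightarrow> norm y < 1 \<Longrightarrow> \<bar>k (x + y) - k x\<bar> \<le> \<bar>D\<bar> * norm y powr \<alpha>" for k x y
    using jump_weight_bound[of k C "\<bar>D\<bar>" y x "\<lambda>_. 0" \<alpha>] k by (simp add: jump_def K_def)
  have holder': "\<bar>f (x + y) - f x\<bar> \<le> \<bar>D\<bar> * norm y powr \<alpha>" if "0 < norm y" "norm y < 1" for x y
    using order_trans[OF holder[OF that, of x], of "\<bar>D\<bar> * norm y powr \<alpha>"] by (simp add: mult_right_mono)
  show "\<bar>f (x + y) - f x\<bar> \<le> (2 * C + \<bar>D\<bar>) * levy_weight \<alpha> y" for x y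
    using inc[of f] f(2) holder' unfolding K_def by blast
  define F where "F n = gauss_avg (real (Suc n)) f" for n
  have [measurable]: "F n \<in> borel_measurable borel" for n unfolding F_def by measurable
  have F: "(\<lambda>n. F n x) \<longlonglongrightarrow> f x" "\<bar>F n x\<bar> \<le> C" for n x
    unfolding F_def by (rule gauss_avg_tendsto[OF f], rule gauss_avg_bound[OF _ f(2)]) simp
  have [measurable]: "levy_weight \<alpha> \<in> borel_measurable borel"
    unfolding levy_weight_def[abs_def] by measurable
  have incF: "\<bar>F n (x + y) - F n x\<bar> \<le> K * levy_weight \<alpha> y" for n x y
    by (rule inc) (use F(2) holder' f(2) in \<open>auto simp: F_def intro!: gauss_avg_increment\<close>)
  have intF: "integrable \<nu> (\<lambda>y. F n (x + y) - F n x)" for n x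
    by (rule Bochner_Integration.integrable_bound[OF integrable_mult_right[OF w, of K]])
      (use order_trans[OF incF abs_ge_self] in \<open>auto intro!: AE_I2\<close>)
  have int_id: "integrable \<nu> (\<lambda>y. indicator {0<..<1} (norm y) *\<^sub>R y)"
  proof (rule Bochner_Integration.integrable_bound[OF w])
    \<comment> \<open>Here \<alpha> \<le> 1 enters: the small jumps have a finite first moment, so
      drift and compensator can be separated.\<close>
    have "norm y powr 1 \<le> norm y powr \<alpha>" if "0 < norm y" "norm y < 1" for y :: "real^'n"
      using that \<alpha> by (intro powr_mono') auto
    then show "AE y in \<nu>. norm (indicator {0<..<1} (norm y) *\<^sub>R y) \<le> norm (levy_weight \<alpha> y)"
      by (auto simp: levy_weight_def indicator_def)
  qed measurable
  show "dynkin f (\<lambda>x. LINT y|\<nu>. f (x + y) - f x)"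
  proof (rule dynkin_limit[where F = F and G = "\<lambda>n x. LINT y|\<nu>. F n (x + y) - F n x" and C = "C + (LINT y|\<nu>. K * levy_weight \<alpha> y)"])
    show "dynkin (F n) (\<lambda>x. LINT y|\<nu>. F n (x + y) - F n x)" for n
    proof -
      obtain V W where "\<And>b Q \<nu> \<mu> \<eta>. dynkin_measures b Q \<nu> \<mu> \<eta> \<Longrightarrow>
          dynkin_measures.dynkin \<mu> \<eta> (F n) (levy_op b \<nu> (F n) V (\<lambda>x. second_order Q (W x)))"
        unfolding F_def by (rule gauss_avg_smooth[of f C "real (Suc n)"]) (use f(2) in auto)
      then have D: "dynkin (F n) (levy_op b \<nu> (F n) V (\<lambda>x. second_order Q (W x)))"
        using dynkin_measures_axioms by blast
      have "levy_op b \<nu> (F n) V (\<lambda>x. second_order Q (W x)) x = (LINT y|\<nu>. F n (x + y) - F n x)" for x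
      proof -
        have "b \<bullet> V x = (LINT y|\<nu>. (V x \<bullet> y) * indicator {0<..<1} (norm y))"
          unfolding b by (subst integral_inner_left[symmetric]) (use int_id in \<open>auto simp: inner_commute mult.commute\<close>)
        moreover have "integrable \<nu> (\<lambda>y. (V x \<bullet> y) * indicator {0<..<1} (norm y))"
          using integrable_inner_right[OF int_id, of "V x"] by (simp add: mult.commute)
        ultimately show ?thesis
          unfolding levy_op_def jump_def using intF Q by (simp add: second_order_def)
      qed
      then have "levy_op b \<nu> (F n) V (\<lambda>x. second_order Q (W x)) = (\<lambda>x. LINT y|\<nu>. F n (x + y) - F n x)"
        by (rule ext)
      with D show ?thesis by simp
    qed
    show "(\<lambda>n. LINT y|\<nu>. F n (x + y) - F n x) \<longlonglongrightarrow> (LINT y|\<nu>. f (x + y) - f x)" for x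
      by (rule integral_dominated_convergence[where w = "\<lambda>y. K * levy_weight \<alpha> y"])
        (use incF w in \<open>auto intro!: tendsto_intros F\<close>)
    have I0: "0 \<le> (LINT y|\<nu>. K * levy_weight \<alpha> y)"
      using C by (intro Bochner_Integration.integral_nonneg) (simp add: K_def)
    show "\<bar>F n x\<bar> \<le> C + (LINT y|\<nu>. K * levy_weight \<alpha> y)" for n x using F(2)[of n x] I0 by linarith
    show "\<bar>LINT y|\<nu>. F n (x + y) - F n x\<bar> \<le> C + (LINT y|\<nu>. K * levy_weight \<alpha> y)" for n x
    proof -
      have "\<bar>LINT y|\<nu>. F n (x + y) - F n x\<bar> \<le> (LINT y|\<nu>. \<bar>F n (x + y) - F n x\<bar>)" by (rule integral_abs_bound)
      also have "\<dots> \<le> (LINT y|\<nu>. K * levy_weight \<alpha> y)"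
        by (intro integral_mono integrable_abs intF integrable_mult_right w incF)
      finally show ?thesis using C by linarith
    qed
  qed (use F in auto)
qed

end

section \<open>The law of a Levy process\<close>

context levy_process
begin

lemma measurable_L [measurable]: "0 \<le> t \<Longrightarrow> L t \<in> borel_measurable M"
  using random_variable_L by simp

section \<open>The characteristic functions form a multiplicative semigroup\<close>

definition chf :: "real \<Rightarrow> real ^ 'n \<Rightarrow> complex" where
  "chf t \<xi> = (LINT \<omega>|M. iexp (\<xi> \<bullet> L t \<omega>))"

lemma chf_0: "chf 0 \<xi> = 1"
proof -
  have "chf 0 \<xi> = (LINT \<omega>|M. 1)"
    unfolding chf_def by (rule integral_cong_AE) (use start_zero in auto)
  then show ?thesis by (simp add: prob_space)
qed

text \<open>The increments over [0, s] and [s, s + h] are independent and the second has the law of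
  \<open>L h\<close>. Both lengths are positive because the sampling times in
  \<open>independent_increments\<close> increase strictly; \<open>L 0 = 0\<close> holds only almost
  surely, hence the comparisons up to null sets.\<close>

lemma chf_add:
  assumes s: "0 < s" and h: "0 < h"
  shows "chf (s + h) \<xi> = chf s \<xi> * chf h \<xi>"
proof -
  define r :: "nat \<Rightarrow> real" where "r i = (if i = 0 then 0 else if i = 1 then s else s + h)" for i
  define X where "X i \<omega> = iexp (\<xi> \<bullet> (L (r (Suc i)) \<omega> - L (r i) \<omega>))" for i \<omega>
  have r: "r 0 = 0" "r (Suc 0) = s" "r (Suc (Suc 0)) = s + h" by (simp_all add: r_def)
  have iexp_meas: "(\<lambda>x. iexp (\<xi> \<bullet> x)) \<in> borel_measurable borel" by measurable
  have "indep_vars (\<lambda>_. borel) (\<lambda>i \<omega>. L (r (Suc i)) \<omega> - L (r i) \<omega>) {..<2}"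
    by (rule independent_increments) (use s h in \<open>auto simp: r_def less_2_cases_iff\<close>)
  from indep_vars_compose2[OF this iexp_meas]
  have "indep_vars (\<lambda>_. borel) X {..<2}" by (simp add: X_def[abs_def])
  moreover have "integrable M (X i)" if "i < 2" for i
  proof (rule integrable_const_bound[where B = 1])
    have "0 \<le> r i" "0 \<le> r (Suc i)" using s h by (auto simp: r_def)
    then show "X i \<in> borel_measurable M" unfolding X_def[abs_def] by measurable
  qed (simp add: X_def)
  ultimately have "(LINT \<omega>|M. (\<Prod>i<2. X i \<omega>)) = (\<Prod>i<2. LINT \<omega>|M. X i \<omega>)"
    by (intro indep_vars_lebesgue_integral) auto
  then have prod: "(LINT \<omega>|M. X 0 \<omega> * X 1 \<omega>) = (LINT \<omega>|M. X 0 \<omega>) * (LINT \<omega>|M. X 1 \<omega>)"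
    by (simp add: numeral_2_eq_2)
  have "chf (s + h) \<xi> = (LINT \<omega>|M. X 0 \<omega> * X 1 \<omega>)"
    unfolding chf_def
  proof (rule integral_cong_AE)
    show "AE \<omega> in M. iexp (\<xi> \<bullet> L (s + h) \<omega>) = X 0 \<omega> * X 1 \<omega>"
      using start_zero by eventually_elim (simp add: X_def r exp_add[symmetric] inner_diff_right algebra_simps)
  qed (use s h in \<open>auto simp: X_def r\<close>)
  moreover have "(LINT \<omega>|M. X 0 \<omega>) = chf s \<xi>"
    unfolding chf_def
    by (rule integral_cong_AE) (use s h start_zero in \<open>auto simp: X_def r\<close>)
  moreover have "(LINT \<omega>|M. X 1 \<omega>) = chf h \<xi>"
  proof -
    have "(LINT \<omega>|M. X 1 \<omega>) = (LINT y|distr M borel (\<lambda>\<omega>. L (s + h) \<omega> - L s \<omega>). iexp (\<xi> \<bullet> y))"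
      unfolding X_def using s h by (subst integral_distr) (auto simp: r)
    also have "\<dots> = (LINT y|distr M borel (\<lambda>\<omega>. L h \<omega> - L 0 \<omega>). iexp (\<xi> \<bullet> y))"
      using s h by (subst stationary_increments) auto
    also have "\<dots> = (LINT \<omega>|M. iexp (\<xi> \<bullet> (L h \<omega> - L 0 \<omega>)))"
      using s h by (subst integral_distr) auto
    also have "\<dots> = chf h \<xi>"
      unfolding chf_def by (rule integral_cong_AE) (use s h start_zero in auto)
    finally show ?thesis .
  qed
  ultimately show ?thesis using prod by simp
qed

lemma chf_mult:
  assumes "0 < s" shows "chf (real k * s) \<xi> = chf s \<xi> ^ k"
proof (induction k)
  case (Suc k)
  show ?case
  proof (cases "k = 0")
    case False
    then have "chf (real k * s + s) \<xi> = chf (real k * s) \<xi> * chf s \<xi>" using assms by (intro chf_add) auto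
    then show ?thesis using Suc by (simp add: algebra_simps)
  qed simp
qed (simp add: chf_0)

lemma continuous_chf:
  assumes "0 \<le> t" shows "continuous_on UNIV (chf t)"
  unfolding continuous_on_sequentially
proof (intro allI impI ballI)
  fix X and \<xi> :: "real ^ 'n" assume X: "(\<forall>n. X n \<in> UNIV) \<and> X \<longlonglongrightarrow> \<xi>"
  show "(chf t \<circ> X) \<longlonglongrightarrow> chf t \<xi>"
    unfolding o_def chf_def
    by (rule integral_dominated_convergence[where w = "\<lambda>_. 1"])
      (use assms X in \<open>auto intro!: tendsto_intros AE_I2\<close>)
qed

section \<open>Consequences of right continuity: joint measurability and smallness at short
  times\<close>

text \<open>The floor plus one places \<open>A n\<close> strictly to the right of \<open>s\<close>
  and at distance at most 1/(n+1), so a right limit along \<open>A\<close> needs no left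
  continuity.\<close>

lemma grid_approx:
  fixes s :: real
  assumes "0 \<le> s"
  defines "A \<equiv> \<lambda>n. real (Suc (nat \<lfloor>real (Suc n) * s\<rfloor>)) / real (Suc n)"
  shows "filterlim A (at_right s) sequentially"
proof -
  have fl: "real (nat \<lfloor>real (Suc n) * s\<rfloor>) = of_int \<lfloor>real (Suc n) * s\<rfloor>" for n using assms(1) by simp
  have gt: "s < A n" for n
  proof -
    have "real (Suc n) * s < real (Suc (nat \<lfloor>real (Suc n) * s\<rfloor>))"
      using fl[of n] by (simp del: of_nat_Suc add: of_nat_Suc[of "nat _"]) linarith
    then show ?thesis unfolding A_def by (simp add: field_simps del: of_nat_Suc)
  qed
  have le: "A n \<le> s + inverse (real (Suc n))" for n
  proof -
    have "real (Suc (nat \<lfloor>real (Suc n) * s\<rfloor>)) \<le> real (Suc n) * s + 1"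
      using fl[of n] by (simp del: of_nat_Suc add: of_nat_Suc[of "nat _"])
    then show ?thesis unfolding A_def by (simp add: field_simps del: of_nat_Suc)
  qed
  have "(\<lambda>n. s + inverse (real (Suc n))) \<longlonglongrightarrow> s + 0"
    by (intro tendsto_intros LIMSEQ_inverse_real_of_nat)
  then have "A \<longlonglongrightarrow> s"
    by (intro tendsto_sandwich[of "\<lambda>_. s" A _ "\<lambda>n. s + inverse (real (Suc n))"]) (use gt le in \<open>auto intro!: always_eventually less_imp_le simp del: of_nat_Suc\<close>)
  then show ?thesis
    using gt gt[THEN less_imp_neq, THEN not_sym] by (simp add: filterlim_at)
qed

lemma L_right_limit:
  assumes "\<omega> \<in> space M" "0 \<le> s"
  shows "(\<lambda>n. L (real (Suc (nat \<lfloor>real (Suc n) * s\<rfloor>)) / real (Suc n)) \<omega>) \<longlonglongrightarrow> L s \<omega>"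
  using filterlim_compose[OF right_continuous[OF assms, unfolded continuous_within] grid_approx[OF assms(2)]] .

text \<open>The discretised process uses only countably many of the random variables and is
  therefore jointly measurable; sampling at the next grid point makes it converge to
  \<open>L s\<close> by right continuity.\<close>

lemma joint_measurable:
  "(\<lambda>(s, \<omega>). L s \<omega>) \<in> borel_measurable (restrict_space lborel {0..t} \<Otimes>\<^sub>M M)" (is "_ \<in> borel_measurable ?N")
proof (rule borel_measurable_LIMSEQ_metric[where f = "\<lambda>n (s, \<omega>). L (real (Suc (nat \<lfloor>real (Suc n) * s\<rfloor>)) / real (Suc n)) \<omega>"])
  fix n :: nat
  let ?f = "\<lambda>k p. L (real (Suc k) / real (Suc n)) (snd p)"
  have "(\<lambda>p. ?f (nat \<lfloor>real (Suc n) * fst p\<rfloor>) p) \<in> borel_measurable ?N"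
  proof (rule measurable_compose_countable[where f = ?f])
    show "?f k \<in> borel_measurable ?N" for k by measurable
    have [measurable]: "fst \<in> borel_measurable ?N"
      by (rule measurable_compose[OF measurable_fst]) (auto intro!: measurable_restrict_space1)
    show "(\<lambda>p. nat \<lfloor>real (Suc n) * fst p\<rfloor>) \<in> ?N \<rightarrow>\<^sub>M count_space UNIV" by measurable
  qed
  then show "(\<lambda>(s, \<omega>). L (real (Suc (nat \<lfloor>real (Suc n) * s\<rfloor>)) / real (Suc n)) \<omega>) \<in> borel_measurable ?N"
    by (simp add: case_prod_beta')
qed (use L_right_limit in \<open>auto simp: space_pair_measure space_restrict_space simp del: of_nat_Suc\<close>)

text \<open>Convergence to 0 in probability, metrised by the truncated norm so that dominated
  convergence applies. The time \<open>s = 0\<close> is included because the occupation measure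
  integrates over the closed interval.\<close>

lemma expectation_norm_small:
  assumes e: "0 < e"
  obtains d where "0 < d" "\<And>s. 0 \<le> s \<Longrightarrow> s < d \<Longrightarrow> (LINT \<omega>|M. min 1 (norm (L s \<omega>))) \<le> e"
proof -
  have "((\<lambda>s. LINT \<omega>|M. min 1 (norm (L s \<omega>))) \<longlongrightarrow> 0) (at_right 0)"
  proof (rule tendsto_at_right_sequentially[of 0 1])
    fix S :: "nat \<Rightarrow> real"
    assume S: "\<And>n. 0 < S n" "S \<longlonglongrightarrow> 0"
    then have "filterlim S (at_right 0) sequentially"
      using S(1)[THEN less_imp_neq, THEN not_sym] by (simp add: filterlim_at)
    then have lim: "(\<lambda>n. L (S n) \<omega>) \<longlonglongrightarrow> L 0 \<omega>" if "\<omega> \<in> space M" for \<omega>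
      using right_continuous[OF that, of 0] by (auto simp: continuous_within intro: filterlim_compose)
    have "(\<lambda>n. LINT \<omega>|M. min 1 (norm (L (S n) \<omega>))) \<longlonglongrightarrow> (LINT \<omega>|M. 0)"
    proof (rule integral_dominated_convergence[where w = "\<lambda>_. 1"])
      show "AE \<omega> in M. (\<lambda>n. min 1 (norm (L (S n) \<omega>))) \<longlonglongrightarrow> 0"
        using start_zero AE_space
      proof eventually_elim
        fix \<omega> assume \<omega>: "L 0 \<omega> = 0" "\<omega> \<in> space M"
        have "(\<lambda>n. min 1 (norm (L (S n) \<omega>))) \<longlonglongrightarrow> min 1 (norm (L 0 \<omega>))"
          by (intro tendsto_intros lim \<omega>)
        then show "(\<lambda>n. min 1 (norm (L (S n) \<omega>))) \<longlonglongrightarrow> 0" using \<omega> by simp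
      qed
    qed (use S in \<open>auto intro!: measurable_compose[OF measurable_L] simp: less_imp_le\<close>)
    then show "(\<lambda>n. LINT \<omega>|M. min 1 (norm (L (S n) \<omega>))) \<longlonglongrightarrow> 0" by simp
  qed simp
  then have "eventually (\<lambda>s. (LINT \<omega>|M. min 1 (norm (L s \<omega>))) < e) (at_right 0)"
    using e by (rule order_tendstoD)
  then obtain d where d: "0 < d" "\<And>s. 0 < s \<Longrightarrow> s < d \<Longrightarrow> (LINT \<omega>|M. min 1 (norm (L s \<omega>))) < e"
    by (auto simp: eventually_at_right_field)
  have "(LINT \<omega>|M. min 1 (norm (L 0 \<omega>))) = (LINT \<omega>|M. 0)"
    by (rule integral_cong_AE) (use start_zero in auto)
  then show ?thesis
    using that[OF d(1)] d(2) e by (metis integral_zero less_eq_real_def)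
qed

text \<open>The law of \<open>L\<close> under Lebesgue measure on \<open>[0, t]\<close> times \<open>M\<close>, so that \<open>\<integral> g d(occupation t)\<close> is
  \<open>\<integral>_0^t E g(L_s) ds\<close> and Dynkin's formula becomes a relation between two finite measures.\<close>

definition occupation :: "real \<Rightarrow> (real ^ 'n) measure" where
  "occupation t = distr (restrict_space lborel {0..t} \<Otimes>\<^sub>M M) borel (\<lambda>(s, \<omega>). L s \<omega>)"

lemma sets_occupation [simp, measurable_cong]: "sets (occupation t) = sets borel"
  by (simp add: occupation_def)

lemma emeasure_occupation_UNIV:
  assumes "0 \<le> t" shows "emeasure (occupation t) UNIV = ennreal t"
proof -
  have "emeasure (occupation t) UNIV = emeasure (restrict_space lborel {0..t} \<Otimes>\<^sub>M M) (space (restrict_space lborel {0..t} \<Otimes>\<^sub>M M))"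
    unfolding occupation_def by (subst emeasure_distr[OF joint_measurable]) auto
  also have "\<dots> = emeasure (restrict_space lborel {0..t}) {0..t} * emeasure M (space M)"
    unfolding space_pair_measure using sets.top[of "restrict_space lborel {0..t}"]
    by (subst emeasure_pair_measure_Times) (auto simp: space_restrict_space)
  also have "\<dots> = ennreal t"
    using assms by (simp add: emeasure_space_1 emeasure_restrict_space)
  finally show ?thesis .
qed

lemma finite_measure_occupation: "0 \<le> t \<Longrightarrow> finite_measure (occupation t)"
  by (rule finite_measureI) (simp add: emeasure_occupation_UNIV sets_eq_imp_space_eq[OF sets_occupation])

lemma sigma_finite_time: "sigma_finite_measure (restrict_space lborel {0..t::real})"
  by (intro finite_measure.axioms(1) finite_measureI) (simp add: space_restrict_space emeasure_restrict_space emeasure_lborel_Icc_eq)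

lemma integral_occupation:
  fixes f :: "real ^ 'n \<Rightarrow> 'b::{banach, second_countable_topology}"
  assumes t: "0 \<le> t" and [measurable]: "f \<in> borel_measurable borel" and B: "\<And>y. norm (f y) \<le> B"
  shows "(LINT y|occupation t. f y) = (LINT s|lborel. indicator {0..t} s *\<^sub>R (LINT \<omega>|M. f (L s \<omega>)))"
proof -
  let ?T = "restrict_space lborel {0..t}"
  interpret T: sigma_finite_measure ?T by (rule sigma_finite_time)
  interpret TM: pair_sigma_finite ?T M ..
  note joint_measurable[measurable]
  interpret o: finite_measure "occupation t" by (rule finite_measure_occupation[OF t])
  have "integrable (occupation t) f"
    by (rule o.integrable_const_bound[where B = B]) (use B in auto)
  then have int: "integrable (?T \<Otimes>\<^sub>M M) (\<lambda>(s, \<omega>). f (L s \<omega>))"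
    unfolding occupation_def by (subst (asm) integrable_distr_eq[OF joint_measurable]) (auto simp: case_prod_beta')
  have "(LINT y|occupation t. f y) = (LINT p|(?T \<Otimes>\<^sub>M M). case_prod (\<lambda>s \<omega>. f (L s \<omega>)) p)"
    unfolding occupation_def by (subst integral_distr[OF joint_measurable]) (auto simp: case_prod_beta')
  also have "\<dots> = (LINT s|?T. (LINT \<omega>|M. f (L s \<omega>)))"
    by (rule TM.integral_fst[OF int, symmetric])
  also have "\<dots> = (LINT s|lborel. indicator {0..t} s *\<^sub>R (LINT \<omega>|M. f (L s \<omega>)))"
    by (subst integral_restrict_space) auto
  finally show ?thesis .
qed

end

section \<open>Functions vanishing at infinity and the generator\<close>

lemma C0_bounded:
  fixes f :: "real ^ 'n \<Rightarrow> real"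
  assumes "f \<in> C0" obtains C where "0 \<le> C" "\<And>x. \<bar>f x\<bar> \<le> C"
proof -
  have cont: "continuous_on UNIV f" and lim: "(f \<longlongrightarrow> 0) at_infinity" using assms by (auto simp: C0_def)
  obtain R where R: "\<And>x. R \<le> norm x \<Longrightarrow> \<bar>f x\<bar> < 1"
    using lim[THEN tendstoD, of 1] by (auto simp: eventually_at_infinity)
  have "compact (f ` cball 0 R)"
    by (intro compact_continuous_image continuous_on_subset[OF cont]) auto
  then obtain B where B: "\<And>x. norm x \<le> R \<Longrightarrow> \<bar>f x\<bar> \<le> B"
    by (metis compact_imp_bounded bounded_iff imageI mem_cball_0 real_norm_def)
  show ?thesis
  proof (rule that[of "max 1 B"])
    show "\<bar>f x\<bar> \<le> max 1 B" for x using R[of x] B[of x] by (cases "norm x \<le> R") auto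
  qed simp
qed

text \<open>The ball has radius \<open>R + 1\<close> and the shift is below 1: two such points
  either both lie in the ball, where compactness applies, or both have norm at least
  \<open>R\<close>, where each value is below e/2.\<close>

lemma C0_uniformly_continuous:
  fixes f :: "real ^ 'n \<Rightarrow> real"
  assumes "f \<in> C0" and e: "0 < e"
  obtains d where "0 < d" "\<And>x y. norm y < d \<Longrightarrow> \<bar>f (x + y) - f x\<bar> \<le> e"
proof -
  have cont: "continuous_on UNIV f" and lim: "(f \<longlongrightarrow> 0) at_infinity" using assms by (auto simp: C0_def)
  obtain R where R: "\<And>x. R \<le> norm x \<Longrightarrow> \<bar>f x\<bar> < e/2"
    using lim[THEN tendstoD, of "e/2"] e by (auto simp: eventually_at_infinity)
  have "uniformly_continuous_on (cball 0 (R + 1)) f"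
    by (intro compact_uniformly_continuous continuous_on_subset[OF cont]) auto
  then obtain d where d: "0 < d" "\<And>x y. \<lbrakk>x \<in> cball 0 (R + 1); y \<in> cball 0 (R + 1); dist y x < d\<rbrakk> \<Longrightarrow> dist (f y) (f x) < e"
    using e unfolding uniformly_continuous_on_def by metis
  show ?thesis
  proof (rule that[of "min d 1"])
    show "\<bar>f (x + y) - f x\<bar> \<le> e" if y: "norm y < min d 1" for x y
    proof (cases "norm x \<le> R + 1 \<and> norm (x + y) \<le> R + 1")
      case True
      have "dist (x + y) x = norm y" by (simp add: dist_norm)
      then have "dist (f (x + y)) (f x) < e" using True y by (intro d(2)) simp_all
      then show ?thesis by (simp add: dist_real_def)
    next
      case False
      then have "R \<le> norm x" "R \<le> norm (x + y)"
        using y norm_triangle_ineq[of x y] norm_triangle_ineq4[of "x + y" y] by auto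
      then show ?thesis using R[of x] R[of "x + y"] by linarith
    qed
  qed (use d in auto)
qed

text \<open>Uniform continuity and boundedness merged into one inequality that is linear in the
  truncated norm and can be integrated directly, uniformly in \<open>x\<close>.\<close>

lemma C0_modulus:
  fixes f :: "real ^ 'n \<Rightarrow> real"
  assumes f: "f \<in> C0" and e: "0 < e"
  obtains K where "0 \<le> K" "\<And>x y. \<bar>f (x + y) - f x\<bar> \<le> e + K * min 1 (norm y)"
proof -
  obtain C where C: "0 \<le> C" "\<And>x. \<bar>f x\<bar> \<le> C" using C0_bounded[OF f] by blast
  obtain d where d: "0 < d" "\<And>x y. norm y < d \<Longrightarrow> \<bar>f (x + y) - f x\<bar> \<le> e" using C0_uniformly_continuous[OF f e] by blast
  define m where "m = min 1 d"
  have m: "0 < m" "m \<le> 1" "m \<le> d" using d by (auto simp: m_def)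
  show ?thesis
  proof (rule that[of "2 * C / m"])
    show "\<bar>f (x + y) - f x\<bar> \<le> e + 2 * C / m * min 1 (norm y)" for x y
    proof (cases "norm y < d")
      case True
      then show ?thesis using d(2)[of y x] C m by (intro order_trans[OF d(2)]) auto
    next
      case False
      then have "m \<le> min 1 (norm y)" using m by auto
      then have "2 * C / m * m \<le> 2 * C / m * min 1 (norm y)" using C m by (intro mult_left_mono) auto
      moreover have "\<bar>f (x + y) - f x\<bar> \<le> 2 * C" using C(2)[of x] C(2)[of "x + y"] by linarith
      ultimately show ?thesis using m e by simp
    qed
  qed (use C m in auto)
qed

lemma C0_zero [simp]: "(\<lambda>x. 0) \<in> C0"
  and C0_add: "f \<in> C0 \<Longrightarrow> g \<in> C0 \<Longrightarrow> (\<lambda>x. f x + g x) \<in> C0"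
  and C0_minus: "f \<in> C0 \<Longrightarrow> g \<in> C0 \<Longrightarrow> (\<lambda>x. f x - g x) \<in> C0"
  and C0_cmult: "f \<in> C0 \<Longrightarrow> (\<lambda>x. c * f x) \<in> C0"
  unfolding C0_def
  by (auto intro!: continuous_intros tendsto_eq_intros)

lemma C0_sum: "(\<And>i. i \<in> I \<Longrightarrow> f i \<in> C0) \<Longrightarrow> (\<lambda>x. \<Sum>i\<in>I. f i x) \<in> C0"
  by (induction I rule: infinite_finite_induct) (auto intro: C0_add)

lemma C0_translate:
  assumes "f \<in> C0" shows "(\<lambda>x. f (x + y)) \<in> C0"
proof -
  have cont: "continuous_on UNIV f" and lim: "(f \<longlongrightarrow> 0) at_infinity" using assms by (auto simp: C0_def)
  have "filterlim (\<lambda>x. x + y) at_infinity at_infinity"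
    by (rule tendsto_add_filterlim_at_infinity'[OF filterlim_ident tendsto_const])
  from filterlim_compose[OF lim this] show ?thesis
    by (auto simp: C0_def intro!: continuous_on_compose2[OF cont] continuous_intros)
qed

text \<open>Dominated convergence along sequences gives both properties: along convergent sequences
  it yields continuity, along sequences with norms tending to infinity it yields the limit
  0.\<close>

lemma C0_integral:
  fixes J :: "real ^ 'n \<Rightarrow> 'a \<Rightarrow> real"
  assumes J: "\<And>y. (\<lambda>x. J x y) \<in> C0" and meas: "\<And>x. J x \<in> borel_measurable k"
    and W: "\<And>x y. \<bar>J x y\<bar> \<le> W y" "integrable k W"
  shows "(\<lambda>x. LINT y|k. J x y) \<in> C0"
proof -
  have *: "(\<lambda>n. LINT y|k. J (X n) y) \<longlonglongrightarrow> (LINT y|k. l y)"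
    if "\<And>y. (\<lambda>n. J (X n) y) \<longlonglongrightarrow> l y" for X :: "nat \<Rightarrow> real ^ 'n" and l
    by (rule integral_dominated_convergence[where w = W])
      (use W meas that in \<open>auto intro: borel_measurable_LIMSEQ_real[OF that]\<close>)
  have "continuous_on UNIV (\<lambda>x. LINT y|k. J x y)"
    unfolding continuous_on_sequentially o_def
    using J by (auto intro!: * simp: C0_def continuous_on_sequentially o_def)
  moreover have "((\<lambda>x. LINT y|k. J x y) \<longlongrightarrow> 0) at_infinity"
  proof (rule tendstoI, rule ccontr)
    fix e :: real
    assume "0 < e" and "\<not> (\<forall>\<^sub>F x in at_infinity. dist (LINT y|k. J x y) 0 < e)"
    then have "\<forall>n. \<exists>x. real n \<le> norm x \<and> e \<le> \<bar>LINT y|k. J x y\<bar>"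
      by (auto simp: eventually_at_infinity not_less)
    then obtain X where X: "\<And>n. real n \<le> norm (X n)" "\<And>n. e \<le> \<bar>LINT y|k. J (X n) y\<bar>" by metis
    have "filterlim X at_infinity sequentially"
      unfolding filterlim_at_infinity_conv_norm_at_top
      by (rule filterlim_at_top_mono[OF filterlim_real_sequentially]) (use X in auto)
    moreover have "((\<lambda>x. J x y) \<longlongrightarrow> 0) at_infinity" for y using J[of y] by (simp add: C0_def)
    ultimately have "(\<lambda>n. LINT y|k. J (X n) y) \<longlonglongrightarrow> (LINT y|k. 0)"
      by (intro *) (rule filterlim_compose)
    then have "(\<lambda>n. \<bar>LINT y|k. J (X n) y\<bar>) \<longlonglongrightarrow> 0" by (auto intro: tendsto_rabs_zero)
    then have "e \<le> 0" by (rule LIMSEQ_le_const) (use X in auto)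
    with \<open>0 < e\<close> show False by simp
  qed
  ultimately show ?thesis by (simp add: C0_def)
qed

context levy_process
begin

section \<open>From Dynkin's formula to the uniform limit\<close>

lemma generator_limit_of_dynkin:
  assumes g: "g \<in> C0"
    and D: "\<And>t x. 0 < t \<Longrightarrow> (LINT \<omega>|M. f (x + L t \<omega>)) - f x = (LINT y|occupation t. g (x + y))"
  shows "generator_limit M L f g"
  unfolding generator_limit_def
proof (rule uniform_limitI)
  fix e :: real assume e: "0 < e"
  obtain K where K: "0 \<le> K" "\<And>x y. \<bar>g (x + y) - g x\<bar> \<le> e/3 + K * min 1 (norm y)"
    using C0_modulus[OF g, of "e/3"] e by auto
  obtain C where C: "\<And>x. \<bar>g x\<bar> \<le> C" using C0_bounded[OF g] by blast
  have cg: "continuous_on UNIV g" using g by (simp add: C0_def)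
  have [measurable]: "g \<in> borel_measurable borel" by (rule borel_measurable_continuous_onI[OF cg])
  \<comment> \<open>Adding 1 to \<open>K\<close> covers the case K = 0; the two error terms then sum
    to at most 2e/3, strictly below \<open>e\<close>.\<close>
  have "0 < e / (3 * (K + 1))" using e K by simp
  then obtain d where d: "0 < d" "\<And>s. 0 \<le> s \<Longrightarrow> s < d \<Longrightarrow> (LINT \<omega>|M. min 1 (norm (L s \<omega>))) \<le> e / (3 * (K + 1))"
    using expectation_norm_small by blast
  have "dist (1 / t * ((LINT \<omega>|M. f (x + L t \<omega>)) - f x)) (g x) < e" if t: "0 < t" "t < d" for t x
  proof -
    interpret o: finite_measure "occupation t" using t by (intro finite_measure_occupation) simp
    have sp: "space (occupation t) = UNIV" using sets_eq_imp_space_eq[OF sets_occupation] by simp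
    have mass: "measure (occupation t) UNIV = t"
      using emeasure_occupation_UNIV[of t] t by (simp add: measure_def)
    have ig: "integrable (occupation t) (\<lambda>y. g (x + y))"
      by (rule o.integrable_const_bound[where B = C]) (use C in auto)
    have im: "integrable (occupation t) (\<lambda>y. min 1 (norm y))"
      by (rule o.integrable_const_bound[where B = 1]) auto
    have "(LINT y|occupation t. min 1 (norm y)) = (LINT s|lborel. indicator {0..t} s *\<^sub>R (LINT \<omega>|M. min 1 (norm (L s \<omega>))))"
      using t by (intro integral_occupation[where B = 1]) auto
    also have "\<dots> \<le> (LINT s|lborel. indicator {0..t} s *\<^sub>R (e / (3 * (K + 1))))"
    proof (rule integral_mono')
      show "indicator {0..t} s *\<^sub>R (LINT \<omega>|M. min 1 (norm (L s \<omega>))) \<le> indicator {0..t} s *\<^sub>R (e / (3 * (K + 1)))" for s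
        using d(2)[of s] t by (auto simp: indicator_def)
      show "integrable lborel (\<lambda>s. indicator {0..t} s *\<^sub>R (e / (3 * (K + 1))))"
        by (intro integrable_scaleR_left integrable_real_indicator) (simp_all add: emeasure_lborel_Icc_eq)
    qed (use e K in \<open>auto simp: indicator_def\<close>)
    also have "\<dots> = t * (e / (3 * (K + 1)))" using t by simp
    finally have small: "(LINT y|occupation t. min 1 (norm y)) \<le> t * (e / (3 * (K + 1)))" .
    \<comment> \<open>The occupation measure has total mass \<open>t\<close>, so
      \<open>t * g x\<close> is the integral of the constant \<open>g x\<close>.\<close>
    have "(LINT \<omega>|M. f (x + L t \<omega>)) - f x - t * g x = (LINT y|occupation t. g (x + y) - g x)"
      using D[OF t(1)] ig by (simp add: sp mass)
    also have "\<bar>\<dots>\<bar> \<le> (LINT y|occupation t. \<bar>g (x + y) - g x\<bar>)" by (rule integral_abs_bound)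
    also have "\<dots> \<le> (LINT y|occupation t. e/3 + K * min 1 (norm y))"
      using ig im K by (intro integral_mono) auto
    also have "\<dots> = t * (e/3) + K * (LINT y|occupation t. min 1 (norm y))"
      using im by (simp add: sp mass)
    also have "\<dots> \<le> t * (e/3) + K * (t * (e / (3 * (K + 1))))" using small K by (intro add_left_mono mult_left_mono)
    also have "\<dots> \<le> t * (e/3) + t * (e/3)"
      using K t e by (simp add: field_simps)
    also have "\<dots> < t * e" using t e by simp
    finally have "\<bar>(LINT \<omega>|M. f (x + L t \<omega>)) - f x - t * g x\<bar> < t * e" .
    moreover have "1 / t * ((LINT \<omega>|M. f (x + L t \<omega>)) - f x) - g x = 1 / t * ((LINT \<omega>|M. f (x + L t \<omega>)) - f x - t * g x)"
      using t by (simp add: field_simps)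
    ultimately show ?thesis
      using t by (simp add: dist_real_def abs_mult field_simps)
  qed
  then show "\<forall>\<^sub>F t in at_right 0. \<forall>x\<in>UNIV. dist (1 / t * ((LINT \<omega>|M. f (x + L t \<omega>)) - f x)) (g x) < e"
    using d(1) unfolding eventually_at_right_field by blast
qed

text \<open>Uniform limits are pointwise limits, which are unique; this justifies the description
  operator in \<open>generator\<close>.\<close>

lemma generator_eqI:
  assumes g: "g \<in> C0" "generator_limit M L f g"
  shows "generator M L f = g"
  unfolding generator_def
proof (rule the_equality)
  fix g' assume "g' \<in> C0 \<and> generator_limit M L f g'"
  then have "((\<lambda>t. 1 / t * ((LINT \<omega>|M. f (x + L t \<omega>)) - f x)) \<longlongrightarrow> g' x) (at_right 0)" for x
    unfolding generator_limit_def using tendsto_uniform_limitI by fastforce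
  moreover have "((\<lambda>t. 1 / t * ((LINT \<omega>|M. f (x + L t \<omega>)) - f x)) \<longlongrightarrow> g x) (at_right 0)" for x
    using g(2) unfolding generator_limit_def using tendsto_uniform_limitI by fastforce
  ultimately show "g' = g"
    by (intro ext tendsto_unique[OF trivial_limit_at_right_real])
qed (use g in simp)

end

section \<open>The exponent at time 1 determines the characteristic function at all times\<close>

locale levy_triplet_process = levy_process M L
  for M :: "'w measure" and L :: "real \<Rightarrow> 'w \<Rightarrow> real ^ 'n" +
  fixes b :: "real ^ 'n" and Q :: "real ^ 'n ^ 'n" and \<nu> :: "(real ^ 'n) measure"
  assumes triplet: "has_levy_triplet M L b Q \<nu>"
begin

lemma sets_\<nu>: "sets \<nu> = sets (restrict_space borel (- {0}))"
  and min_\<nu>: "(\<integral>\<^sup>+y. ennreal (min ((norm y)\<^sup>2) 1) \<partial>\<nu>) < \<infinity>"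
  and chf_1: "chf 1 \<xi> = exp (- char_exponent b Q \<nu> \<xi>)"
  using triplet by (auto simp: has_levy_triplet_def levy_triplet_def levy_measure_def chf_def)

text \<open>\<open>\<nu>\<close> transported to the Borel sets of the whole space, without mass at \<open>0\<close>.\<close>

definition \<nu>' :: "(real ^ 'n) measure" where
  "\<nu>' = distr \<nu> borel (\<lambda>y. y)"

lemma measurable_\<nu>: "(\<lambda>y. y) \<in> \<nu> \<rightarrow>\<^sub>M borel"
proof -
  have "(\<lambda>y. y) \<in> restrict_space borel (- {0}) \<rightarrow>\<^sub>M (borel :: (real ^ 'n) measure)"
    by (rule measurable_restrict_space1) simp
  then show ?thesis by (simp cong: measurable_cong_sets[OF sets_\<nu> refl])
qed

lemma sets_\<nu>' [measurable_cong]: "sets \<nu>' = sets borel" by (simp add: \<nu>'_def)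

lemma integral_\<nu>':
  fixes f :: "real ^ 'n \<Rightarrow> 'b::{banach, second_countable_topology}"
  assumes "f \<in> borel_measurable borel"
  shows "(LINT y|\<nu>'. f y) = (LINT y|\<nu>. f y)" and "integrable \<nu>' f \<longleftrightarrow> integrable \<nu> f"
  unfolding \<nu>'_def using integral_distr[OF measurable_\<nu> assms] integrable_distr_eq[OF measurable_\<nu> assms] by simp_all

lemma nn_integral_\<nu>': "f \<in> borel_measurable borel \<Longrightarrow> (\<integral>\<^sup>+y. f y \<partial>\<nu>') = (\<integral>\<^sup>+y. f y \<partial>\<nu>)"
  unfolding \<nu>'_def by (subst nn_integral_distr[OF measurable_\<nu>]) simp_all

lemma \<nu>'_zero: "emeasure \<nu>' {0} = 0"
proof -
  have "space \<nu> = - {0}" using sets_eq_imp_space_eq[OF sets_\<nu>] by (simp add: space_restrict_space)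
  then show ?thesis unfolding \<nu>'_def by (subst emeasure_distr[OF measurable_\<nu>]) auto
qed

lemma min_\<nu>': "(\<integral>\<^sup>+y. ennreal (min ((norm y)\<^sup>2) 1) \<partial>\<nu>') < \<infinity>"
  using min_\<nu> by (subst nn_integral_\<nu>') auto

lemma integrable_min: "integrable \<nu>' (\<lambda>y. min ((norm y)\<^sup>2) 1)"
  using min_\<nu>' by (intro integrableI_nonneg) auto

lemma char_exponent_\<nu>': "char_exponent b Q \<nu>' \<xi> = char_exponent b Q \<nu> \<xi>"
  unfolding char_exponent_def by (subst integral_\<nu>') auto

abbreviation \<psi> :: "real ^ 'n \<Rightarrow> complex" where "\<psi> \<equiv> char_exponent b Q \<nu>'"

text \<open>A convergent sequence of frequencies is bounded by some \<open>R\<close>, which yields a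
  common \<open>\<nu>'\<close>-integrable majorant. Continuity is what fixes the branch of the root
  in \<open>chf_inverse_nat\<close>.\<close>

lemma continuous_\<psi>: "continuous_on UNIV \<psi>"
  unfolding continuous_on_sequentially o_def
proof (intro allI impI ballI)
  fix X and \<xi> :: "real ^ 'n" assume "(\<forall>n. X n \<in> UNIV) \<and> X \<longlonglongrightarrow> \<xi>"
  then have X: "X \<longlonglongrightarrow> \<xi>" by simp
  then have "Bseq X" by (intro convergent_imp_Bseq convergentI)
  then obtain R where R: "0 < R" "\<And>n. norm (X n) \<le> R" by (auto simp: Bseq_def)
  have "(\<lambda>n. LINT y|\<nu>'. 1 - exp (\<i> * complex_of_real (y \<bullet> X n)) + \<i> * complex_of_real (y \<bullet> X n * indicator {0<..<1} (norm y)))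
      \<longlonglongrightarrow> (LINT y|\<nu>'. 1 - exp (\<i> * complex_of_real (y \<bullet> \<xi>)) + \<i> * complex_of_real (y \<bullet> \<xi> * indicator {0<..<1} (norm y)))"
  proof (rule integral_dominated_convergence[where w = "\<lambda>y. (2 + R\<^sup>2) * min ((norm y)\<^sup>2) 1"])
    show "AE y in \<nu>'. norm (1 - exp (\<i> * complex_of_real (y \<bullet> X n)) + \<i> * complex_of_real (y \<bullet> X n * indicator {0<..<1} (norm y)))
        \<le> (2 + R\<^sup>2) * min ((norm y)\<^sup>2) 1" for n
    proof (rule AE_I2)
      fix y :: "real ^ 'n"
      have "(2 + (norm (X n))\<^sup>2) * min ((norm y)\<^sup>2) 1 \<le> (2 + R\<^sup>2) * min ((norm y)\<^sup>2) 1"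
        using R(2)[of n] by (intro mult_right_mono add_left_mono power_mono) auto
      then show "norm (1 - exp (\<i> * complex_of_real (y \<bullet> X n)) + \<i> * complex_of_real (y \<bullet> X n * indicator {0<..<1} (norm y)))
        \<le> (2 + R\<^sup>2) * min ((norm y)\<^sup>2) 1"
        by (rule order_trans[OF levy_integrand_bound])
    qed
  qed (use integrable_min X in \<open>auto intro!: tendsto_intros AE_I2\<close>)
  moreover have "(\<lambda>n. Q *v X n) \<longlonglongrightarrow> Q *v \<xi>"
    by (rule bounded_linear.tendsto[OF matrix_vector_mul_bounded_linear X])
  ultimately show "(\<lambda>n. \<psi> (X n)) \<longlonglongrightarrow> \<psi> \<xi>"
    unfolding char_exponent_def using X by (intro tendsto_intros) auto
qed

text \<open>The quotient of the two sides is a continuous function of \<open>\<xi>\<close> whose values are \<open>n+1\<close>-st roots of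
  unity, hence constant; this selects the right branch of the root.\<close>

lemma chf_inverse_nat: "chf (1 / real (Suc n)) \<xi> = exp (- \<psi> \<xi> / of_nat (Suc n))"
proof -
  define r where "r \<xi> = chf (1 / real (Suc n)) \<xi> * exp (\<psi> \<xi> / of_nat (Suc n))" for \<xi>
  have pow: "r \<xi> ^ Suc n = 1" for \<xi>
  proof -
    have "r \<xi> ^ Suc n = chf (1 / real (Suc n)) \<xi> ^ Suc n * exp (\<psi> \<xi> / of_nat (Suc n)) ^ Suc n"
      unfolding r_def by (rule power_mult_distrib)
    also have "exp (\<psi> \<xi> / of_nat (Suc n)) ^ Suc n = exp (\<psi> \<xi>)"
      by (subst exp_of_nat_mult[symmetric]) (simp del: of_nat_Suc)
    also have "chf (1 / real (Suc n)) \<xi> ^ Suc n = chf 1 \<xi>"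
      by (subst chf_mult[symmetric]) (simp_all del: of_nat_Suc)
    finally show ?thesis by (simp add: chf_1 char_exponent_\<nu>' exp_minus)
  qed
  have "continuous_on UNIV r"
    unfolding r_def using continuous_chf[of "1 / real (Suc n)"] continuous_\<psi>
    by (intro continuous_intros) (auto simp del: of_nat_Suc)
  moreover have "finite (range r)"
    by (rule finite_subset[OF _ finite_roots_unity[of "Suc n"]]) (use pow in auto)
  ultimately have "r constant_on UNIV"
    by (intro continuous_finite_range_constant) auto
  then have "r \<xi> = r 0" by (auto simp: constant_on_def)
  also have "r 0 = 1" by (simp add: r_def chf_def char_exponent_def prob_space)
  finally show ?thesis by (simp add: r_def exp_minus field_simps)
qed

text \<open>Powers of \<open>chf_inverse_nat\<close> settle the rational times k/(n+1); these
  approach \<open>t\<close> from the right, where the paths are continuous.\<close>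

lemma chf_eq:
  assumes t: "0 \<le> t" shows "chf t \<xi> = exp (- of_real t * \<psi> \<xi>)"
proof -
  define A where "A n = real (Suc (nat \<lfloor>real (Suc n) * t\<rfloor>)) / real (Suc n)" for n
  have A: "filterlim A (at_right t) sequentially" unfolding A_def[abs_def] by (rule grid_approx[OF t])
  have A0: "0 \<le> A n" for n by (simp add: A_def)
  have "(\<lambda>n. chf (A n) \<xi>) \<longlonglongrightarrow> chf t \<xi>"
    unfolding chf_def
  proof (rule integral_dominated_convergence[where w = "\<lambda>_. 1"])
    show "AE \<omega> in M. (\<lambda>n. iexp (\<xi> \<bullet> L (A n) \<omega>)) \<longlonglongrightarrow> iexp (\<xi> \<bullet> L t \<omega>)"
      unfolding A_def by (auto intro!: AE_I2 tendsto_intros L_right_limit t simp del: of_nat_Suc)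
  qed (use t A0 in \<open>auto intro!: AE_I2 measurable_compose[OF measurable_L]\<close>)
  moreover have "chf (A n) \<xi> = exp (- of_real (A n) * \<psi> \<xi>)" for n
  proof -
    let ?k = "Suc (nat \<lfloor>real (Suc n) * t\<rfloor>)"
    have "chf (A n) \<xi> = chf (real ?k * (1 / real (Suc n))) \<xi>" by (simp add: A_def)
    also have "\<dots> = exp (- \<psi> \<xi> / of_nat (Suc n)) ^ ?k"
      by (subst chf_mult) (simp_all only: chf_inverse_nat, simp)
    also have "\<dots> = exp (of_nat ?k * (- \<psi> \<xi> / of_nat (Suc n)))" by (rule exp_of_nat_mult[symmetric])
    also have "of_nat ?k * (- \<psi> \<xi> / of_nat (Suc n)) = - of_real (A n) * \<psi> \<xi>"
      unfolding A_def by (simp only: of_real_divide of_real_of_nat_eq) (simp add: field_simps del: of_nat_Suc)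
    finally show ?thesis .
  qed
  moreover have "(\<lambda>n. exp (- of_real (A n) * \<psi> \<xi>)) \<longlonglongrightarrow> exp (- of_real t * \<psi> \<xi>)"
    using A by (intro tendsto_intros) (auto simp: filterlim_at)
  ultimately show ?thesis by (auto intro: LIMSEQ_unique)
qed

text \<open>The fundamental theorem of calculus for s \<mapsto> exp(-s \<psi>) on [0, t]. Keeping
  \<psi> as a factor instead of dividing by it includes the frequencies where \<psi>
  vanishes.\<close>

lemma dynkin_measures_L:
  assumes t: "0 \<le> t"
  shows "dynkin_measures b Q \<nu>' (distr M borel (L t)) (occupation t)"
proof (rule dynkin_measures.intro)
  show "finite_measure (distr M borel (L t))"
    using t by (intro finite_measure_distr) simp
  show "finite_measure (occupation t)" by (rule finite_measure_occupation[OF t])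
  fix \<xi> :: "real ^ 'n"
  let ?E = "\<lambda>s::real. exp (- of_real s * \<psi> \<xi>)"
  have "(LINT y|occupation t. iexp (\<xi> \<bullet> y)) = (LINT s|lborel. indicator {0..t} s *\<^sub>R (LINT \<omega>|M. iexp (\<xi> \<bullet> L s \<omega>)))"
    by (rule integral_occupation[OF t, where B = 1]) auto
  also have "\<dots> = (LINT s|lborel. indicator {0..t} s *\<^sub>R ?E s)"
    by (rule Bochner_Integration.integral_cong) (auto simp: chf_eq[unfolded chf_def] indicator_def)
  finally have occ: "(LINT y|occupation t. iexp (\<xi> \<bullet> y)) = (LINT s|lborel. indicator {0..t} s *\<^sub>R ?E s)" .
  have "(LINT s|lborel. indicator {0..t} s *\<^sub>R (- \<psi> \<xi> * ?E s)) = ?E t - ?E 0"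
  proof (rule integral_FTC_Icc[OF t])
    show "(?E has_vector_derivative - \<psi> \<xi> * ?E s) (at s within {0..t})" for s
      by (rule has_vector_derivative_real_field[where f = "\<lambda>z. exp (- z * \<psi> \<xi>)"])
        (auto intro!: derivative_eq_intros)
    show "continuous_on {0..t} (\<lambda>s. - \<psi> \<xi> * ?E s)" by (intro continuous_intros)
  qed
  moreover have "(LINT s|lborel. indicator {0..t} s *\<^sub>R (- \<psi> \<xi> * ?E s)) = - \<psi> \<xi> * (LINT s|lborel. indicator {0..t} s *\<^sub>R ?E s)"
    by (subst integral_mult_right_zero[symmetric]) (simp only: mult_scaleR_right)
  moreover have "(LINT y|distr M borel (L t). iexp (\<xi> \<bullet> y)) = ?E t"
    using t by (subst integral_distr) (auto simp: chf_eq[unfolded chf_def])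
  ultimately show "(LINT y|distr M borel (L t). iexp (\<xi> \<bullet> y)) - 1 = - \<psi> \<xi> * (LINT y|occupation t. iexp (\<xi> \<bullet> y))"
    by (simp add: occ)
qed (use \<nu>'_zero min_\<nu>' sets_\<nu>' in simp_all)

lemma generator_of_dynkin:
  assumes f: "f \<in> C0" and g: "g \<in> C0"
    and D: "\<And>t. 0 < t \<Longrightarrow> dynkin_measures.dynkin (distr M borel (L t)) (occupation t) f g"
  shows "f \<in> generator_domain M L" and "generator M L f = g"
proof -
  have [measurable]: "f \<in> borel_measurable borel"
    using f by (auto simp: C0_def intro: borel_measurable_continuous_onI)
  have "generator_limit M L f g"
  proof (rule generator_limit_of_dynkin[OF g])
    fix t :: real and x assume t: "0 < t"
    interpret dynkin_measures b Q \<nu>' "distr M borel (L t)" "occupation t"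
      using t by (intro dynkin_measures_L) simp
    have "(LINT y|distr M borel (L t). f (x + y)) = (LINT \<omega>|M. f (x + L t \<omega>))"
      using t by (subst integral_distr) auto
    then show "(LINT \<omega>|M. f (x + L t \<omega>)) - f x = (LINT y|occupation t. g (x + y))"
      using D[OF t] unfolding dynkin_def by metis
  qed
  then show "f \<in> generator_domain M L" "generator M L f = g"
    using f g generator_eqI by (auto simp: generator_domain_def)
qed

end

section \<open>The generator on the three function classes\<close>

lemma has_partial_deriv:
  "has_partial j f x \<Longrightarrow> ((\<lambda>s. f (x + s *\<^sub>R axis j 1)) has_real_derivative partial j f x) (at 0)"
  unfolding has_partial_def partial_def by (simp add: DERIV_deriv_iff_real_differentiable)

lemma C0_continuous: "f \<in> C0 \<Longrightarrow> continuous_on UNIV f"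
  by (simp add: C0_def)

lemma C0_family_bounded:
  fixes f :: "'i::finite \<Rightarrow> real ^ 'n \<Rightarrow> real"
  assumes "\<And>i. f i \<in> C0" obtains C where "\<And>i x. \<bar>f i x\<bar> \<le> C"
proof -
  have "\<forall>i. \<exists>C\<ge>0. \<forall>x. \<bar>f i x\<bar> \<le> C" using C0_bounded[OF assms] by metis
  then obtain c where c: "\<And>i. 0 \<le> c i" "\<And>i x. \<bar>f i x\<bar> \<le> c i" by metis
  show ?thesis
  proof (rule that)
    show "\<bar>f i x\<bar> \<le> (\<Sum>i\<in>UNIV. c i)" for i x
      using member_le_sum[of i UNIV c] c by (intro order_trans[OF c(2)]) auto
  qed
qed

lemma C0_inner_gradient:
  assumes "\<And>j. partial j f \<in> C0" shows "(\<lambda>x. v \<bullet> gradient f x) \<in> C0"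
  unfolding inner_vec_def gradient_def using assms by (auto intro!: C0_sum C0_cmult)

lemma C0_holder_increment:
  assumes "f \<in> C0_holder \<beta>"
  obtains D where "\<And>x y. y \<noteq> 0 \<Longrightarrow> \<bar>f (x + y) - f x\<bar> \<le> D * norm y powr \<beta>"
proof -
  obtain D where D: "\<And>x y. x \<noteq> y \<Longrightarrow> \<bar>f x - f y\<bar> / norm (x - y) powr \<beta> \<le> D"
    using assms unfolding C0_holder_def bdd_above_def by blast
  show ?thesis
  proof (rule that[of D])
    show "\<bar>f (x + y) - f x\<bar> \<le> D * norm y powr \<beta>" if "y \<noteq> 0" for x y
      using D[of "x + y" x] that by (simp add: divide_le_eq)
  qed
qed

lemma trace_hessian:
  "1/2 * trace (Q ** hessian f x) = 1/2 * (\<Sum>i\<in>UNIV. \<Sum>j\<in>UNIV. Q $ i $ j * partial j (partial i f) x)"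
  by (simp add: trace_def matrix_matrix_mult_def hessian_def)

context levy_triplet_process
begin

text \<open>The moment hypothesis controls the part in the unit ball and min(|y|^2, 1) the part
  outside; their sum dominates the weight.\<close>

lemma integrable_levy_weight:
  assumes "(\<integral>\<^sup>+ y\<in>{y. 0 < norm y \<and> norm y \<le> 1}. ennreal (norm y powr \<alpha>) \<partial>\<nu>) < \<infinity>"
  shows "integrable \<nu>' (levy_weight \<alpha>)"
proof -
  have "integrable \<nu>' (\<lambda>y. indicator {y. 0 < norm y \<and> norm y \<le> 1} y * norm y powr \<alpha>)"
  proof (rule integrableI_nonneg)
    have "(\<integral>\<^sup>+ y. ennreal (indicator {y. 0 < norm y \<and> norm y \<le> 1} y * norm y powr \<alpha>) \<partial>\<nu>')
        = (\<integral>\<^sup>+ y\<in>{y. 0 < norm y \<and> norm y \<le> 1}. ennreal (norm y powr \<alpha>) \<partial>\<nu>)"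
      by (subst nn_integral_\<nu>') (auto intro!: nn_integral_cong simp: indicator_def)
    then show "(\<integral>\<^sup>+ y. ennreal (indicator {y. 0 < norm y \<and> norm y \<le> 1} y * norm y powr \<alpha>) \<partial>\<nu>') < \<infinity>"
      using assms by simp
  qed auto
  from Bochner_Integration.integrable_add[OF this integrable_min] show ?thesis
  proof (rule Bochner_Integration.integrable_bound)
    show "levy_weight \<alpha> \<in> borel_measurable \<nu>'" unfolding levy_weight_def[abs_def] by measurable
    show "AE y in \<nu>'. norm (levy_weight \<alpha> y) \<le> norm (indicator {y. 0 < norm y \<and> norm y \<le> 1} y * norm y powr \<alpha> + min ((norm y)\<^sup>2) 1)"
      by (rule AE_I2) (auto simp: levy_weight_def indicator_def one_le_power)
  qed
qed

lemma integrable_levy_weight_2: "integrable \<nu>' (levy_weight 2)"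
proof (rule Bochner_Integration.integrable_bound[OF integrable_min])
  show "levy_weight 2 \<in> borel_measurable \<nu>'" unfolding levy_weight_def[abs_def] by measurable
  show "AE y in \<nu>'. norm (levy_weight 2 y) \<le> norm (min ((norm y)\<^sup>2) 1)"
    by (rule AE_I2) (auto simp: levy_weight_def indicator_def one_le_power power_le_one)
qed

text \<open>The common core of (i) and (iii): for (i) it is applied with \<alpha> = 2 and the trace
  term as \<open>q\<close>, for (iii) with Q = 0 and \<open>q = 0\<close>.\<close>

lemma generator_differentiable:
  assumes f: "f \<in> C0" and part: "\<And>j x. has_partial j f x" and g: "\<And>j. partial j f \<in> C0"
    and \<alpha>: "1 \<le> \<alpha>" and w: "integrable \<nu>' (levy_weight \<alpha>)"
    and holder: "\<And>x y j. 0 < norm y \<Longrightarrow> norm y < 1 \<Longrightarrow> \<bar>partial j f (x + y) - partial j f x\<bar> \<le> D * norm y powr (\<alpha> - 1)"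
    and q: "Q = 0 \<and> q = (\<lambda>x. 0) \<or>
      (\<forall>i j. partial i (partial j f) \<in> C0 \<and> (\<forall>x. has_partial i (partial j f) x)) \<and> q = (\<lambda>x. 1/2 * trace (Q ** hessian f x))"
  shows "f \<in> generator_domain M L"
    and "integrable \<nu> (\<lambda>y. f (x + y) - f x - (gradient f x \<bullet> y) * indicator {0<..<1} (norm y))"
    and "generator M L f x = b \<bullet> gradient f x + q x
      + (LINT y|\<nu>. f (x + y) - f x - (gradient f x \<bullet> y) * indicator {0<..<1} (norm y))"
proof -
  have grad: "gradient f x $ j = partial j f x" for x j by (simp add: gradient_def)
  obtain Cf where Cf: "0 \<le> Cf" "\<And>x. \<bar>f x\<bar> \<le> Cf" using C0_bounded[OF f] by blast
  obtain Cg where Cg: "\<And>j x. \<bar>partial j f x\<bar> \<le> Cg" using C0_family_bounded[of "\<lambda>j. partial j f"] g by blast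
  \<comment> \<open>The second derivatives are indexed by pairs so that
    \<open>C0_family_bounded\<close> applies to a single finite type.\<close>
  have "\<exists>Ch. Q = 0 \<and> q = (\<lambda>x. 0) \<or> (\<forall>i j x. \<bar>partial i (partial j f) x\<bar> \<le> Ch)"
  proof (cases "Q = 0 \<and> q = (\<lambda>x. 0)")
    case False
    with q have "\<And>p. partial (fst p) (partial (snd p) f) \<in> C0" by auto
    then obtain C where C: "\<And>p x. \<bar>partial (fst p) (partial (snd p) f) x\<bar> \<le> C"
      using C0_family_bounded[of "\<lambda>p. partial (fst p) (partial (snd p) f)"] by blast
    show ?thesis using C[of "(_, _)"] by auto
  qed simp
  then obtain Ch where Ch: "Q = 0 \<and> q = (\<lambda>x. 0) \<or> (\<forall>i j x. \<bar>partial i (partial j f) x\<bar> \<le> Ch)" by blast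
  define C where "C = max Cf (max Cg Ch)"
  have C: "\<bar>f x\<bar> \<le> C" "\<bar>gradient f x $ j\<bar> \<le> C" for x j
    unfolding C_def grad using Cf(2)[of x] Cg[of j x] by auto
  have contg: "continuous_on UNIV (\<lambda>x. gradient f x $ j)" for j
    unfolding grad using g by (simp add: C0_continuous)
  have der: "((\<lambda>s. f (x + s *\<^sub>R axis j 1)) has_real_derivative gradient f x $ j) (at 0)" for x j
    unfolding grad by (rule has_partial_deriv[OF part])
  have hold: "\<bar>gradient f (x + y) $ j - gradient f x $ j\<bar> \<le> D * norm y powr (\<alpha> - 1)" if "0 < norm y" "norm y < 1" for x y j
    unfolding grad by (rule holder[OF that])
  have q': "Q = 0 \<and> q = (\<lambda>x. 0) \<or>
      (\<exists>h. (\<forall>i j. continuous_on UNIV (h i j)) \<and> (\<forall>i j x. \<bar>h i j x\<bar> \<le> C) \<and>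
        (\<forall>i j x. ((\<lambda>s. gradient f (x + s *\<^sub>R axis i 1) $ j) has_real_derivative h i j x) (at 0)) \<and>
        (\<forall>x. q x = 1/2 * (\<Sum>i\<in>UNIV. \<Sum>j\<in>UNIV. Q $ i $ j * h j i x)))"
  proof (cases "Q = 0 \<and> q = (\<lambda>x. 0)")
    case False
    with q Ch have h: "\<And>i j. partial i (partial j f) \<in> C0" "\<And>i j x. has_partial i (partial j f) x"
        "q = (\<lambda>x. 1/2 * trace (Q ** hessian f x))" "\<And>i j x. \<bar>partial i (partial j f) x\<bar> \<le> Ch"
      by blast+
    have "\<bar>partial i (partial j f) x\<bar> \<le> C" for i j x unfolding C_def using h(4)[of i j x] by simp
    then show ?thesis
      using h(1-3) unfolding grad trace_hessian
      by (intro disjI2 exI[of _ "\<lambda>i j. partial i (partial j f)"]) (auto intro: C0_continuous has_partial_deriv)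
  qed simp
  \<comment> \<open>The jump estimate concerns only \<open>f\<close>, its gradient and
    \<open>\<nu>'\<close>; the instance at time 0 is taken to extract it from the locale.\<close>
  have "dynkin_measures b Q \<nu>' (distr M borel (L 0)) (occupation 0)" by (rule dynkin_measures_L) simp
  note bound = dynkin_measures.dynkin_of_partials(1)[OF this C0_continuous[OF f] C(1) contg C(2) der \<alpha> w hold q']
  have D: "dynkin_measures.dynkin (distr M borel (L t)) (occupation t) f (levy_op b \<nu>' f (gradient f) q)" if "0 < t" for t
    using dynkin_measures.dynkin_of_partials(2)[OF dynkin_measures_L C0_continuous[OF f] C(1) contg C(2) der \<alpha> w hold q'] that
    by simp
  have [measurable]: "f \<in> borel_measurable borel" by (rule borel_measurable_continuous_onI[OF C0_continuous[OF f]])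
  have jm [measurable]: "jump f (gradient f) x \<in> borel_measurable borel" for x unfolding jump_def by measurable
  have jump_C0: "(\<lambda>x. jump f (gradient f) x y) \<in> C0" for y
    unfolding jump_def inner_commute[of "gradient f _"] mult.commute[of _ "indicator _ _ :: real"]
    using f g by (intro C0_minus C0_translate C0_cmult C0_inner_gradient) auto
  have "(\<lambda>x. LINT y|\<nu>'. jump f (gradient f) x y) \<in> C0"
    by (rule C0_integral[OF jump_C0 _ bound integrable_mult_right[OF w]]) measurable
  moreover have "q \<in> C0"
    using q
  proof
    assume "(\<forall>i j. partial i (partial j f) \<in> C0 \<and> (\<forall>x. has_partial i (partial j f) x)) \<and> q = (\<lambda>x. 1/2 * trace (Q ** hessian f x))"
    then show ?thesis unfolding trace_hessian by (elim conjE ssubst) (intro C0_cmult C0_sum, blast)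
  qed simp
  ultimately have op: "levy_op b \<nu>' f (gradient f) q \<in> C0"
    unfolding levy_op_def[abs_def] using g by (intro C0_add C0_inner_gradient) auto
  show "f \<in> generator_domain M L" by (rule generator_of_dynkin[OF f op D])
  have "integrable \<nu>' (jump f (gradient f) x)"
    by (rule Bochner_Integration.integrable_bound[OF integrable_mult_right[OF w]])
      (use order_trans[OF bound abs_ge_self] in \<open>auto intro!: AE_I2\<close>)
  then show "integrable \<nu> (\<lambda>y. f (x + y) - f x - (gradient f x \<bullet> y) * indicator {0<..<1} (norm y))"
    unfolding integral_\<nu>'(2)[OF jm] unfolding jump_def[abs_def] .
  have "generator M L f = levy_op b \<nu>' f (gradient f) q" by (rule generator_of_dynkin[OF f op D])
  then show "generator M L f x = b \<bullet> gradient f x + q x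
      + (LINT y|\<nu>. f (x + y) - f x - (gradient f x \<bullet> y) * indicator {0<..<1} (norm y))"
    unfolding levy_op_def integral_\<nu>'(1)[OF jm] by (simp add: jump_def[abs_def])
qed

lemma generator_holder:
  assumes f: "f \<in> C0_holder \<alpha>" and \<alpha>: "\<alpha> \<le> 1" and w: "integrable \<nu>' (levy_weight \<alpha>)" and Q: "Q = 0"
    and b: "b = (LINT y:{y. 0 < norm y \<and> norm y < 1}|\<nu>. y)"
  shows "f \<in> generator_domain M L" and "integrable \<nu> (\<lambda>y. f (x + y) - f x)"
    and "generator M L f x = (LINT y|\<nu>. f (x + y) - f x)"
proof -
  have f0: "f \<in> C0" using f by (simp add: C0_holder_def)
  obtain C where C: "\<And>x. \<bar>f x\<bar> \<le> C" using C0_bounded[OF f0] by blast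
  obtain D where D: "\<And>x y. y \<noteq> 0 \<Longrightarrow> \<bar>f (x + y) - f x\<bar> \<le> D * norm y powr \<alpha>"
    using C0_holder_increment[OF f] by blast
  then have hold: "\<bar>f (x + y) - f x\<bar> \<le> D * norm y powr \<alpha>" if "0 < norm y" "norm y < 1" for x y using that by simp
  have "(LINT y|\<nu>'. indicator {0<..<1} (norm y) *\<^sub>R y) = (LINT y|\<nu>. indicator {0<..<1} (norm y) *\<^sub>R y)"
    by (rule integral_\<nu>') measurable
  also have "\<dots> = b"
    unfolding b set_lebesgue_integral_def by (intro Bochner_Integration.integral_cong) (auto simp: indicator_def)
  finally have b': "b = (LINT y|\<nu>'. indicator {0<..<1} (norm y) *\<^sub>R y)" ..
  have "dynkin_measures b Q \<nu>' (distr M borel (L 0)) (occupation 0)" by (rule dynkin_measures_L) simp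
  note bound = dynkin_measures.dynkin_of_holder(1)[OF this C0_continuous[OF f0] C \<alpha> w hold Q b']
  have Dyn: "dynkin_measures.dynkin (distr M borel (L t)) (occupation t) f (\<lambda>x. LINT y|\<nu>'. f (x + y) - f x)" if "0 < t" for t
    using dynkin_measures.dynkin_of_holder(2)[OF dynkin_measures_L C0_continuous[OF f0] C \<alpha> w hold Q b'] that by simp
  have [measurable]: "f \<in> borel_measurable borel" by (rule borel_measurable_continuous_onI[OF C0_continuous[OF f0]])
  have op: "(\<lambda>x. LINT y|\<nu>'. f (x + y) - f x) \<in> C0"
    by (rule C0_integral[OF C0_minus[OF C0_translate[OF f0] f0] _ bound integrable_mult_right[OF w]]) measurable
  show "f \<in> generator_domain M L" by (rule generator_of_dynkin[OF f0 op Dyn])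
  have "integrable \<nu>' (\<lambda>y. f (x + y) - f x)"
    by (rule Bochner_Integration.integrable_bound[OF integrable_mult_right[OF w]])
      (use order_trans[OF bound abs_ge_self] in \<open>auto intro!: AE_I2\<close>)
  then show "integrable \<nu> (\<lambda>y. f (x + y) - f x)"
    by (subst (asm) integral_\<nu>') auto
  have "generator M L f = (\<lambda>x. LINT y|\<nu>'. f (x + y) - f x)" by (rule generator_of_dynkin[OF f0 op Dyn])
  then show "generator M L f x = (LINT y|\<nu>. f (x + y) - f x)"
    by (simp add: integral_\<nu>')
qed

end

theorem theorem3p2:
  fixes M :: "'w measure"
    and L :: "real \<Rightarrow> 'w \<Rightarrow> real ^ 'n"
    and b :: "real ^ 'n"
    and Q :: "real ^ 'n ^ 'n"
    and \<nu> :: "(real ^ 'n) measure"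
    and \<alpha> :: real
  assumes "levy_process M L"
    and "has_levy_triplet M L b Q \<nu>"
    and "0 \<le> \<alpha>" and "\<alpha> \<le> 2"
    and "(\<integral>\<^sup>+ y\<in>{y. 0 < norm y \<and> norm y \<le> 1}. ennreal (norm y powr \<alpha>) \<partial>\<nu>) < \<infinity>"
  shows "(C0_diff 2 \<subseteq> generator_domain M L \<and>
          (\<forall>f \<in> C0_diff 2. \<forall>x.
             integrable \<nu> (\<lambda>y. f (x + y) - f x - (gradient f x \<bullet> y) * indicator {0<..<1} (norm y)) \<and>
             generator M L f x =
               b \<bullet> gradient f x + 1/2 * trace (Q ** hessian f x)
               + (LINT y|\<nu>. f (x + y) - f x - (gradient f x \<bullet> y) * indicator {0<..<1} (norm y))))
       \<and> (Q = 0 \<and> \<alpha> \<le> 1 \<and> b = (LINT y:{y. 0 < norm y \<and> norm y < 1}|\<nu>. y) \<longrightarrow>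
          C0_holder \<alpha> \<subseteq> generator_domain M L \<and>
          (\<forall>f \<in> C0_holder \<alpha>. \<forall>x.
             integrable \<nu> (\<lambda>y. f (x + y) - f x) \<and>
             generator M L f x = (LINT y|\<nu>. f (x + y) - f x)))
       \<and> (Q = 0 \<and> 1 \<le> \<alpha> \<longrightarrow>
          C0_1_holder (\<alpha> - 1) \<subseteq> generator_domain M L \<and>
          (\<forall>f \<in> C0_1_holder (\<alpha> - 1). \<forall>x.
             integrable \<nu> (\<lambda>y. f (x + y) - f x - (gradient f x \<bullet> y) * indicator {0<..<1} (norm y)) \<and>
             generator M L f x =
               b \<bullet> gradient f x
               + (LINT y|\<nu>. f (x + y) - f x - (gradient f x \<bullet> y) * indicator {0<..<1} (norm y))))"
proof -
  interpret levy_triplet_process M L b Q \<nu>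
    using assms(1,2) by (simp add: levy_triplet_process_def levy_triplet_process_axioms_def)
  let ?J = "\<lambda>f x y. f (x + y) - f x - (gradient f x \<bullet> y) * indicator {0<..<1} (norm y)"
  have w: "integrable \<nu>' (levy_weight \<alpha>)" by (rule integrable_levy_weight[OF assms(5)])
  \<comment> \<open>The exponent is taken to be 2 here: bounded second derivatives make the first
    derivatives Lipschitz, and \<open>levy_weight 2\<close> is integrable for every Levy
    measure.\<close>
  have smooth: "f \<in> generator_domain M L \<and> (\<forall>x. integrable \<nu> (?J f x) \<and>
      generator M L f x = b \<bullet> gradient f x + 1/2 * trace (Q ** hessian f x) + (LINT y|\<nu>. ?J f x y))"
    if f: "f \<in> C0_diff 2" for f
  proof -
    have f0: "f \<in> C0" and p: "\<And>j x. has_partial j f x" and g: "\<And>j. partial j f \<in> C0"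
      and h: "\<And>i j. partial i (partial j f) \<in> C0" and ph: "\<And>i j x. has_partial i (partial j f) x"
      using f by (auto simp: numeral_2_eq_2)
    obtain C where C: "\<And>j x. \<bar>partial j f x\<bar> \<le> C" using C0_family_bounded[of "\<lambda>j. partial j f"] g by blast
    obtain D where D: "\<And>p x. \<bar>partial (fst p) (partial (snd p) f) x\<bar> \<le> D"
      using C0_family_bounded[of "\<lambda>p. partial (fst p) (partial (snd p) f)"] h by blast
    have "\<bar>partial j f (x + y) - partial j f x\<bar> \<le> (real CARD('n) * D) * norm y powr (2 - 1)"
      if "0 < norm y" "norm y < 1" for x y j
    proof -
      have "\<bar>partial j f (x + y) - partial j f x\<bar> \<le> real CARD('n) * D * norm y"
      proof (rule lipschitz_of_partials[OF C0_continuous[OF g] C, where g = "gradient (partial j f)"])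
        fix i
        show "(\<lambda>x. gradient (partial j f) x $ i) \<in> borel_measurable borel"
          unfolding gradient_def using h by (auto intro: borel_measurable_continuous_onI C0_continuous)
        show "\<bar>gradient (partial j f) x $ i\<bar> \<le> D" for x
          using D[of "(i, j)" x] by (simp add: gradient_def)
        show "((\<lambda>s. partial j f (x + s *\<^sub>R axis i 1)) has_real_derivative gradient (partial j f) x $ i) (at 0)" for x
          unfolding gradient_def using has_partial_deriv[OF ph] by simp
      qed (use that in simp)
      then show ?thesis using that by simp
    qed
    from generator_differentiable[OF f0 p g _ integrable_levy_weight_2 this, of "\<lambda>x. 1/2 * trace (Q ** hessian f x)"]
    show ?thesis using h ph by simp
  qed
  have holder: "f \<in> generator_domain M L \<and> (\<forall>x. integrable \<nu> (\<lambda>y. f (x + y) - f x) \<and>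
      generator M L f x = (LINT y|\<nu>. f (x + y) - f x))"
    if "Q = 0 \<and> \<alpha> \<le> 1 \<and> b = (LINT y:{y. 0 < norm y \<and> norm y < 1}|\<nu>. y)" "f \<in> C0_holder \<alpha>" for f
    using generator_holder[OF that(2) _ w] that(1) by blast
  have holder1: "f \<in> generator_domain M L \<and> (\<forall>x. integrable \<nu> (?J f x) \<and>
      generator M L f x = b \<bullet> gradient f x + (LINT y|\<nu>. ?J f x y))"
    if Q: "Q = 0 \<and> 1 \<le> \<alpha>" and f: "f \<in> C0_1_holder (\<alpha> - 1)" for f
  proof -
    have f0: "f \<in> C0" and p: "\<And>j x. has_partial j f x" and g: "\<And>j. partial j f \<in> C0"
      and gh: "\<And>j. partial j f \<in> C0_holder (\<alpha> - 1)"
      using f by (auto simp: C0_1_holder_def)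
    have "\<forall>j. \<exists>D. \<forall>x y. y \<noteq> 0 \<longrightarrow> \<bar>partial j f (x + y) - partial j f x\<bar> \<le> D * norm y powr (\<alpha> - 1)"
      using C0_holder_increment[OF gh] by metis
    then obtain D where D: "\<And>j x y. y \<noteq> 0 \<Longrightarrow> \<bar>partial j f (x + y) - partial j f x\<bar> \<le> D j * norm y powr (\<alpha> - 1)"
      by metis
    have "\<bar>partial j f (x + y) - partial j f x\<bar> \<le> (\<Sum>j\<in>UNIV. \<bar>D j\<bar>) * norm y powr (\<alpha> - 1)"
      if "0 < norm y" "norm y < 1" for x y j
    proof -
      \<comment> \<open>The Hoelder constants of the partial derivatives are summed in absolute
        value to obtain one constant for all coordinates.\<close>
      have "D j \<le> (\<Sum>j\<in>UNIV. \<bar>D j\<bar>)"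
        using member_le_sum[of j UNIV "\<lambda>j. \<bar>D j\<bar>"] by auto
      then show ?thesis
        using that by (intro order_trans[OF D] mult_right_mono) auto
    qed
    from generator_differentiable[OF f0 p g _ w this, of "\<lambda>x. 0"] show ?thesis using Q by simp
  qed
  show ?thesis
    using smooth holder holder1 by blast
qed

end
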